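(* Let $N\ge 2$, $k,k'\in\{0,\dots,N\}$, and let $q\in\mathbb C^\times$ not be a root of unity. The braiding matrix $$\check R_{k,k'}(z_1/z_2)\colon \textstyle\bigwedge^kV(z_1)\otimes\bigwedge^{k'}V(z_2)\to\bigwedge^{k'}V(z_2)\otimes\bigwedge^kV(z_1),$$ i.e. the isomorphism of $U_qL\mathfrak{gl}_N$-modules (for generic $z_1,z_2\in\mathbb C^\times$) normalized so that $\check R_{k,k'}(z_1/z_2)\,v^k\otimes v^{k'}=(-1)^{kk'}v^{k'}\otimes v^k$, is given by $$\check R_{k,k'}(z_1/z_2)=(-1)^{\min(k,k')}A_{k-k'}(z_1/z_2),$$ where $$A_m(z)=\sum_{j=0}^n(-q)^j\frac{1-q^{|m|}z}{1-q^{2j+|m|}z}\begin{cases}E^{(j)}F^{(j+m)},&\text{if } m\ge0,\\ E^{(j-m)}F^{(j)},&\text{if } m\le0,\end{cases}$$ with $E^{(l)}=E^l/[l]_q!$, $F^{(l)}=F^l/[l]_q!$ and $n=\min(k,k',N-k,N-k')$.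
   Context: $q$-numbers: $[n]_q=\frac{q^n-q^{-n}}{q-q^{-1}}$, $[n]_q!=\prod_{j=1}^n[j]_q$, $[0]_q!=1$. Quantum loop algebra. Indices $i$ are taken in $\mathbb Z/N\mathbb Z$. $U_qL\mathfrak{gl}_N$ is the Hopf algebra over $\mathbb C$ generated by $e_i,f_i$ ($i\in\mathbb Z/N\mathbb Z$) and $t_\lambda$ ($\lambda\in\mathbb Z^N=\oplus_{i}\mathbb Z\epsilon_i$, standard inner product $(\ |\ )$). With $\alpha_i=\epsilon_i-\epsilon_{i+1}$ (so $\alpha_0=\epsilon_N-\epsilon_1$), $t_i=t_{\epsilon_i}$ and $k_i=t_{\alpha_i}=t_it_{i+1}^{-1}$ (so $\prod_i k_i=1$), the relations are $t_\lambda t_\mu=t_{\lambda+\mu}$, $t_0=1$, $t_\lambda e_it_{-\lambda}=q^{(\lambda|\alpha_i)}e_i$, $t_\lambda f_it_{-\lambda}=q^{-(\lambda|\alpha_i)}f_i$, $e_if_j-f_je_i=\delta_{ij}\frac{k_i-k_i^{-1}}{q-q^{-1}}$, and the $q$-Serre relations for the affine Cartan matrix of type $A^{(1)}_{N-1}$. Coproduct: $\Delta(e_i)=e_i\otimes1+k_i\otimes e_i$, $\Delta(f_i)=f_i\otimes k_i^{-1}+1\otimes f_i$, $\Delta(t_\lambda)=t_\lambda\otimes t_\lambda$. Tensor products of modules are defined via $\Delta$. Exterior powers. $V=\mathbb C^N$ with basis $v_1,\dots,v_N$. On $\bigwedge V$ let $\psi_i^*$ be $v\mapsto v_i\wedge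 v$ and $\psi_i$ contraction with the dual basis vector, so $\psi_i\psi_j^*+\psi_j^*\psi_i=\delta_{ij}$, and the $\psi$'s (resp. the $\psi^*$'s) anticommute among themselves; $|0\rangle=1$; $t_i^{\pm1}=q^{\pm\psi_i^*\psi_i}=q^{\pm1}\psi_i^*\psi_i+\psi_i\psi_i^*$. $\bigwedge V$ is $\mathbb Z/2$-graded by degree. For $z\in\mathbb C^\times$, $\bigwedge^jV(z)$ is the vector space $\bigwedge^jV$ with $U_qL\mathfrak{gl}_N$-action $e_i\mapsto\psi_i^*\psi_{i+1}$, $f_i\mapsto\psi_{i+1}^*\psi_i$ for $1\le i\le N-1$, $e_0\mapsto z\psi_N^*\psi_1$, $f_0\mapsto z^{-1}\psi_1^*\psi_N$, and $t_i^{\pm1}\mapsto q^{\pm\psi_i^*\psi_i}=q^{\pm1}\psi_i^*\psi_i+\psi_i\psi_i^*$ for $1\le i\le N$. Put $v^k=\psi_1^*\cdots\psi_k^*|0\rangle\in\bigwedge^kV$. For generic $z_1,z_2$ the module $\bigwedge^kV(z_1)\otimes\bigwedge^{k'}V(z_2)$ is irreducible and isomorphic to the tensor product in the opposite order; the normalized isomorphism, viewed as a linear map of the underlying vector spaces, depends only on $z_1/z_2$. Operators on $\bigwedge V\otimes\bigwedge V$. Tensor products of linear maps act with the sign rule $(f\otimes g)(v\otimes w)=(-1)^{|g||v|}fv\otimes gw$. With $K_i=t_i\otimes t_i^{-1}$ ($i=1,\dots,N$), $$E=\sum_{i=1}^N(\psi_i^*\otimes\psi_i)\prod_{j>i}K_j,\qquad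 F=-\sum_{i=1}^N\prod_{j<i}K_j^{-1}(\psi_i\otimes\psi_i^* ).$$ *)

theory Defs
  imports Complex_Main "HOL-Library.Function_Algebras"
begin

section \<open>Coordinate vectors and operators\<close>

text \<open>A vector is its coefficient function \<open>'b \<Rightarrow> complex\<close> with respect to a basis indexed by
  (a finite subset of) \<open>'b\<close>; addition and zero are pointwise.\<close>

definition cscale :: "complex \<Rightarrow> ('b \<Rightarrow> complex) \<Rightarrow> ('b \<Rightarrow> complex)" (infixr "\<odot>" 75)
  where "c \<odot> u = (\<lambda>b. c * u b)"

interpretation cfun: vector_space "cscale :: complex \<Rightarrow> ('b \<Rightarrow> complex) \<Rightarrow> ('b \<Rightarrow> complex)"
  by unfold_locales (auto simp: cscale_def fun_eq_iff algebra_simps)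

definition basis_vec :: "'b \<Rightarrow> ('b \<Rightarrow> complex)"
  where "basis_vec a = (\<lambda>b. if b = a then 1 else 0)"

definition linear_map_on :: "('b \<Rightarrow> complex) set \<Rightarrow> (('b \<Rightarrow> complex) \<Rightarrow> ('c \<Rightarrow> complex)) \<Rightarrow> bool"
  where "linear_map_on W f \<longleftrightarrow>
    (\<forall>u\<in>W. \<forall>w\<in>W. f (u + w) = f u + f w) \<and> (\<forall>c. \<forall>u\<in>W. f (c \<odot> u) = c \<odot> f u)"

definition op_prod :: "('v \<Rightarrow> 'v) list \<Rightarrow> ('v \<Rightarrow> 'v)"
  where "op_prod fs = foldr (\<circ>) fs id"

section \<open>q-numbers\<close>

definition qnum :: "complex \<Rightarrow> nat \<Rightarrow> complex"
  where "qnum q n = (q ^ n - inverse q ^ n) / (q - inverse q)"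

definition qfact :: "complex \<Rightarrow> nat \<Rightarrow> complex"
  where "qfact q n = (\<Prod>j=1..n. qnum q j)"

definition qbinom :: "complex \<Rightarrow> nat \<Rightarrow> nat \<Rightarrow> complex"
  where "qbinom q n r = qfact q n / (qfact q r * qfact q (n - r))"

section \<open>Modules over the quantum loop algebra of gl_N\<close>

text \<open>Elements of \<open>\<int>/N\<int>\<close> are represented by \<open>0, \<dots>, N - 1\<close>, while the \<open>\<epsilon>\<^sub>j\<close>, the \<open>v\<^sub>j\<close> and
  the \<open>\<psi>\<^sub>j\<close> are numbered by the representatives \<open>1, \<dots>, N\<close>; \<open>cyc N i\<close> is the representative
  of \<open>i\<close> in the latter range. For \<open>i < N\<close> the class of \<open>i + 1\<close> is represented by \<open>i + 1\<close> itself.\<close>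

definition cyc :: "nat \<Rightarrow> nat \<Rightarrow> nat"
  where "cyc N i = (if i = 0 then N else i)"

definition weight_lattice :: "nat \<Rightarrow> (nat \<Rightarrow> int) set"
  where "weight_lattice N = {\<nu>. \<forall>j. j \<notin> {1..N} \<longrightarrow> \<nu> j = 0}"

definition weight_inner :: "nat \<Rightarrow> (nat \<Rightarrow> int) \<Rightarrow> (nat \<Rightarrow> int) \<Rightarrow> int"
  where "weight_inner N \<nu> \<mu> = (\<Sum>j=1..N. \<nu> j * \<mu> j)"

definition eps :: "nat \<Rightarrow> (nat \<Rightarrow> int)"
  where "eps j = (\<lambda>l. if l = j then 1 else 0)"

definition sroot :: "nat \<Rightarrow> nat \<Rightarrow> (nat \<Rightarrow> int)"
  where "sroot N i = eps (cyc N i) - eps (i + 1)"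

text \<open>For \<open>N \<ge> 2\<close> the Gram matrix of the \<open>\<alpha>\<^sub>i\<close> is the affine Cartan matrix of type
  \<open>A\<^bsub>N-1\<^esub>\<^bsup>(1)\<^esup>\<close>, including the off-diagonal entries \<open>-2\<close> for \<open>N = 2\<close>.\<close>

definition cartan :: "nat \<Rightarrow> nat \<Rightarrow> nat \<Rightarrow> int"
  where "cartan N i j = weight_inner N (sroot N i) (sroot N j)"

record 'b uq_mod =
  space_of :: "('b \<Rightarrow> complex) set"
  act_e :: "nat \<Rightarrow> ('b \<Rightarrow> complex) \<Rightarrow> ('b \<Rightarrow> complex)"
  act_f :: "nat \<Rightarrow> ('b \<Rightarrow> complex) \<Rightarrow> ('b \<Rightarrow> complex)"
  act_t :: "(nat \<Rightarrow> int) \<Rightarrow> ('b \<Rightarrow> complex) \<Rightarrow> ('b \<Rightarrow> complex)"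

definition serre_at ::
  "complex \<Rightarrow> nat \<Rightarrow> (nat \<Rightarrow> ('b \<Rightarrow> complex) \<Rightarrow> ('b \<Rightarrow> complex)) \<Rightarrow> nat \<Rightarrow> nat \<Rightarrow> ('b \<Rightarrow> complex) \<Rightarrow> bool"
  where "serre_at q N x i j u \<longleftrightarrow>
    (let m = nat (1 - cartan N i j) in
      (\<Sum>r=0..m. ((-1) ^ r * qbinom q m r) \<odot> (x i ^^ (m - r)) (x j ((x i ^^ r) u))) = 0)"

text \<open>A module over an algebra given by generators and relations is a vector space with linear
  actions of the generators satisfying the relations.\<close>

definition is_uq_module :: "complex \<Rightarrow> nat \<Rightarrow> 'b uq_mod \<Rightarrow> bool"
  where "is_uq_module q N M \<longleftrightarrow>
    (let W = space_of M; P = weight_lattice N; e = act_e M; f = act_f M; t = act_t M in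
      cfun.subspace W \<and>
      (\<forall>i<N. linear_map_on W (e i) \<and> e i ` W \<subseteq> W) \<and>
      (\<forall>i<N. linear_map_on W (f i) \<and> f i ` W \<subseteq> W) \<and>
      (\<forall>\<nu>\<in>P. linear_map_on W (t \<nu>) \<and> t \<nu> ` W \<subseteq> W) \<and>
      (\<forall>u\<in>W.
        t 0 u = u \<and>
        (\<forall>\<nu>\<in>P. \<forall>\<mu>\<in>P. t \<nu> (t \<mu> u) = t (\<nu> + \<mu>) u) \<and>
        (\<forall>\<nu>\<in>P. \<forall>i<N. t \<nu> (e i (t (- \<nu>) u)) = (q powi weight_inner N \<nu> (sroot N i)) \<odot> e i u) \<and>
        (\<forall>\<nu>\<in>P. \<forall>i<N. t \<nu> (f i (t (- \<nu>) u)) = (q powi (- weight_inner N \<nu> (sroot N i))) \<odot> f i u) \<and>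
        (\<forall>i<N. \<forall>j<N. e i (f j u) - f j (e i u) =
          (if i = j then (1 / (q - inverse q)) \<odot> (t (sroot N i) u - t (- sroot N i) u) else 0)) \<and>
        (\<forall>i<N. \<forall>j<N. i \<noteq> j \<longrightarrow> serre_at q N e i j u \<and> serre_at q N f i j u)))"

definition is_uq_iso ::
  "complex \<Rightarrow> nat \<Rightarrow> 'b uq_mod \<Rightarrow> 'c uq_mod \<Rightarrow> (('b \<Rightarrow> complex) \<Rightarrow> ('c \<Rightarrow> complex)) \<Rightarrow> bool"
  where "is_uq_iso q N M M' R \<longleftrightarrow>
    is_uq_module q N M \<and> is_uq_module q N M' \<and>
    linear_map_on (space_of M) R \<and> bij_betw R (space_of M) (space_of M') \<and>
    (\<forall>u\<in>space_of M.
      (\<forall>i<N. R (act_e M i u) = act_e M' i (R u)) \<and>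
      (\<forall>i<N. R (act_f M i u) = act_f M' i (R u)) \<and>
      (\<forall>\<nu>\<in>weight_lattice N. R (act_t M \<nu> u) = act_t M' \<nu> (R u)))"

section \<open>The exterior algebra\<close>

text \<open>The basis vector indexed by \<open>I = {i\<^sub>1 < \<dots> < i\<^sub>r} \<subseteq> {1..N}\<close> is
  \<open>v\<^bsub>i\<^sub>1\<^esub> \<and> \<dots> \<and> v\<^bsub>i\<^sub>r\<^esub>\<close>.\<close>

type_synonym ext = "nat set \<Rightarrow> complex"
type_synonym ext2 = "nat set \<times> nat set \<Rightarrow> complex"

definition ext_power :: "nat \<Rightarrow> nat \<Rightarrow> ext set"
  where "ext_power N j = {u. \<forall>I. u I \<noteq> 0 \<longrightarrow> I \<subseteq> {1..N} \<and> card I = j}"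

text \<open>The sign counts the factors that \<open>v\<^sub>i\<close> has to pass on its way to or from the front.\<close>

definition psi_star :: "nat \<Rightarrow> ext \<Rightarrow> ext"
  where "psi_star i u = (\<lambda>A. if i \<in> A then (-1) ^ card {a \<in> A. a < i} * u (A - {i}) else 0)"

definition psi :: "nat \<Rightarrow> ext \<Rightarrow> ext"
  where "psi i u = (\<lambda>A. if i \<in> A then 0 else (-1) ^ card {a \<in> A. a < i} * u (insert i A))"

definition vac :: ext
  where "vac = basis_vec {}"

definition v_top :: "nat \<Rightarrow> ext"
  where "v_top k = op_prod (map psi_star [1..<k + 1]) vac"

text \<open>\<open>t_pow q i n\<close> is the power \<open>t\<^sub>i\<^sup>n = q\<^bsup>n \<psi>\<^sub>i\<^sup>* \<psi>\<^sub>i\<^esup>\<close>.\<close>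

definition t_pow :: "complex \<Rightarrow> nat \<Rightarrow> int \<Rightarrow> ext \<Rightarrow> ext"
  where "t_pow q i n u = (q powi n) \<odot> psi_star i (psi i u) + psi i (psi_star i u)"

definition ext_module :: "complex \<Rightarrow> nat \<Rightarrow> nat \<Rightarrow> complex \<Rightarrow> nat set uq_mod"
  where "ext_module q N j z =
    \<lparr> space_of = ext_power N j,
      act_e = (\<lambda>i u. if i = 0 then z \<odot> psi_star N (psi 1 u) else psi_star i (psi (i + 1) u)),
      act_f = (\<lambda>i u. if i = 0 then inverse z \<odot> psi_star 1 (psi N u) else psi_star (i + 1) (psi i u)),
      act_t = (\<lambda>\<nu>. op_prod (map (\<lambda>i. t_pow q i (\<nu> i)) [1..<N + 1])) \<rparr>"

section \<open>Tensor products\<close>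

definition tensor_vec :: "ext \<Rightarrow> ext \<Rightarrow> ext2"
  where "tensor_vec u w = (\<lambda>(A, B). u A * w B)"

text \<open>The tensor product of linear maps with the sign rule: the component of \<open>g\<close> from \<open>v\<^sub>J\<close> to \<open>v\<^sub>B\<close>
  has parity \<open>|J| + |B|\<close>, so it contributes the sign \<open>(-1)\<^bsup>(|J| + |B|) |I|\<^esup>\<close> when \<open>f \<otimes> g\<close> is
  applied to \<open>v\<^sub>I \<otimes> v\<^sub>J\<close>. This extends the rule for homogeneous \<open>g\<close> bilinearly.\<close>

definition tensor_op :: "nat \<Rightarrow> (ext \<Rightarrow> ext) \<Rightarrow> (ext \<Rightarrow> ext) \<Rightarrow> ext2 \<Rightarrow> ext2"
  where "tensor_op N f g x = (\<lambda>(A, B). \<Sum>I\<in>Pow {1..N}. \<Sum>J\<in>Pow {1..N}.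
    (-1) ^ ((card J + card B) * card I) * x (I, J) * f (basis_vec I) A * g (basis_vec J) B)"

text \<open>The tensor product along the coproduct; it is only used for submodules of the exterior
  algebra, on which the generators act by even operators, so that the sign rule plays no role.\<close>

definition tensor_module :: "nat \<Rightarrow> nat set uq_mod \<Rightarrow> nat set uq_mod \<Rightarrow> (nat set \<times> nat set) uq_mod"
  where "tensor_module N M M' =
    \<lparr> space_of = cfun.span {tensor_vec u w | u w. u \<in> space_of M \<and> w \<in> space_of M'},
      act_e = (\<lambda>i x. tensor_op N (act_e M i) id x + tensor_op N (act_t M (sroot N i)) (act_e M' i) x),
      act_f = (\<lambda>i x. tensor_op N (act_f M i) (act_t M' (- sroot N i)) x + tensor_op N id (act_f M' i) x),
      act_t = (\<lambda>\<nu>. tensor_op N (act_t M \<nu>) (act_t M' \<nu>)) \<rparr>"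

section \<open>The operators E, F and A_m\<close>

definition K_op :: "complex \<Rightarrow> nat \<Rightarrow> nat \<Rightarrow> ext2 \<Rightarrow> ext2"
  where "K_op q N i = tensor_op N (t_pow q i 1) (t_pow q i (-1))"

definition K_inv_op :: "complex \<Rightarrow> nat \<Rightarrow> nat \<Rightarrow> ext2 \<Rightarrow> ext2"
  where "K_inv_op q N i = tensor_op N (t_pow q i (-1)) (t_pow q i 1)"

definition E_op :: "complex \<Rightarrow> nat \<Rightarrow> ext2 \<Rightarrow> ext2"
  where "E_op q N x = (\<Sum>i=1..N.
    tensor_op N (psi_star i) (psi i) (op_prod (map (K_op q N) [i + 1..<N + 1]) x))"

definition F_op :: "complex \<Rightarrow> nat \<Rightarrow> ext2 \<Rightarrow> ext2"
  where "F_op q N x = - (\<Sum>i=1..N.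
    op_prod (map (K_inv_op q N) [1..<i]) (tensor_op N (psi i) (psi_star i) x))"

definition div_pow :: "complex \<Rightarrow> (ext2 \<Rightarrow> ext2) \<Rightarrow> nat \<Rightarrow> ext2 \<Rightarrow> ext2"
  where "div_pow q X l x = (1 / qfact q l) \<odot> (X ^^ l) x"

definition A_op :: "complex \<Rightarrow> nat \<Rightarrow> nat \<Rightarrow> int \<Rightarrow> complex \<Rightarrow> ext2 \<Rightarrow> ext2"
  where "A_op q N n m z x = (\<Sum>j=0..n.
    ((- q) ^ j * ((1 - q ^ nat \<bar>m\<bar> * z) / (1 - q ^ (2 * j + nat \<bar>m\<bar>) * z))) \<odot>
      (if m \<ge> 0 then div_pow q (E_op q N) j (div_pow q (F_op q N) (j + nat m) x)
       else div_pow q (E_op q N) (j + nat (- m)) (div_pow q (F_op q N) j x)))"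

section \<open>The braiding\<close>

definition ext_tensor :: "complex \<Rightarrow> nat \<Rightarrow> nat \<Rightarrow> complex \<Rightarrow> nat \<Rightarrow> complex \<Rightarrow> (nat set \<times> nat set) uq_mod"
  where "ext_tensor q N k z k' z' = tensor_module N (ext_module q N k z) (ext_module q N k' z')"

definition is_braiding ::
  "complex \<Rightarrow> nat \<Rightarrow> nat \<Rightarrow> nat \<Rightarrow> complex \<Rightarrow> complex \<Rightarrow> (ext2 \<Rightarrow> ext2) \<Rightarrow> bool"
  where "is_braiding q N k k' z1 z2 R \<longleftrightarrow>
    is_uq_iso q N (ext_tensor q N k z1 k' z2) (ext_tensor q N k' z2 k z1) R \<and>
    R (tensor_vec (v_top k) (v_top k')) = (-1) ^ (k * k') \<odot> tensor_vec (v_top k') (v_top k)"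

end

theory Submission
  imports Defs "HOL-Computational_Algebra.Polynomial"
begin

text \<open>
  Why the theorem holds. All operators are elements of the ring of linear endomorphisms of the functions on
  pairs of subsets of \<open>\<nat>\<close>. With one fermion for every \<open>v\<^sub>i\<close> and every tensor factor, \<open>E\<close>, \<open>F\<close> and
  \<open>K = \<Prod>\<^sub>i K\<^sub>i\<close> generate a copy of quantum \<open>sl\<^sub>2\<close> that commutes with the action of \<open>e\<^sub>i\<close>, \<open>f\<^sub>i\<close> (\<open>1 \<le> i < N\<close>) and
  \<open>t\<^sub>\<nu>\<close>; this is skew Howe duality. Any combination of the products \<open>E\<^bsup>(a)\<^esup> F\<^bsup>(b)\<^esup>\<close> is therefore equivariant for
  these generators, and the coefficients are forced by \<open>e\<^sub>0\<close> and \<open>f\<^sub>0\<close>.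

  Write \<open>\<Delta>(e\<^sub>0) = z\<^sub>1 X + z\<^sub>2 Y\<close> on the source; on the target it is \<open>z\<^sub>2 X + z\<^sub>1 Y\<close>, and with \<open>z = z\<^sub>1 / z\<^sub>2\<close> the task is
  \<open>A(z) (z X + Y) = (X + z Y) A(z)\<close>. The operators \<open>X\<close>, \<open>Y\<close> and two further ones \<open>U\<close>, \<open>V\<close> are closed under
  \<open>q\<close>-commutators with \<open>E\<close> and \<open>F\<close> (\<open>twisted_adjoint\<close>). Moving \<open>X\<close> and \<open>Y\<close> through one product
  \<open>E\<^bsup>(a)\<^esup> F\<^bsup>(b)\<^esup>\<close> leaves a defect with the factor \<open>1 - q\<^bsup>a+b\<^esup> z\<close>, which is the denominator in \<open>A(z)\<close>
  (\<open>product_defect\<close>). After its cancellation nothing depends on \<open>z\<close>; the sum telescopes up to the multiple of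
  an alternating sum of products \<open>E\<^bsup>(a)\<^esup> F\<^bsup>(b-1)\<^esup>\<close>, and this vanishes in every nilpotent representation of
  quantum \<open>sl\<^sub>2\<close> (\<open>alternating_sum_zero\<close>). For \<open>f\<^sub>0\<close> the same relations hold by a mirror symmetry which exchanges
  the tensor factors and reverses the order of \<open>1, \<dots>, N\<close>.

  The tensor products are modules because the coproducts \<open>e\<^sub>i = a + b\<close> are sums of two operators that square to
  zero and \<open>q\<close>-commute, which reduces the Serre relations to reordering words. The value on
  \<open>v\<^sup>k \<otimes> v\<^bsup>k'\<^esup>\<close> is found by splitting off one site at a time.

  Bijectivity and uniqueness both come from one fact, \<open>generic_cyclicity\<close>: for all but finitely many \<open>z\<close> the vector
  \<open>v\<^sup>k \<otimes> v\<^bsup>k'\<^esup>\<close> generates the module. In the limit \<open>z\<^sub>2 / z\<^sub>1 \<longrightarrow> 0\<close> the operator \<open>\<Delta>(e\<^sub>0) / z\<^sub>1\<close> acts on the first factor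
  only, and all basis vectors can then be reached by moving particles around a circle; an elimination argument
  over the polynomials carries this back to generic parameters. The composite of the two candidates in opposite
  directions is an intertwiner fixing a cyclic vector, hence the identity; and any other braiding agrees with the
  candidate on a cyclic vector, hence everywhere.
\<close>

section \<open>The ring of linear operators\<close>

typedef endo = "{f :: ext2 \<Rightarrow> ext2. linear_map_on UNIV f}" morphisms ap Endo
  by (rule exI[of _ id]) (simp add: linear_map_on_def)

setup_lifting type_definition_endo

lemma ap_linear: "linear_map_on UNIV (ap T)"
  using ap[of T] by simp

lemma ap_add: "ap T (u + w) = ap T u + ap T w"
  and ap_scale: "ap T (c \<odot> u) = c \<odot> ap T u"
  using ap_linear[of T] by (simp_all add: linear_map_on_def)

lemma ap_0 [simp]: "ap T 0 = 0"
  using ap_scale[of T 0 0] by simp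

lemma ap_sum: "ap T (sum f S) = (\<Sum>i\<in>S. ap T (f i))"
proof (induction S rule: infinite_finite_induct)
  case (insert x F)
  then show ?case by (simp only: sum.insert[OF insert.hyps(1,2)] ap_add)
next
  case (infinite A)
  then show ?case by (simp only: sum.infinite[OF infinite.hyps] ap_0)
qed (simp only: sum.empty ap_0)

lemma ap_eqI: "(\<And>x. ap S x = ap T x) \<Longrightarrow> S = T"
  by (simp add: ap_inject[symmetric] fun_eq_iff)

instantiation endo :: ring_1
begin

lift_definition zero_endo :: endo is "\<lambda>u. 0"
  by (simp add: linear_map_on_def)
lift_definition one_endo :: endo is "\<lambda>u. u"
  by (simp add: linear_map_on_def)
lift_definition plus_endo :: "endo \<Rightarrow> endo \<Rightarrow> endo" is "\<lambda>S T u. S u + T u"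
  by (simp add: linear_map_on_def algebra_simps cfun.scale_right_distrib)
lift_definition uminus_endo :: "endo \<Rightarrow> endo" is "\<lambda>S u. - S u"
  by (simp add: linear_map_on_def algebra_simps)
lift_definition minus_endo :: "endo \<Rightarrow> endo \<Rightarrow> endo" is "\<lambda>S T u. S u - T u"
  by (simp add: linear_map_on_def algebra_simps cfun.scale_right_diff_distrib)
lift_definition times_endo :: "endo \<Rightarrow> endo \<Rightarrow> endo" is "\<lambda>S T u. S (T u)"
  by (simp add: linear_map_on_def)

instance
proof
  show "(0::endo) \<noteq> 1"
  proof
    assume "(0::endo) = 1"
    then have "ap 0 (\<lambda>_. 1) = ap 1 (\<lambda>_. 1)" by simp
    then show False by (simp add: zero_endo.rep_eq one_endo.rep_eq fun_eq_iff)
  qed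
qed (rule ap_eqI, simp add: zero_endo.rep_eq one_endo.rep_eq plus_endo.rep_eq uminus_endo.rep_eq
       minus_endo.rep_eq times_endo.rep_eq ap_add algebra_simps)+

end

lift_definition scl :: "complex \<Rightarrow> endo \<Rightarrow> endo" (infixr "\<bullet>" 75) is "\<lambda>c T u. c \<odot> T u"
  by (simp add: linear_map_on_def cfun.scale_right_distrib mult.commute)

lemmas ap_simps = zero_endo.rep_eq one_endo.rep_eq plus_endo.rep_eq uminus_endo.rep_eq
  minus_endo.rep_eq times_endo.rep_eq scl.rep_eq

lemma ap_sum_left: "ap (sum f S) x = (\<Sum>i\<in>S. ap (f i) x)"
  by (induction S rule: infinite_finite_induct) (simp_all add: ap_simps)

lemma scl_times [simp]: "(c \<bullet> S) * T = c \<bullet> (S * T)"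
  by (rule ap_eqI) (simp add: ap_simps)

lemma times_scl [simp]: "S * (c \<bullet> T) = c \<bullet> (S * T)"
  by (rule ap_eqI) (simp add: ap_simps ap_scale)

lemma scl_scl [simp]: "c \<bullet> d \<bullet> T = (c * d) \<bullet> T"
  by (rule ap_eqI) (simp add: ap_simps)

lemma scl_1 [simp]: "1 \<bullet> T = T"
  by (rule ap_eqI) (simp add: ap_simps)

lemma scl_0 [simp]: "0 \<bullet> T = 0" "c \<bullet> 0 = 0"
  by (rule ap_eqI, simp add: ap_simps)+

lemma scl_minus [simp]: "(- c) \<bullet> T = - (c \<bullet> T)" "c \<bullet> (- T) = - (c \<bullet> T)"
  by (rule ap_eqI, simp add: ap_simps)+

lemma scl_add: "c \<bullet> (S + T) = c \<bullet> S + c \<bullet> T" "c \<bullet> (S - T) = c \<bullet> S - c \<bullet> T"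
  by (rule ap_eqI, simp add: ap_simps cfun.scale_right_distrib cfun.scale_right_diff_distrib)+

lemma scl_add_left: "(c + d) \<bullet> T = c \<bullet> T + d \<bullet> T" "(c - d) \<bullet> T = c \<bullet> T - d \<bullet> T"
  by (rule ap_eqI, simp add: ap_simps cfun.scale_left_distrib cfun.scale_left_diff_distrib)+

lemma scl_sum: "c \<bullet> sum f S = (\<Sum>i\<in>S. c \<bullet> f i)"
  by (induction S rule: infinite_finite_induct) (simp_all add: scl_add)

lemma scl_cancel: "c \<noteq> 0 \<Longrightarrow> c \<bullet> S = c \<bullet> T \<Longrightarrow> S = T"
  by (metis scl_1 scl_scl left_inverse)

section \<open>Quantum integers and divided powers\<close>

locale generic_q =
  fixes q :: complex
  assumes q_nz [simp]: "q \<noteq> 0" and q_generic: "\<And>n. n \<ge> 1 \<Longrightarrow> q ^ n \<noteq> 1"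
begin

text \<open>The quantum integers at all integers, which is where weights live.\<close>

definition qint :: "int \<Rightarrow> complex"
  where "qint n = (q powi n - q powi (- n)) / (q - inverse q)"

lemma powi_generic: "n \<noteq> 0 \<Longrightarrow> q powi n \<noteq> 1"
proof (cases "n \<ge> 0")
  case True
  assume "n \<noteq> 0"
  with True q_generic[of "nat n"] show ?thesis by (simp add: power_int_def)
next
  case False
  with q_generic[of "nat (- n)"] show ?thesis
    by (simp add: power_int_def power_inverse)
qed

lemma q_diff_nz [simp]: "q - inverse q \<noteq> 0"
proof
  assume "q - inverse q = 0"
  then have "q ^ 2 = 1" by (simp add: power2_eq_square field_simps)
  then show False using q_generic[of 2] by simp
qed

lemma q_ne_inverse [simp]: "q \<noteq> inverse q" "inverse q \<noteq> q"
  using q_diff_nz by auto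

lemma qint_nz: "n \<noteq> 0 \<Longrightarrow> qint n \<noteq> 0"
proof
  assume n: "n \<noteq> 0" and "qint n = 0"
  then have "q powi n = q powi (- n)" using q_diff_nz unfolding qint_def by (simp del: q_diff_nz)
  then have "q powi (2 * n) = 1"
    by (simp add: power_int_minus field_simps flip: power_int_add) 
  with powi_generic[of "2 * n"] n show False by simp
qed

lemma qint_0 [simp]: "qint 0 = 0" by (simp add: qint_def)
lemma qint_minus [simp]: "qint (- n) = - qint n"
  unfolding qint_def by (metis minus_diff_eq minus_divide_left minus_minus)
lemma qint_1 [simp]: "qint 1 = 1" using q_diff_nz by (simp add: qint_def power_int_minus del: q_diff_nz)

lemma qnum_qint: "qnum q n = qint (int n)"
  by (simp add: qnum_def qint_def power_int_minus power_inverse)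

lemma qfact_nz [simp]: "qfact q n \<noteq> 0"
  by (simp add: qfact_def qnum_qint qint_nz)

lemma qfact_Suc: "qfact q (Suc n) = qint (int n + 1) * qfact q n"
  by (simp add: qfact_def qnum_qint add.commute mult.commute)

text \<open>Divided powers are indexed by integers, with value \<open>0\<close> at negative indices: the
  commutation formulas below then hold without boundary cases.\<close>

definition dpow :: "endo \<Rightarrow> int \<Rightarrow> endo"
  where "dpow T n = (if n < 0 then 0 else (1 / qfact q (nat n)) \<bullet> T ^ nat n)"

lemma dpow_neg [simp]: "n < 0 \<Longrightarrow> dpow T n = 0" by (simp add: dpow_def)
lemma dpow_0 [simp]: "dpow T 0 = 1" by (simp add: dpow_def qfact_def)
lemma dpow_left: "T * dpow T n = qint (n + 1) \<bullet> dpow T (n + 1)"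
proof -
  consider "n < -1" | "n = -1" | "n \<ge> 0" by linarith
  then show ?thesis
  proof cases
    case 3
    then have "nat (n + 1) = Suc (nat n)" "int (nat n) = n" by auto
    then show ?thesis using 3 qint_nz[of "n+1"] by (simp add: dpow_def qfact_Suc field_simps)
  qed auto
qed

lemma dpow_right: "dpow T n * T = qint (n + 1) \<bullet> dpow T (n + 1)"
proof -
  have "dpow T n * T = T * dpow T n" by (simp add: dpow_def power_commutes)
  then show ?thesis by (simp add: dpow_left)
qed

lemma dpow_eqI:
  assumes "n \<noteq> 0" "qint n \<bullet> S = qint n \<bullet> T"
  shows "S = T"
  using scl_cancel[OF qint_nz] assms by blast

text \<open>Induction for statements about integer-indexed divided powers, which are trivial below \<open>0\<close>.\<close>

lemma int_step_induct:
  fixes P :: "int \<Rightarrow> bool"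
  assumes "\<And>n. n < 0 \<Longrightarrow> P n" "P 0" "\<And>n. n \<ge> 0 \<Longrightarrow> P n \<Longrightarrow> P (n + 1)"
  shows "P n"
proof (cases "n < 0")
  case False
  then have "n \<ge> 0" by simp
  then show ?thesis by (induction rule: int_ge_induct) (use assms in auto)
qed (rule assms(1))

lemma qint_mult_denominator: "qint n * (q - inverse q) = q powi n - q powi (- n)"
  unfolding qint_def using q_diff_nz by (simp del: q_diff_nz)

lemma qint_eqI: "c * (q - inverse q) = q powi n - q powi (- n) \<Longrightarrow> qint n = c"
  using qint_mult_denominator[of n] q_diff_nz by (metis mult_right_cancel)

lemma qint_Suc: "qint (n + 1) = q powi n + inverse q * qint n"
proof (rule qint_eqI)
  have "(q powi n + inverse q * qint n) * (q - inverse q) =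
      q powi n * (q - inverse q) + inverse q * (q powi n - q powi (- n))"
    by (simp only: distrib_right mult.assoc qint_mult_denominator)
  also have "\<dots> = q powi (n + 1) - q powi (- (n + 1))"
    by (simp add: power_int_add power_int_diff power_int_minus right_diff_distrib divide_inverse mult.commute)
  finally show "(q powi n + inverse q * qint n) * (q - inverse q) = q powi (n + 1) - q powi (- (n + 1))" .
qed

lemma qint_Suc': "qint (n + 1) = q powi (- n) + q * qint n"
proof (rule qint_eqI)
  have "(q powi (- n) + q * qint n) * (q - inverse q) =
      q powi (- n) * (q - inverse q) + q * (q powi n - q powi (- n))"
    by (simp only: distrib_right mult.assoc qint_mult_denominator)
  also have "\<dots> = q powi (n + 1) - q powi (- (n + 1))"
    by (simp add: power_int_add power_int_diff power_int_minus right_diff_distrib divide_inverse mult.commute)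
  finally show "(q powi (- n) + q * qint n) * (q - inverse q) = q powi (n + 1) - q powi (- (n + 1))" .
qed

lemma qint_mult: "qint a * qint b * (q - inverse q)\<^sup>2 =
    q powi (a + b) + q powi (- a - b) - q powi (a - b) - q powi (b - a)"
proof -
  have "qint a * qint b * (q - inverse q)\<^sup>2 = (qint a * (q - inverse q)) * (qint b * (q - inverse q))"
    by (simp only: power2_eq_square mult_ac)
  also have "\<dots> = q powi (a + b) + q powi (- a - b) - q powi (a - b) - q powi (b - a)"
    unfolding qint_mult_denominator unfolding left_diff_distrib right_diff_distrib
    by (simp flip: power_int_add)
  finally show ?thesis .
qed

text \<open>The identity that makes the commutators of \<open>F\<close> with divided powers of \<open>E\<close> add up.\<close>

lemma qint_exchange: "qint (n + 1) * qint (m + n) = qint m + qint n * qint (m + n + 1)"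
proof -
  have e: "- m - 1 = -1 - m" by simp
  have "(qint m + qint n * qint (m + n + 1)) * (q - inverse q)\<^sup>2 =
      qint m * qint 1 * (q - inverse q)\<^sup>2 + qint n * qint (m + n + 1) * (q - inverse q)\<^sup>2"
    by (simp only: distrib_right qint_1 mult_1_right)
  also have "\<dots> = qint (n + 1) * qint (m + n) * (q - inverse q)\<^sup>2"
    unfolding qint_mult by (simp add: algebra_simps e)
  finally show ?thesis using q_diff_nz by (metis mult_right_cancel power_not_zero)
qed

end

section \<open>Nilpotent representations of quantum sl2\<close>

text \<open>Vectors are replaced by elements \<open>x\<close> of the operator ring itself, on which the ring acts from
  the left; a weight vector is an \<open>x\<close> with \<open>K x = q\<^sup>m x\<close>. The projection onto a tensor product of two
  exterior powers is such an \<open>x\<close>, and this turns identities that hold on one weight space into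
  identities in a ring.\<close>

locale quantum_sl2 = generic_q +
  fixes E F K Ki :: endo and L :: nat
  assumes K_Ki: "K * Ki = 1" and Ki_K: "Ki * K = 1"
    and KE: "K * E = q\<^sup>2 \<bullet> (E * K)" and KF: "K * F = (1 / q\<^sup>2) \<bullet> (F * K)"
    and EF: "E * F - F * E = (1 / (q - inverse q)) \<bullet> (K - Ki)"
    and E_nil: "E ^ L = 0" and F_nil: "F ^ L = 0"
begin

definition has_weight :: "endo \<Rightarrow> int \<Rightarrow> bool"
  where "has_weight x m \<longleftrightarrow> K * x = q powi m \<bullet> x"

lemma weight_K: "has_weight x m \<Longrightarrow> K * x = q powi m \<bullet> x" by (simp add: has_weight_def)

lemma weight_Ki: assumes "has_weight x m" shows "Ki * x = q powi (- m) \<bullet> x"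
proof -
  have "x = Ki * (K * x)" by (simp add: Ki_K flip: mult.assoc)
  also have "\<dots> = q powi m \<bullet> (Ki * x)" using weight_K[OF assms] by simp
  finally show ?thesis by (metis scl_scl scl_1 power_int_minus power_int_not_zero q_nz left_inverse)
qed

lemma weight_left: assumes "K * T = q powi l \<bullet> (T * K)" "has_weight x m" shows "has_weight (T * x) (m + l)"
proof -
  have "K * (T * x) = q powi l \<bullet> (T * (K * x))" by (simp add: assms(1) flip: mult.assoc)
  then show ?thesis using assms(2) by (simp add: has_weight_def power_int_add mult.commute)
qed

lemma weight_E: "has_weight x m \<Longrightarrow> has_weight (E * x) (m + 2)"
  by (rule weight_left) (use KE in \<open>simp_all add: power_int_def\<close>)

lemma weight_F: "has_weight x m \<Longrightarrow> has_weight (F * x) (m - 2)"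
  using weight_left[of F "- 2" x m] KF by (simp add: power_int_minus power_inverse field_simps)

lemma weight_scl: "has_weight x m \<Longrightarrow> has_weight (c \<bullet> x) m" by (simp add: has_weight_def mult.commute)
lemma weight_zero: "has_weight 0 m" by (simp add: has_weight_def)
lemma weight_add: "has_weight x m \<Longrightarrow> has_weight y m \<Longrightarrow> has_weight (x + y) m" by (simp add: has_weight_def scl_add distrib_left)
lemma weight_sum: "(\<And>i. i \<in> S \<Longrightarrow> has_weight (f i) m) \<Longrightarrow> has_weight (sum f S) m"
  by (induction S rule: infinite_finite_induct) (auto simp: weight_zero weight_add)

lemma weight_powE: "has_weight x m \<Longrightarrow> has_weight (E ^ n * x) (m + 2 * int n)"
proof (induction n)
  case (Suc n)
  from weight_E[OF Suc.IH[OF Suc.prems]] show ?case by (simp add: mult.assoc algebra_simps)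
qed simp

lemma weight_powF: "has_weight x m \<Longrightarrow> has_weight (F ^ n * x) (m - 2 * int n)"
proof (induction n)
  case (Suc n)
  from weight_F[OF Suc.IH[OF Suc.prems]] show ?case by (simp add: mult.assoc algebra_simps)
qed simp

lemma weight_dpowE: assumes "has_weight x m" shows "has_weight (dpow E n * x) (m + 2 * n)"
  using weight_powE[OF assms, of "nat n"] by (cases "n < 0") (auto simp: dpow_def weight_zero intro: weight_scl)

lemma weight_dpowF: assumes "has_weight x m" shows "has_weight (dpow F n * x) (m - 2 * n)"
  using weight_powF[OF assms, of "nat n"] by (cases "n < 0") (auto simp: dpow_def weight_zero intro: weight_scl)

lemma E_F_weight: assumes "has_weight x m" shows "E * (F * x) = F * (E * x) + qint m \<bullet> x"
proof -
  have "E * (F * x) - F * (E * x) = (E * F - F * E) * x"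
    by (simp add: left_diff_distrib mult.assoc)
  also have "\<dots> = qint m \<bullet> x"
    unfolding EF using weight_K[OF assms] weight_Ki[OF assms]
    by (simp add: left_diff_distrib qint_def scl_add scl_add_left diff_divide_distrib)
  finally show ?thesis by (simp add: algebra_simps)
qed

lemma dpow_left_assoc: "T * (dpow T n * x) = qint (n + 1) \<bullet> (dpow T (n + 1) * x)"
  by (simp add: dpow_left flip: mult.assoc)
lemma dpow_right_assoc: "dpow T n * (T * x) = qint (n + 1) \<bullet> (dpow T (n + 1) * x)"
  by (simp add: dpow_right flip: mult.assoc)

lemma F_dpowE:
  "has_weight x m \<Longrightarrow> F * (dpow E n * x) = dpow E n * (F * x) - qint (m + n - 1) \<bullet> (dpow E (n - 1) * x)"
proof (induction n arbitrary: x m rule: int_step_induct)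
  case (3 n)
  have "qint (n + 1) \<bullet> (F * (dpow E (n + 1) * x)) = F * (dpow E n * (E * x))"
    by (simp add: dpow_right_assoc)
  also have "\<dots> = dpow E n * (F * (E * x)) - qint (m + 2 + n - 1) \<bullet> (dpow E (n - 1) * (E * x))"
    by (rule 3(2)[OF weight_E[OF 3(3)]])
  also have "F * (E * x) = E * (F * x) - qint m \<bullet> x"
    using E_F_weight[OF 3(3)] by simp
  also have "dpow E n * (E * (F * x) - qint m \<bullet> x) - qint (m + 2 + n - 1) \<bullet> (dpow E (n - 1) * (E * x))
     = qint (n + 1) \<bullet> (dpow E (n + 1) * (F * x)) - (qint m + qint n * qint (m + n + 1)) \<bullet> (dpow E n * x)"
    by (simp add: dpow_right_assoc algebra_simps scl_add_left)
  also have "\<dots> = qint (n + 1) \<bullet> (dpow E (n + 1) * (F * x) - qint (m + (n + 1) - 1) \<bullet> (dpow E (n + 1 - 1) * x))"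
    using qint_exchange[of n m] by (simp add: scl_add)
  finally show ?case using 3(1) by - (rule dpow_eqI[of "n + 1"], simp_all)
qed auto

lemma dpowF_E:
  "has_weight x m \<Longrightarrow> dpow F n * (E * x) = E * (dpow F n * x) - qint (m - n + 1) \<bullet> (dpow F (n - 1) * x)"
proof (induction n arbitrary: x m rule: int_step_induct)
  case (3 n)
  have "qint (n + 1) \<bullet> (dpow F (n + 1) * (E * x)) = dpow F n * (F * (E * x))"
    by (simp add: dpow_right_assoc)
  also have "F * (E * x) = E * (F * x) - qint m \<bullet> x"
    using E_F_weight[OF 3(3)] by simp
  also have "dpow F n * (E * (F * x) - qint m \<bullet> x) = dpow F n * (E * (F * x)) - qint m \<bullet> (dpow F n * x)"
    by (simp add: right_diff_distrib)
  also have "dpow F n * (E * (F * x)) =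
      E * (dpow F n * (F * x)) - qint (m - 2 - n + 1) \<bullet> (dpow F (n - 1) * (F * x))"
    by (rule 3(2)[OF weight_F[OF 3(3)]])
  also have "E * (dpow F n * (F * x)) - qint (m - 2 - n + 1) \<bullet> (dpow F (n - 1) * (F * x)) - qint m \<bullet> (dpow F n * x)
      = qint (n + 1) \<bullet> (E * (dpow F (n + 1) * x)) - (qint m + qint n * qint (m - n - 1)) \<bullet> (dpow F n * x)"
    by (simp add: dpow_right_assoc algebra_simps scl_add_left)
  also have "qint m + qint n * qint (m - n - 1) = qint (n + 1) * qint (m - n)"
  proof -
    have "qint (n + 1) * qint (- m + n) = qint (- m) + qint n * qint (- m + n + 1)"
      by (rule qint_exchange)
    moreover have "- m + n = - (m - n)" "- m + n + 1 = - (m - n - 1)" by simp_all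
    then have "qint (- m + n) = - qint (m - n)" "qint (- m + n + 1) = - qint (m - n - 1)"
      by (simp_all only: qint_minus)
    ultimately have "- (qint (n + 1) * qint (m - n)) = - (qint m + qint n * qint (m - n - 1))" by simp
    then show ?thesis by (simp only: neg_equal_iff_equal)
  qed
  also have "qint (n + 1) \<bullet> (E * (dpow F (n + 1) * x)) - (qint (n + 1) * qint (m - n)) \<bullet> (dpow F n * x)
     = qint (n + 1) \<bullet> (E * (dpow F (n + 1) * x) - qint (m - (n + 1) + 1) \<bullet> (dpow F (n + 1 - 1) * x))"
    by (simp add: scl_add)
  finally show ?case using 3(1) by - (rule dpow_eqI[of "n + 1"], simp_all)
qed auto

lemma dpow_nil: assumes "n \<ge> int L" shows "dpow E n = 0" "dpow F n = 0"
proof -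
  have "T ^ nat n = 0" if "T ^ L = 0" for T :: endo
  proof -
    have "T ^ nat n = T ^ L * T ^ (nat n - L)"
      using assms by (simp flip: power_add)
    then show ?thesis using that by simp
  qed
  then show "dpow E n = 0" "dpow F n = 0" using E_nil F_nil by (simp_all add: dpow_def)
qed

text \<open>If \<open>F y = 0\<close> then \<open>F E\<^bsup>(n+1)\<^esup> y\<close> is a nonzero multiple of \<open>E\<^bsup>(n)\<^esup> y\<close> as long as the weight is
  positive, so that the vanishing of high powers of \<open>E\<close> descends to \<open>y\<close>.\<close>

lemma lowest_weight_nonpos:
  assumes "has_weight y w" "F * y = 0" "w \<ge> 1"
  shows "y = 0"
proof -
  have "dpow E (int n) * y = 0" if "n \<le> L" for n
    using that
  proof (induction n rule: inc_induct)
    case base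
    then show ?case by (simp add: dpow_nil)
  next
    case (step n)
    have "F * (dpow E (int n + 1) * y) = - (qint (w + int n) \<bullet> (dpow E (int n) * y))"
      using F_dpowE[OF assms(1), of "int n + 1"] assms(2) by (simp add: algebra_simps)
    moreover have "dpow E (int n + 1) * y = 0" using step.IH by (simp add: add.commute)
    ultimately have "qint (w + int n) \<bullet> (dpow E (int n) * y) = qint (w + int n) \<bullet> 0" by simp
    then show ?case using dpow_eqI[of "w + int n"] assms(3) by simp
  qed
  from this[of 0] show ?thesis by simp
qed

text \<open>The preimage is a combination of the \<open>F\<^bsup>(j+1)\<^esup> E\<^bsup>(j)\<^esup> x\<close>, a truncated extremal projector.\<close>

lemma positive_weight_in_range_E:
  assumes "has_weight x m" "m \<ge> 1"
  obtains y where "x = E * y" "has_weight y (m - 2)"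
proof -
  \<comment> \<open>The recursion makes consecutive contributions to \<open>E y\<close> cancel, except for \<open>x\<close> itself.\<close>
  define c where "c = rec_nat (1 / qint m) (\<lambda>j r. - r * qint (int j + 1) / qint (m + int j + 1))"
  have c0: "c 0 = 1 / qint m" and cS: "c (Suc j) = - c j * qint (int j + 1) / qint (m + int j + 1)" for j
    by (simp_all add: c_def)
  define y where "y = (\<Sum>j<L. c j \<bullet> (dpow F (int j + 1) * (dpow E (int j) * x)))"
  define h where "h j = (c j * qint (m + int j)) \<bullet> (dpow F (int j) * (dpow E (int j) * x))" for j
  have "has_weight (dpow F (int j + 1) * (dpow E (int j) * x)) (m - 2)" for j
    using weight_dpowF[OF weight_dpowE[OF assms(1), of "int j"], of "int j + 1"] by (simp add: algebra_simps)
  then have wty: "has_weight y (m - 2)" unfolding y_def by (intro weight_sum weight_scl)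
  have "E * (c j \<bullet> (dpow F (int j + 1) * (dpow E (int j) * x))) = h j - h (Suc j)" for j
  proof -
    let ?e = "dpow E (int j) * x"
    have "E * (dpow F (int j + 1) * ?e) = dpow F (int j + 1) * (E * ?e) + qint (m + int j) \<bullet> (dpow F (int j) * ?e)"
      using dpowF_E[OF weight_dpowE[OF assms(1), of "int j"], of "int j + 1"] by (simp add: algebra_simps)
    moreover have "E * ?e = qint (int j + 1) \<bullet> (dpow E (int j + 1) * x)" by (rule dpow_left_assoc)
    moreover have "c (Suc j) * qint (m + int (Suc j)) = - (c j * qint (int j + 1))"
    proof -
      have "qint (m + int j + 1) \<noteq> 0" using assms(2) by (intro qint_nz) linarith
      then show ?thesis by (simp add: cS algebra_simps)
    qed
    ultimately show ?thesis by (simp add: h_def scl_add algebra_simps)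
  qed
  then have "E * y = (\<Sum>j<L. h j - h (Suc j))"
    unfolding y_def sum_distrib_left by (intro sum.cong) auto
  also have "\<dots> = h 0 - h L" by (rule sum_lessThan_telescope')
  also have "h L = 0" by (simp add: h_def dpow_nil)
  also have "h 0 = x" using qint_nz[of m] assms(2) by (simp add: h_def c0)
  finally have "x = E * y" by simp
  then show ?thesis using that wty by blast
qed

text \<open>This alternating sum, a map from weight \<open>m\<close> to weight \<open>2 - m\<close>, is killed by \<open>F\<close> on the
  left and by \<open>E\<close> on the right (both products telescope). One of these weights is positive, and
  a nilpotent action has neither lowest weight vectors nor a cokernel of \<open>E\<close> in positive weights.\<close>

lemma alternating_sum_zero:
  assumes "has_weight x m" and n: "n \<ge> L"
  shows "(\<Sum>j\<le>n. (-1) ^ j \<bullet> (dpow E (int j + max (- m) 0) * (dpow F (int j + max m 0 - 1) * x))) = 0"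
proof (cases "m \<ge> 1")
  case True
  then have m: "max m 0 = m" "max (- m) 0 = 0" by auto
  obtain y where x: "x = E * y" and y: "has_weight y (m - 2)"
    using positive_weight_in_range_E[OF assms(1) True] .
  define h where "h j = (-1) ^ j \<bullet> qint (int j) \<bullet> (dpow E (int j) * (dpow F (int j + m - 2) * y))" for j :: nat
  have "(-1) ^ j \<bullet> (dpow E (int j) * (dpow F (int j + m - 1) * x)) = h j - h (Suc j)" for j :: nat
  proof -
    have e: "m - 2 - (int j + m - 1) + 1 = - int j" by simp
    have "dpow F (int j + m - 1) * x = E * (dpow F (int j + m - 1) * y) + qint (int j) \<bullet> (dpow F (int j + m - 2) * y)"
      using dpowF_E[OF y, of "int j + m - 1"] unfolding x e by simp
    then show ?thesis
      by (simp add: h_def distrib_left dpow_right_assoc scl_add algebra_simps)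
  qed
  then have "(\<Sum>j\<le>n. (-1) ^ j \<bullet> (dpow E (int j + max (- m) 0) * (dpow F (int j + max m 0 - 1) * x)))
      = (\<Sum>j\<le>n. h j - h (Suc j))" unfolding m by (intro sum.cong) auto
  also have "\<dots> = h 0 - h (Suc n)" by (rule sum_telescope)
  also have "\<dots> = 0" using n by (simp add: h_def dpow_nil)
  finally show ?thesis .
next
  case False
  then have m: "max m 0 = 0" "max (- m) 0 = - m" by auto
  let ?th = "\<Sum>j\<le>n. (-1) ^ j \<bullet> (dpow E (int j - m) * (dpow F (int j - 1) * x))"
  have "has_weight (dpow E (int j - m) * (dpow F (int j - 1) * x)) (2 - m)" for j :: nat
    using weight_dpowE[OF weight_dpowF[OF assms(1), of "int j - 1"], of "int j - m"] by (simp add: algebra_simps)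
  then have w: "has_weight ?th (2 - m)" by (intro weight_sum weight_scl)
  define h where "h j = (-1) ^ j \<bullet> qint (int j) \<bullet> (dpow E (int j - m) * (dpow F (int j) * x))" for j :: nat
  define h' where "h' j = (-1) ^ j \<bullet> qint (int j - 1) \<bullet> (dpow E (int j - 1 - m) * (dpow F (int j - 1) * x))" for j :: nat
  have hh': "h' (Suc j) = - h j" for j by (simp add: h_def h'_def)
  have "F * ((-1) ^ j \<bullet> (dpow E (int j - m) * (dpow F (int j - 1) * x))) = h j + h' j" for j
  proof -
    have e: "m - 2 * (int j - 1) + (int j - m) - 1 = - (int j - 1)" by simp
    show ?thesis
      using F_dpowE[OF weight_dpowF[OF assms(1), of "int j - 1"], of "int j - m"] unfolding e qint_minus
      by (simp add: h_def h'_def dpow_left_assoc scl_add algebra_simps)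
  qed
  then have "F * ?th = (\<Sum>j\<le>n. h j + h' j)"
    unfolding sum_distrib_left by (intro sum.cong) auto
  also have "\<dots> = (\<Sum>j\<le>n. h' j - h' (Suc j))"
    by (intro sum.cong) (simp_all add: hh')
  also have "\<dots> = h' 0 - h' (Suc n)" by (rule sum_telescope)
  also have "\<dots> = 0" using n by (simp add: h'_def dpow_nil)
  finally have "?th = 0" using lowest_weight_nonpos[OF w] False by simp
  then show ?thesis unfolding m by simp
qed

end

section \<open>The intertwining relation for the affine generators\<close>

text \<open>The summands \<open>X\<close> and \<open>Y\<close> of \<open>\<Delta>(e\<^sub>0) = z\<^sub>1 X + z\<^sub>2 Y\<close> span, together with \<open>U\<close> and \<open>V\<close>, the sum of the
  trivial and the three-dimensional representation under commutators with \<open>E\<close> and \<open>F\<close>. At \<open>q = 1\<close> the sum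
  \<open>X + Y\<close> is invariant and \<open>V\<close>, \<open>X - Y\<close>, \<open>U\<close> is the adjoint triple; for general \<open>q\<close> the relations take the
  following twisted form. The same form describes \<open>\<Delta>(f\<^sub>0)\<close>.\<close>

locale twisted_adjoint = quantum_sl2 +
  fixes X Y V U :: endo
  assumes FX: "F * X = q \<bullet> (X * F) + (1 / q) \<bullet> (Ki * V)"
    and FY: "F * Y = (1 / q) \<bullet> (Y * F) - (1 / q) \<bullet> V"
    and FV: "F * V = q \<bullet> (V * F)"
    and EX: "E * X = q \<bullet> (X * E) - q\<^sup>2 \<bullet> (U * K)"
    and EY: "E * Y = (1 / q) \<bullet> (Y * E) + U"
    and EU: "E * U = q \<bullet> (U * E)"
    and EV: "E * V = (1 / q) \<bullet> (V * E) + X - Y * K"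
    and KV: "K * V = (1 / q\<^sup>2) \<bullet> (V * K)"
begin

lemma powi_minus_Suc: "q powi (- (n + 1)) = q powi (- n) * (1 / q)"
  by (simp only: power_int_minus power_int_add_1[of q] q_nz inverse_mult_distrib divide_inverse mult_1_left simp_thms)

lemma F_Ki: "F * Ki = (1 / q\<^sup>2) \<bullet> (Ki * F)"
proof -
  have "F * Ki = Ki * (K * F) * Ki" by (simp add: Ki_K flip: mult.assoc)
  also have "\<dots> = (1 / q\<^sup>2) \<bullet> (Ki * F * (K * Ki))" by (simp add: KF mult.assoc)
  finally show ?thesis by (simp add: K_Ki)
qed

lemma E_K: "E * K = (1 / q\<^sup>2) \<bullet> (K * E)"
  by (simp add: KE)

lemma qint_Suc_rules:
  "qint (n + 1) = q powi n + inverse q * qint n"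
  "qint (n + 1) = (1 / q) powi n + inverse (1 / q) * qint n"
  using qint_Suc qint_Suc' by (simp_all add: power_int_inverse power_int_minus divide_inverse)

text \<open>If \<open>T\<close> \<open>q\<close>-commutes with \<open>A\<close> up to a \<open>B\<close> with which it \<open>q\<close>-commutes in the opposite way, the \<open>n\<close> terms that arise
  from \<open>T\<^sup>n A\<close> add up to the multiple \<open>[n]\<^sub>q\<close> of one term, which the divided power absorbs. Both \<open>r = q\<close> and \<open>r = 1 / q\<close> occur.\<close>

lemma dpow_triangular:
  assumes r: "\<And>n. qint (n + 1) = r powi n + inverse r * qint n" "r \<noteq> 0"
    and TA: "T * A = r \<bullet> (A * T) + B" and TB: "T * B = inverse r \<bullet> (B * T)"
  shows "dpow T n * A = r powi n \<bullet> (A * dpow T n) + B * dpow T (n - 1)"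
proof (induction n rule: int_step_induct)
  case (3 n)
  have TA': "T * (A * z) = r \<bullet> (A * (T * z)) + B * z" and TB': "T * (B * z) = inverse r \<bullet> (B * (T * z))" for z
    by (simp_all add: TA TB distrib_right flip: mult.assoc)
  have "qint (n + 1) \<bullet> (dpow T (n + 1) * A) = T * (dpow T n * A)"
    by (simp add: dpow_left flip: mult.assoc)
  also have "\<dots> = (r powi n * r * qint (n + 1)) \<bullet> (A * dpow T (n + 1)) + (r powi n + inverse r * qint n) \<bullet> (B * dpow T n)"
    by (simp add: 3 distrib_left TA' TB' dpow_left scl_add scl_add_left algebra_simps)
  also have "\<dots> = qint (n + 1) \<bullet> (r powi (n + 1) \<bullet> (A * dpow T (n + 1)) + B * dpow T (n + 1 - 1))"
    unfolding r(1)[symmetric] using r(2) by (simp add: scl_add power_int_add mult_ac)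
  finally show ?case using 3(1) by - (rule dpow_eqI[of "n + 1"], simp_all)
qed auto

lemma dpowF_X: "dpow F n * X = q powi n \<bullet> (X * dpow F n) + (1 / q) \<bullet> (Ki * (V * dpow F (n - 1)))"
proof -
  have "F * (Ki * V) = (1 / q\<^sup>2) \<bullet> (Ki * (F * V))" by (simp add: F_Ki flip: mult.assoc)
  then show ?thesis
    using dpow_triangular[OF qint_Suc_rules(1) q_nz FX, of n] by (simp add: FV mult.assoc power2_eq_square divide_inverse)
qed

lemma dpowF_Y: "dpow F n * Y = q powi (- n) \<bullet> (Y * dpow F n) - (1 / q) \<bullet> (V * dpow F (n - 1))"
  using dpow_triangular[OF qint_Suc_rules(2), of F Y "- ((1 / q) \<bullet> V)" n] FY FV
  by (simp add: power_int_inverse power_int_minus divide_inverse)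

lemma dpowE_Y: "dpow E n * Y = q powi (- n) \<bullet> (Y * dpow E n) + U * dpow E (n - 1)"
  using dpow_triangular[OF qint_Suc_rules(2) _ EY, of n] EU
  by (simp add: power_int_inverse power_int_minus divide_inverse)

lemma dpowE_X: "dpow E n * X = q powi n \<bullet> (X * dpow E n) - q\<^sup>2 \<bullet> (U * (K * dpow E (n - 1)))"
proof -
  have "E * (U * K) = q \<bullet> (U * (E * K))" by (simp add: EU flip: mult.assoc)
  moreover have "q * (1 / q\<^sup>2) = inverse q" by (simp add: power2_eq_square field_simps)
  ultimately have "E * (U * K) = inverse q \<bullet> (U * K * E)" by (simp add: E_K mult.assoc)
  then show ?thesis
    using dpow_triangular[OF qint_Suc_rules(1) q_nz, of E X "- (q\<^sup>2 \<bullet> (U * K))" n] EX by (simp add: mult.assoc mult.commute)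
qed

text \<open>Moving \<open>V\<close> from the lowest to the highest weight of the triple passes through all four operators,
  which is why two steps of the divided power are involved.\<close>

lemma dpowE_V: "dpow E n * V = q powi (- n) \<bullet> (V * dpow E n) + X * dpow E (n - 1)
    - q powi (2 - 2 * n) \<bullet> (Y * (K * dpow E (n - 1))) - q powi (3 - n) \<bullet> (U * (K * dpow E (n - 2)))"
proof (induction n rule: int_step_induct)
  case (3 n)
  have EV': "E * (V * z) = (1 / q) \<bullet> (V * (E * z)) + X * z - Y * (K * z)" for z
    by (simp add: EV distrib_right left_diff_distrib flip: mult.assoc)
  have EX': "E * (X * z) = q \<bullet> (X * (E * z)) - q\<^sup>2 \<bullet> (U * (K * z))" for z
    by (simp add: EX left_diff_distrib flip: mult.assoc)
  have EUK': "E * (U * (K * z)) = (1 / q) \<bullet> (U * (K * (E * z)))" for z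
  proof -
    have "E * (U * (K * z)) = q \<bullet> (U * ((E * K) * z))" by (simp add: EU flip: mult.assoc)
    then show ?thesis by (simp add: E_K mult.assoc power2_eq_square)
  qed
  have EYK': "E * (Y * (K * z)) = (1 / q ^ 3) \<bullet> (Y * (K * (E * z))) + U * (K * z)" for z
  proof -
    have "E * (Y * (K * z)) = (1 / q) \<bullet> (Y * ((E * K) * z)) + U * (K * z)"
      by (simp add: EY distrib_right flip: mult.assoc)
    then show ?thesis by (simp add: E_K mult.assoc power2_eq_square power3_eq_cube)
  qed
  have y: "q powi (- n) + q powi (2 - 2 * n) * (1 / q ^ 3) * qint n = qint (n + 1) * q powi (- 2 * n)"
  proof -
    have "qint (n + 1) * q powi (- 2 * n) = q powi n * q powi (- 2 * n) + inverse q * q powi (- 2 * n) * qint n"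
      by (simp only: qint_Suc distrib_left distrib_right mult_ac)
    moreover have "q powi n * q powi (- 2 * n) = q powi (- n)" by (simp flip: power_int_add)
    moreover have "q powi (2 - 2 * n) * (1 / q ^ 3) = inverse q * q powi (- 2 * n)"
      by (simp add: power_int_diff power_int_minus field_simps power2_eq_square power3_eq_cube)
    ultimately show ?thesis by simp
  qed
  have u: "q\<^sup>2 + q powi (2 - 2 * n) + q powi (3 - n) * (1 / q) * qint (n - 1) = qint (n + 1) * q powi (2 - n)"
  proof -
    have "qint (n + 1) = q powi n + inverse q * (q powi (- (n - 1)) + q * qint (n - 1))"
      using qint_Suc[of n] qint_Suc'[of "n - 1"] by simp
    also have "\<dots> = q powi n + q powi (- n) + qint (n - 1)"
      by (simp add: distrib_left power_int_diff power_int_minus field_simps)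
    finally have "qint (n + 1) * q powi (2 - n) =
        q powi n * q powi (2 - n) + q powi (- n) * q powi (2 - n) + q powi (2 - n) * qint (n - 1)"
      by (simp add: algebra_simps)
    moreover have "q powi n * q powi (2 - n) = q\<^sup>2"
      by (simp flip: power_int_add)
    moreover have "q powi (- n) * q powi (2 - n) = q powi (2 - 2 * n)"
      by (simp flip: power_int_add)
    moreover have "q powi (3 - n) * (1 / q) = q powi (2 - n)"
      by (simp add: power_int_diff power2_eq_square power3_eq_cube)
    ultimately show ?thesis by simp
  qed
  have "qint (n + 1) \<bullet> (dpow E (n + 1) * V) = E * (dpow E n * V)"
    by (simp add: dpow_left flip: mult.assoc)
  also have "\<dots> = q powi (- n) \<bullet> (E * (V * dpow E n)) + E * (X * dpow E (n - 1))
     - q powi (2 - 2 * n) \<bullet> (E * (Y * (K * dpow E (n - 1))))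
     - q powi (3 - n) \<bullet> (E * (U * (K * dpow E (n - 2))))"
    by (simp add: 3 right_diff_distrib distrib_left)
  also have "\<dots> = (q powi (- n) * (1 / q) * qint (n + 1)) \<bullet> (V * dpow E (n + 1))
     + (q powi (- n) + q * qint n) \<bullet> (X * dpow E n)
     - (q powi (- n) + q powi (2 - 2 * n) * (1 / q ^ 3) * qint n) \<bullet> (Y * (K * dpow E n))
     - (q\<^sup>2 + q powi (2 - 2 * n) + q powi (3 - n) * (1 / q) * qint (n - 1)) \<bullet> (U * (K * dpow E (n - 1)))"
    unfolding EV' EX' EUK' EYK' by (simp add: dpow_left scl_add scl_add_left algebra_simps divide_inverse)
  also have "\<dots> = qint (n + 1) \<bullet> (q powi (- (n + 1)) \<bullet> (V * dpow E (n + 1)) + X * dpow E (n + 1 - 1)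
    - q powi (2 - 2 * (n + 1)) \<bullet> (Y * (K * dpow E (n + 1 - 1)))
    - q powi (3 - (n + 1)) \<bullet> (U * (K * dpow E (n + 1 - 2))))"
    unfolding qint_Suc'[symmetric] y u
    by (simp add: scl_add power_int_diff power_int_minus power_int_add divide_inverse mult_ac)
  finally show ?case using 3(1) by - (rule dpow_eqI[of "n + 1"], simp_all)
qed auto

lemma weight_dpowE': assumes "has_weight x m" "l = m + 2 * n" shows "has_weight (dpow E n * x) l"
  using weight_dpowE[OF assms(1)] assms(2) by simp
lemma weight_dpowF': assumes "has_weight x m" "l = m - 2 * n" shows "has_weight (dpow F n * x) l"
  using weight_dpowF[OF assms(1)] assms(2) by simp

text \<open>The defect of the intertwining relation for a single product of divided powers carries the
  factor \<open>1 - q\<^bsup>a+b\<^esup> z\<close>, which the coefficient of that product in the braiding matrix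
  cancels; what remains no longer depends on \<open>z\<close>. It is telescoping apart from its last term.\<close>

lemma product_defect:
  assumes x: "has_weight x m" and m: "m = b - a"
  defines "G \<equiv> \<lambda>a b. - (X * (dpow E a * (dpow F b * x))) + q powi (- a - b) \<bullet> (Y * (dpow E a * (dpow F b * x)))
      + q powi (- b) \<bullet> (U * (dpow E (a - 1) * (dpow F b * x)))"
  shows "dpow E a * (dpow F b * ((z \<bullet> X + Y) * x)) - (X + z \<bullet> Y) * (dpow E a * (dpow F b * x)) =
    (1 - z * q powi (a + b)) \<bullet> (G a b + (1 / q) \<bullet> G (a - 1) (b - 1)
       - q powi (- 1 - a) \<bullet> (V * (dpow E a * (dpow F (b - 1) * x))))"
proof -
  let ?p = "\<lambda>a b. dpow E a * (dpow F b * x)"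
  have wV: "has_weight (V * (dpow F (b - 1) * x)) (- a - b)"
  proof -
    have "has_weight (dpow F (b - 1) * x) (- a - b + 2)" by (rule weight_dpowF'[OF x]) (simp add: m)
    then have "has_weight (V * (dpow F (b - 1) * x)) (- a - b + 2 + - 2)"
      by (rule weight_left[rotated]) (simp add: KV power_int_minus power_inverse divide_inverse)
    then show ?thesis by simp
  qed
  have FX': "dpow F b * (X * x) = q powi b \<bullet> (X * (dpow F b * x)) + (1 / q) \<bullet> (Ki * (V * (dpow F (b - 1) * x)))"
    using arg_cong[OF dpowF_X[of b], of "\<lambda>t. t * x"] by (simp add: mult.assoc distrib_right)
  have FY': "dpow F b * (Y * x) = q powi (- b) \<bullet> (Y * (dpow F b * x)) - (1 / q) \<bullet> (V * (dpow F (b - 1) * x))"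
    using arg_cong[OF dpowF_Y[of b], of "\<lambda>t. t * x"] by (simp add: mult.assoc left_diff_distrib)
  have F: "dpow F b * ((z \<bullet> X + Y) * x) = (z * q powi b) \<bullet> (X * (dpow F b * x)) + q powi (- b) \<bullet> (Y * (dpow F b * x))
      - ((1 - z * q powi (a + b)) * (1 / q)) \<bullet> (V * (dpow F (b - 1) * x))"
    by (simp add: distrib_right distrib_left FX' FY' weight_Ki[OF wV] scl_add scl_add_left left_diff_distrib diff_divide_distrib
        mult_ac add.commute)
  have EX': "dpow E a * (X * (dpow F b * x)) = q powi a \<bullet> (X * ?p a b) - (q\<^sup>2 * q powi (a - b - 2)) \<bullet> (U * ?p (a - 1) b)"
  proof -
    have "K * ?p (a - 1) b = q powi (a - b - 2) \<bullet> ?p (a - 1) b"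
      by (rule weight_K, rule weight_dpowE'[OF weight_dpowF[OF x]]) (simp add: m)
    then show ?thesis
      using arg_cong[OF dpowE_X[of a], of "\<lambda>t. t * (dpow F b * x)"]
      by (simp add: mult.assoc left_diff_distrib)
  qed
  have EY': "dpow E a * (Y * (dpow F b * x)) = q powi (- a) \<bullet> (Y * ?p a b) + U * ?p (a - 1) b"
    using arg_cong[OF dpowE_Y[of a], of "\<lambda>t. t * (dpow F b * x)"] by (simp add: mult.assoc distrib_right)
  have EV': "dpow E a * (V * (dpow F (b - 1) * x)) = q powi (- a) \<bullet> (V * ?p a (b - 1)) + X * ?p (a - 1) (b - 1)
     - (q powi (2 - 2 * a) * q powi (a - b)) \<bullet> (Y * ?p (a - 1) (b - 1))
     - (q powi (3 - a) * q powi (a - b - 2)) \<bullet> (U * ?p (a - 2) (b - 1))"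
  proof -
    have "K * ?p (a - 1) (b - 1) = q powi (a - b) \<bullet> ?p (a - 1) (b - 1)"
      by (rule weight_K, rule weight_dpowE'[OF weight_dpowF[OF x]]) (simp add: m)
    moreover have "K * ?p (a - 2) (b - 1) = q powi (a - b - 2) \<bullet> ?p (a - 2) (b - 1)"
      by (rule weight_K, rule weight_dpowE'[OF weight_dpowF[OF x]]) (simp add: m)
    ultimately show ?thesis
      using arg_cong[OF dpowE_V[of a], of "\<lambda>t. t * (dpow F (b - 1) * x)"]
      by (simp add: mult.assoc left_diff_distrib distrib_right)
  qed
  define w where "w = 1 - z * q powi (a + b)"
  have c1: "z * q powi b * q powi a = 1 - w" "q powi (- b) * q powi (- a) = q powi (- a - b)"
    by (simp_all add: w_def mult.assoc add.commute flip: power_int_add)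
  have c2: "q powi (- b) - z * q powi b * (q\<^sup>2 * q powi (a - b - 2)) = w * q powi (- b)"
  proof -
    have "q\<^sup>2 * q powi (a - b - 2) = q powi (a - b)"
      by (simp add: power_int_diff)
    then have "z * q powi b * (q\<^sup>2 * q powi (a - b - 2)) = z * (q powi (a + b) * q powi (- b))"
      by (simp add: mult.assoc flip: power_int_add)
    then show ?thesis unfolding w_def left_diff_distrib by (simp only: mult_ac mult_1_left)
  qed
  have c3: "q powi (- a - b) - z = w * q powi (- a - b)"
  proof -
    have "q powi (a + b) * q powi (- a - b) = 1" by (simp flip: power_int_add)
    then show ?thesis by (simp add: w_def left_diff_distrib mult.assoc)
  qed
  have e: "2 + (- a - b) = 2 - b - a" by simp
  have c4: "q powi (2 - 2 * a) * q powi (a - b) = q powi (- (a - 1) - (b - 1))"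
    "q powi (3 - a) * q powi (a - b - 2) = q powi (- (b - 1))"
    "(1 / q) * q powi (- a) = q powi (- 1 - a)"
    using power_int_add[of q "2 - 2 * a" "a - b"] power_int_add[of q "3 - a" "a - b - 2"]
      power_int_add[of q "-1" "- a"] by (simp_all add: divide_inverse e)
  have "dpow E a * (dpow F b * ((z \<bullet> X + Y) * x)) =
      (z * q powi b) \<bullet> (dpow E a * (X * (dpow F b * x))) + q powi (- b) \<bullet> (dpow E a * (Y * (dpow F b * x)))
      - (w * (1 / q)) \<bullet> (dpow E a * (V * (dpow F (b - 1) * x)))"
    unfolding F w_def by (simp add: distrib_left right_diff_distrib)
  also have "\<dots> = (z * q powi b * q powi a) \<bullet> (X * ?p a b) + (q powi (- b) * q powi (- a)) \<bullet> (Y * ?p a b)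
     + (q powi (- b) - z * q powi b * (q\<^sup>2 * q powi (a - b - 2))) \<bullet> (U * ?p (a - 1) b)
     - (w * (1 / q)) \<bullet> (dpow E a * (V * (dpow F (b - 1) * x)))"
    unfolding EX' EY' by (simp add: scl_add scl_add_left algebra_simps)
  also have "\<dots> = (X + z \<bullet> Y) * ?p a b - w \<bullet> (X * ?p a b) + (q powi (- a - b) - z) \<bullet> (Y * ?p a b)
     + (w * q powi (- b)) \<bullet> (U * ?p (a - 1) b)
     - (w * (1 / q)) \<bullet> (dpow E a * (V * (dpow F (b - 1) * x)))"
    unfolding c1 c2 by (simp add: scl_add scl_add_left algebra_simps)
  finally have "dpow E a * (dpow F b * ((z \<bullet> X + Y) * x)) - (X + z \<bullet> Y) * ?p a b =
     - (w \<bullet> (X * ?p a b)) + (w * q powi (- a - b)) \<bullet> (Y * ?p a b)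
     + (w * q powi (- b)) \<bullet> (U * ?p (a - 1) b)
     - (w * (1 / q)) \<bullet> (dpow E a * (V * (dpow F (b - 1) * x)))"
    unfolding c3 by (simp add: algebra_simps)
  also have "\<dots> = w \<bullet> (G a b + (1 / q) \<bullet> G (a - 1) (b - 1)
       - ((1 / q) * q powi (- a)) \<bullet> (V * ?p a (b - 1)))"
    unfolding EV' c4(1,2) G_def by (simp add: scl_add algebra_simps)
  finally show ?thesis unfolding w_def c4(3) .
qed

text \<open>Once the factors \<open>1 - q\<^bsup>a+b\<^esup> z\<close> have cancelled, the terms \<open>G\<close> telescope because \<open>(-q)\<^sup>j\<close> and \<open>(-q)\<^bsup>j+1\<^esup> / q\<close>
  are opposite, and the terms with \<open>V\<close> add up to \<open>V\<close> times the alternating sum that vanishes on every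
  weight space. The summation runs beyond the nilpotency index, so that the telescope has no upper end.\<close>

theorem braiding_sum_intertwines:
  fixes z :: complex
  assumes x: "has_weight x m" and n: "n \<ge> L" and z: "\<And>j. j \<le> n \<Longrightarrow> 1 - q ^ (2 * j + nat \<bar>m\<bar>) * z \<noteq> 0"
  defines "T \<equiv> \<Sum>j\<le>n. ((- q) ^ j / (1 - q ^ (2 * j + nat \<bar>m\<bar>) * z)) \<bullet>
      (dpow E (int j + max (- m) 0) * dpow F (int j + max m 0))"
  shows "T * ((z \<bullet> X + Y) * x) = (X + z \<bullet> Y) * (T * x)"
proof -
  define a where "a j = int j + max (- m) 0" for j
  define b where "b j = int j + max m 0" for j
  define c where "c j = (- q) ^ j / (1 - q ^ (2 * j + nat \<bar>m\<bar>) * z)" for j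
  define G where "G a b = - (X * (dpow E a * (dpow F b * x))) + q powi (- a - b) \<bullet> (Y * (dpow E a * (dpow F b * x)))
      + q powi (- b) \<bullet> (U * (dpow E (a - 1) * (dpow F b * x)))" for a b
  have ba: "m = b j - a j" and ab: "q powi (a j + b j) = q ^ (2 * j + nat \<bar>m\<bar>)" for j
  proof -
    show "m = b j - a j" by (simp add: a_def b_def)
    have "a j + b j = int (2 * j + nat \<bar>m\<bar>)" by (simp add: a_def b_def)
    then show "q powi (a j + b j) = q ^ (2 * j + nat \<bar>m\<bar>)" by (simp only: power_int_of_nat)
  qed
  have "T * ((z \<bullet> X + Y) * x) - (X + z \<bullet> Y) * (T * x) =
     (\<Sum>j\<le>n. c j \<bullet> (dpow E (a j) * (dpow F (b j) * ((z \<bullet> X + Y) * x)) - (X + z \<bullet> Y) * (dpow E (a j) * (dpow F (b j) * x))))"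
    unfolding T_def a_def[symmetric] b_def[symmetric] c_def[symmetric] sum_distrib_left sum_distrib_right
      sum_subtractf[symmetric]
    by (intro sum.cong) (simp_all add: scl_add mult.assoc)
  also have "\<dots> = (\<Sum>j\<le>n. (- q) ^ j \<bullet> (G (a j) (b j) + (1 / q) \<bullet> G (a j - 1) (b j - 1)
       - q powi (- 1 - a j) \<bullet> (V * (dpow E (a j) * (dpow F (b j - 1) * x)))))"
  proof (intro sum.cong refl)
    fix j assume "j \<in> {..n}"
    then have "c j * (1 - z * q powi (a j + b j)) = (- q) ^ j"
      using z[of j] by (simp add: ab c_def mult.commute)
    then show "c j \<bullet> (dpow E (a j) * (dpow F (b j) * ((z \<bullet> X + Y) * x)) - (X + z \<bullet> Y) * (dpow E (a j) * (dpow F (b j) * x)))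
       = (- q) ^ j \<bullet> (G (a j) (b j) + (1 / q) \<bullet> G (a j - 1) (b j - 1)
       - q powi (- 1 - a j) \<bullet> (V * (dpow E (a j) * (dpow F (b j - 1) * x))))"
      unfolding product_defect[OF x ba] G_def by simp
  qed
  also have "\<dots> = (\<Sum>j\<le>n. (- q) ^ j \<bullet> (G (a j) (b j) + (1 / q) \<bullet> G (a j - 1) (b j - 1)))
      - (\<Sum>j\<le>n. (- q) ^ j \<bullet> q powi (- 1 - a j) \<bullet> (V * (dpow E (a j) * (dpow F (b j - 1) * x))))"
    unfolding sum_subtractf[symmetric] by (intro sum.cong) (simp_all add: scl_add)
  also have "(\<Sum>j\<le>n. (- q) ^ j \<bullet> q powi (- 1 - a j) \<bullet> (V * (dpow E (a j) * (dpow F (b j - 1) * x)))) =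
      q powi (- 1 - max (- m) 0) \<bullet> (V * (\<Sum>j\<le>n. (-1) ^ j \<bullet> (dpow E (a j) * (dpow F (b j - 1) * x))))"
  proof -
    have "(- q) ^ j * q powi (- 1 - a j) = q powi (- 1 - max (- m) 0) * (-1) ^ j" for j
    proof -
      have "q powi (- 1 - a j) = q powi (- 1 - max (- m) 0) * inverse (q ^ j)"
        by (simp add: a_def power_int_diff power_int_add power_int_minus field_simps)
      then show ?thesis by (simp add: power_minus[of q])
    qed
    then show ?thesis
      by (simp add: scl_sum sum_distrib_left)
  qed
  also have "(\<Sum>j\<le>n. (-1) ^ j \<bullet> (dpow E (a j) * (dpow F (b j - 1) * x))) = 0"
    using alternating_sum_zero[OF x n] by (simp add: a_def b_def)
  also have "(\<Sum>j\<le>n. (- q) ^ j \<bullet> (G (a j) (b j) + (1 / q) \<bullet> G (a j - 1) (b j - 1))) = 0"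
  proof -
    define h where "h j = (- q) ^ j \<bullet> (1 / q) \<bullet> G (a j - 1) (b j - 1)" for j
    have "(- q) ^ j \<bullet> (G (a j) (b j) + (1 / q) \<bullet> G (a j - 1) (b j - 1)) = h j - h (Suc j)" for j
    proof -
      have "a (Suc j) - 1 = a j" "b (Suc j) - 1 = b j" by (simp_all add: a_def b_def)
      then show ?thesis by (simp add: h_def scl_add)
    qed
    then have "(\<Sum>j\<le>n. (- q) ^ j \<bullet> (G (a j) (b j) + (1 / q) \<bullet> G (a j - 1) (b j - 1))) = h 0 - h (Suc n)"
      by (simp only: sum_telescope)
    also have "h (Suc n) = 0"
      using n by (simp add: h_def G_def a_def b_def dpow_nil)
    also have "h 0 = 0"
      by (cases "m \<ge> 0") (simp_all add: h_def G_def a_def b_def)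
    finally show ?thesis by simp
  qed
  finally show ?thesis by simp
qed

end

section \<open>Fermions and the Howe dual pair\<close>

type_synonym mode = "nat \<times> bool"

text \<open>A mode \<open>(i, s)\<close> belongs to \<open>v\<^sub>i\<close> in the first (\<open>s = False\<close>) or second tensor factor;
  \<open>An\<close> and \<open>Cr\<close> annihilate and create it, and \<open>D w\<close> scales a state by \<open>q\<close> to the sum of the
  integers \<open>w p\<close> over its occupied modes \<open>p\<close>.\<close>

definition modes :: "nat \<Rightarrow> mode set" where "modes N = {1..N} \<times> UNIV"

locale fermions = generic_q +
  fixes N :: nat and An Cr :: "mode \<Rightarrow> endo" and D :: "(mode \<Rightarrow> int) \<Rightarrow> endo"
  assumes An_An: "\<And>p r. p \<in> modes N \<Longrightarrow> r \<in> modes N \<Longrightarrow> An p * An r = - (An r * An p)"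
    and Cr_Cr: "\<And>p r. p \<in> modes N \<Longrightarrow> r \<in> modes N \<Longrightarrow> Cr p * Cr r = - (Cr r * Cr p)"
    and An_sq: "\<And>p. p \<in> modes N \<Longrightarrow> An p * An p = 0"
    and Cr_sq: "\<And>p. p \<in> modes N \<Longrightarrow> Cr p * Cr p = 0"
    and An_Cr: "\<And>p r. p \<in> modes N \<Longrightarrow> r \<in> modes N \<Longrightarrow> An p * Cr r = (if p = r then 1 else 0) - Cr r * An p"
    and D_0: "D (\<lambda>_. 0) = 1"
    and D_D: "\<And>v w. D v * D w = D (\<lambda>p. v p + w p)"
    and D_Cr: "\<And>w p. p \<in> modes N \<Longrightarrow> D w * Cr p = q powi w p \<bullet> (Cr p * D w)"
    and D_An: "\<And>w p. p \<in> modes N \<Longrightarrow> D w * An p = q powi (- w p) \<bullet> (An p * D w)"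
    and D_single: "\<And>p n. p \<in> modes N \<Longrightarrow> D (\<lambda>r. if r = p then n else 0) = 1 + (q powi n - 1) \<bullet> (Cr p * An p)"
    and D_cong: "\<And>v w. (\<And>p. p \<in> modes N \<Longrightarrow> v p = w p) \<Longrightarrow> D v = D w"
begin

abbreviation "M \<equiv> modes N"

definition hop :: "mode \<Rightarrow> mode \<Rightarrow> endo" where "hop p r = Cr p * An r"
text \<open>A hop between two modes followed by a diagonal operator. All of \<open>E\<close>, \<open>F\<close>, \<open>e\<^sub>i\<close>, \<open>f\<^sub>i\<close> and their
  commutators are sums of such monomials.\<close>

definition qhop :: "(mode \<Rightarrow> int) \<Rightarrow> mode \<Rightarrow> mode \<Rightarrow> endo" where "qhop w p r = D w * hop p r"

lemma hop_comm:
  assumes "p \<in> M" "r \<in> M" "s \<in> M" "t \<in> M"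
  shows "hop p r * hop s t = hop s t * hop p r + (if r = s then hop p t else 0) - (if p = t then hop s r else 0)"
proof -
  have swap: "Cr p * (Cr s * (An r * An t)) = Cr s * (Cr p * (An t * An r))"
  proof -
    have "Cr p * (Cr s * (An r * An t)) = (Cr p * Cr s) * (An r * An t)" by (simp add: mult.assoc)
    also have "\<dots> = (Cr s * Cr p) * (An t * An r)"
      using Cr_Cr[OF assms(1,3)] An_An[OF assms(2,4)] by simp
    finally show ?thesis by (simp add: mult.assoc)
  qed
  have *: "hop p' r' * hop s' t' = (if r' = s' then hop p' t' else 0) - Cr p' * (Cr s' * (An r' * An t'))"
    if "r' \<in> M" "s' \<in> M" for p' r' s' t'
  proof -
    have "hop p' r' * hop s' t' = Cr p' * ((An r' * Cr s') * An t')" by (simp add: hop_def mult.assoc)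
    also have "\<dots> = Cr p' * ((if r' = s' then 1 else 0) * An t') - Cr p' * (Cr s' * (An r' * An t'))"
      using An_Cr[OF that] by (simp add: left_diff_distrib right_diff_distrib mult.assoc)
    finally show ?thesis by (simp add: hop_def)
  qed
  show ?thesis unfolding *[OF assms(2,3)] *[OF assms(4,1)] swap by auto
qed

lemma D_hop:
  assumes "p \<in> M" "r \<in> M"
  shows "D w * hop p r = q powi (w p - w r) \<bullet> (hop p r * D w)"
proof -
  have "D w * hop p r = (D w * Cr p) * An r" by (simp add: hop_def mult.assoc)
  also have "\<dots> = q powi w p \<bullet> (Cr p * (D w * An r))" by (simp add: D_Cr[OF assms(1)] mult.assoc)
  also have "\<dots> = q powi (w p - w r) \<bullet> (hop p r * D w)"
    by (simp add: D_An[OF assms(2)] hop_def mult.assoc power_int_diff power_int_minus divide_inverse)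
  finally show ?thesis .
qed

lemma hop_D:
  assumes "p \<in> M" "r \<in> M"
  shows "hop p r * D w = q powi (w r - w p) \<bullet> (D w * hop p r)"
  unfolding D_hop[OF assms] by (simp flip: power_int_add)

lemma D_split: assumes "p \<in> M"
  shows "D w = D (w(p := n)) * (1 + (q powi (w p - n) - 1) \<bullet> (Cr p * An p))"
proof -
  have "w = (\<lambda>r. (w(p := n)) r + (if r = p then w p - n else 0))" by auto
  then have "D w = D (w(p := n)) * D (\<lambda>r. if r = p then w p - n else 0)"
    by (simp add: D_D)
  then show ?thesis using D_single[OF assms] by simp
qed

lemma D_upd_Cr: assumes "p \<in> M" shows "D w * Cr p = q powi (w p - n) \<bullet> (D (w(p := n)) * Cr p)"
proof -
  have "Cr p * An p * Cr p = Cr p"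
    using An_Cr[OF assms assms] Cr_sq[OF assms] by (simp add: mult.assoc right_diff_distrib) (simp flip: mult.assoc)
  then show ?thesis
    by (subst D_split[OF assms, of w n]) (simp add: mult.assoc distrib_left distrib_right left_diff_distrib right_diff_distrib scl_add_left)
qed

lemma D_upd_An: assumes "p \<in> M" shows "D w * An p = D (w(p := n)) * An p"
  by (subst D_split[OF assms, of w n]) (simp add: mult.assoc distrib_left distrib_right An_sq assms)

text \<open>The mode \<open>p\<close> is occupied and \<open>r\<close> is empty after the hop, so that the weights of \<open>w\<close> there are visible only
  as a scalar.\<close>

lemma qhop_cong:
  assumes "p \<in> M" "r \<in> M" "p \<noteq> r" "\<And>s. s \<in> M \<Longrightarrow> s \<noteq> p \<Longrightarrow> s \<noteq> r \<Longrightarrow> w s = w' s"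
  shows "qhop w p r = q powi (w p - w' p) \<bullet> qhop w' p r"
proof -
  have "qhop w p r = q powi (w p - w' p) \<bullet> (D (w(p := w' p)) * Cr p * An r)"
    using D_upd_Cr[OF assms(1), of w "w' p"] by (simp add: qhop_def hop_def flip: mult.assoc)
  also have "D (w(p := w' p)) * Cr p * An r = - (D (w(p := w' p)) * An r * Cr p)"
    using An_Cr[OF assms(2,1)] assms(3) by (simp add: mult.assoc)
  also have "D (w(p := w' p)) * An r = D (w(p := w' p, r := w' r)) * An r"
    by (rule D_upd_An[OF assms(2)])
  also have "D (w(p := w' p, r := w' r)) = D w'"
    by (rule D_cong) (use assms(4) in auto)
  also have "- (D w' * An r * Cr p) = qhop w' p r"
    using An_Cr[OF assms(2,1)] assms(3) by (simp add: qhop_def hop_def mult.assoc)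
  finally show ?thesis .
qed

lemma qhop_mult:
  assumes "p \<in> M" "r \<in> M"
  shows "qhop l p r * qhop w s t = q powi (w r - w p) \<bullet> (D (\<lambda>m. l m + w m) * (hop p r * hop s t))"
proof -
  have "qhop l p r * qhop w s t = D l * ((hop p r * D w) * hop s t)" by (simp add: qhop_def mult.assoc)
  also have "\<dots> = q powi (w r - w p) \<bullet> ((D l * D w) * (hop p r * hop s t))"
    unfolding hop_D[OF assms] by (simp add: mult.assoc)
  finally show ?thesis by (simp only: D_D)
qed

lemma hop_hop_same:
  assumes "p \<in> M" "r \<in> M" "s \<in> M" "t \<in> M"
  shows "s \<noteq> t \<Longrightarrow> p = s \<Longrightarrow> hop s t * hop p r = 0"
    and "p \<noteq> r \<Longrightarrow> r = t \<Longrightarrow> hop s t * hop p r = 0"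
proof -
  assume "s \<noteq> t" "p = s"
  have "hop s t * hop p r = Cr s * (An t * Cr p) * An r" by (simp add: hop_def mult.assoc)
  also have "\<dots> = - ((Cr s * Cr p) * (An t * An r))"
    using An_Cr[OF assms(4,1)] \<open>s \<noteq> t\<close> \<open>p = s\<close> by (simp add: mult.assoc)
  finally show "hop s t * hop p r = 0" using Cr_sq[OF assms(1)] \<open>p = s\<close> by simp
next
  assume "p \<noteq> r" "r = t"
  have "hop s t * hop p r = Cr s * (An t * Cr p) * An r" by (simp add: hop_def mult.assoc)
  also have "\<dots> = - (Cr s * (Cr p * (An t * An r)))"
    using An_Cr[OF assms(4,1)] \<open>p \<noteq> r\<close> \<open>r = t\<close> by (simp add: mult.assoc)
  finally show "hop s t * hop p r = 0" using An_sq[OF assms(2)] \<open>r = t\<close> by simp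
qed

text \<open>Two monomials \<open>q\<close>-commute up to the two contractions known from matrix units. The exponent \<open>k\<close> is free
  when the monomials share their target or their source, because both products then vanish; this freedom
  lets one \<open>k\<close> serve all summands of \<open>E\<close> and \<open>F\<close> at once.\<close>

lemma qhop_comm:
  assumes "p \<in> M" "r \<in> M" "s \<in> M" "t \<in> M"
    and "w r - w p = k + l t - l s \<or> (s \<noteq> t \<and> p = s) \<or> (p \<noteq> r \<and> r = t)"
  shows "qhop l p r * qhop w s t = q powi k \<bullet> (qhop w s t * qhop l p r)
    + q powi (w r - w p) \<bullet> ((if r = s then qhop (\<lambda>m. l m + w m) p t else 0)
       - (if p = t then qhop (\<lambda>m. l m + w m) s r else 0))"
proof -
  have comm: "q powi (w r - w p) \<bullet> (D (\<lambda>m. l m + w m) * (hop s t * hop p r)) =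
      q powi k \<bullet> (qhop w s t * qhop l p r)"
  proof (cases "w r - w p = k + l t - l s")
    case True
    then have "q powi (w r - w p) = q powi k * q powi (l t - l s)"
      by (simp add: add_diff_eq flip: power_int_add)
    then show ?thesis
      unfolding qhop_mult[OF assms(3,4)] by (simp add: add.commute)
  next
    case False
    then have "hop s t * hop p r = 0" using assms hop_hop_same by blast
    then show ?thesis unfolding qhop_mult[OF assms(3,4)] by simp
  qed
  show ?thesis
    unfolding qhop_mult[OF assms(1,2)] hop_comm[OF assms(1-4)] comm[symmetric]
    by (simp add: qhop_def distrib_left right_diff_distrib scl_add)
qed

text \<open>The weight of \<open>\<Prod>\<^bsub>j\<in>S\<^esub> K\<^sub>j\<close>.\<close>

definition K_weight :: "nat set \<Rightarrow> mode \<Rightarrow> int"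
  where "K_weight S p = (if fst p \<in> S then if snd p then - 1 else 1 else 0)"

definition E :: endo where "E = (\<Sum>i=1..N. qhop (K_weight {i<..}) (i, False) (i, True))"
definition F :: endo where "F = (\<Sum>i=1..N. qhop (\<lambda>p. - K_weight {..<i} p) (i, True) (i, False))"
definition K :: endo where "K = D (K_weight UNIV)"
definition Ki :: endo where "Ki = D (\<lambda>p. - K_weight UNIV p)"

definition at1 :: "nat \<Rightarrow> mode \<Rightarrow> int" where "at1 i p = (if p = (i, False) then 1 else 0)"
definition at2 :: "nat \<Rightarrow> mode \<Rightarrow> int" where "at2 i p = (if p = (i, True) then 1 else 0)"

text \<open>The two summands of \<open>\<Delta>(e)\<close> and of \<open>\<Delta>(f)\<close> for a root \<open>\<epsilon>\<^sub>c - \<epsilon>\<^sub>d\<close>, without spectral parameters.\<close>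

definition e1 :: "nat \<Rightarrow> nat \<Rightarrow> endo" where "e1 c d = qhop (\<lambda>_. 0) (c, False) (d, False)"
definition e2 :: "nat \<Rightarrow> nat \<Rightarrow> endo" where "e2 c d = qhop (\<lambda>p. at1 c p - at1 d p) (c, True) (d, True)"
definition f1 :: "nat \<Rightarrow> nat \<Rightarrow> endo" where "f1 c d = qhop (\<lambda>p. at2 d p - at2 c p) (d, False) (c, False)"
definition f2 :: "nat \<Rightarrow> nat \<Rightarrow> endo" where "f2 c d = qhop (\<lambda>_. 0) (d, True) (c, True)"

lemma M_iff [simp]: "(i, s) \<in> M \<longleftrightarrow> 1 \<le> i \<and> i \<le> N" by (auto simp: modes_def)

lemma sum_single:
  fixes f :: "nat \<Rightarrow> endo"
  assumes "1 \<le> k" "k \<le> N" "\<And>i. 1 \<le> i \<Longrightarrow> i \<le> N \<Longrightarrow> i \<noteq> k \<Longrightarrow> f i = 0"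
  shows "(\<Sum>i=1..N. f i) = f k"
proof -
  have "(\<Sum>i=1..N. f i) = (\<Sum>i\<in>{k}. f i)" by (rule sum.mono_neutral_right) (use assms in auto)
  then show ?thesis by simp
qed

text \<open>The contractions pick one site each: the site where \<open>s\<close> lives in the second factor, and the site where
  \<open>t\<close> lives in the first.\<close>

lemma E_qhop:
  assumes s: "s \<in> M" and t: "t \<in> M" and "s \<noteq> t"
    and "\<And>i. 1 \<le> i \<Longrightarrow> i \<le> N \<Longrightarrow> w (i, True) - w (i, False) = k + K_weight {i<..} t - K_weight {i<..} s \<or> (i, False) = s \<or> (i, True) = t"
  shows "E * qhop w s t = q powi k \<bullet> (qhop w s t * E)
    + (if snd s then q powi (w s - w (fst s, False)) \<bullet> qhop (\<lambda>p. K_weight {fst s<..} p + w p) (fst s, False) t else 0)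
    - (if snd t then 0 else q powi (w (fst t, True) - w t) \<bullet> qhop (\<lambda>p. K_weight {fst t<..} p + w p) s (fst t, True))"
proof -
  define A where "A i = (if (i, True) = s then q powi (w s - w (fst s, False)) \<bullet> qhop (\<lambda>p. K_weight {fst s<..} p + w p) (fst s, False) t else 0)" for i
  define B where "B i = (if (i, False) = t then q powi (w (fst t, True) - w t) \<bullet> qhop (\<lambda>p. K_weight {fst t<..} p + w p) s (fst t, True) else 0)" for i
  have "qhop (K_weight {i<..}) (i, False) (i, True) * qhop w s t =
      q powi k \<bullet> (qhop w s t * qhop (K_weight {i<..}) (i, False) (i, True)) + (A i - B i)" if "i \<in> {1..N}" for i
  proof -
    have "(i, False) \<in> M" "(i, True) \<in> M" using that by auto
    from qhop_comm[OF this s t, where w = w and k = k and l = "K_weight {i<..}"] assms(3) assms(4)[of i] that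
    show ?thesis by (cases s; cases t) (auto simp: A_def B_def scl_add)
  qed
  then have "E * qhop w s t = (\<Sum>i=1..N. q powi k \<bullet> (qhop w s t * qhop (K_weight {i<..}) (i, False) (i, True)) + (A i - B i))"
    unfolding E_def sum_distrib_right by (intro sum.cong) auto
  also have "\<dots> = q powi k \<bullet> (qhop w s t * E) + (sum A {1..N} - sum B {1..N})"
    by (simp add: sum.distrib sum_subtractf E_def scl_sum sum_distrib_left)
  also have "sum A {1..N} = A (fst s)"
    by (rule sum_single; use s in \<open>cases s; auto simp: A_def\<close>)
  also have "sum B {1..N} = B (fst t)"
    by (rule sum_single; use t in \<open>cases t; auto simp: B_def\<close>)
  finally show ?thesis by (cases s; cases t) (auto simp: A_def B_def)
qed

lemma F_qhop:
  assumes s: "s \<in> M" and t: "t \<in> M" and "s \<noteq> t"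
    and "\<And>i. 1 \<le> i \<Longrightarrow> i \<le> N \<Longrightarrow> w (i, False) - w (i, True) = k - K_weight {..<i} t + K_weight {..<i} s \<or> (i, True) = s \<or> (i, False) = t"
  shows "F * qhop w s t = q powi k \<bullet> (qhop w s t * F)
    + (if snd s then 0 else q powi (w s - w (fst s, True)) \<bullet> qhop (\<lambda>p. - K_weight {..<fst s} p + w p) (fst s, True) t)
    - (if snd t then q powi (w (fst t, False) - w t) \<bullet> qhop (\<lambda>p. - K_weight {..<fst t} p + w p) s (fst t, False) else 0)"
proof -
  define A where "A i = (if (i, False) = s then q powi (w s - w (fst s, True)) \<bullet> qhop (\<lambda>p. - K_weight {..<fst s} p + w p) (fst s, True) t else 0)" for i
  define B where "B i = (if (i, True) = t then q powi (w (fst t, False) - w t) \<bullet> qhop (\<lambda>p. - K_weight {..<fst t} p + w p) s (fst t, False) else 0)" for i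
  have "qhop (\<lambda>p. - K_weight {..<i} p) (i, True) (i, False) * qhop w s t =
      q powi k \<bullet> (qhop w s t * qhop (\<lambda>p. - K_weight {..<i} p) (i, True) (i, False)) + (A i - B i)" if "i \<in> {1..N}" for i
  proof -
    have "(i, False) \<in> M" "(i, True) \<in> M" using that by auto
    from qhop_comm[OF this(2,1) s t, where w = w and k = k and l = "\<lambda>p. - K_weight {..<i} p"] assms(3) assms(4)[of i] that
    show ?thesis by (cases s; cases t) (auto simp: A_def B_def scl_add)
  qed
  then have "F * qhop w s t = (\<Sum>i=1..N. q powi k \<bullet> (qhop w s t * qhop (\<lambda>p. - K_weight {..<i} p) (i, True) (i, False)) + (A i - B i))"
    unfolding F_def sum_distrib_right by (intro sum.cong) auto
  also have "\<dots> = q powi k \<bullet> (qhop w s t * F) + (sum A {1..N} - sum B {1..N})"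
    by (simp add: sum.distrib sum_subtractf F_def scl_sum sum_distrib_left)
  also have "sum A {1..N} = A (fst s)"
    by (rule sum_single; use s in \<open>cases s; auto simp: A_def\<close>)
  also have "sum B {1..N} = B (fst t)"
    by (rule sum_single; use t in \<open>cases t; auto simp: B_def\<close>)
  finally show ?thesis by (cases s; cases t) (auto simp: A_def B_def)
qed

lemma D_qhop: "D v * qhop w s t = qhop (\<lambda>p. v p + w p) s t"
  by (simp add: qhop_def D_D flip: mult.assoc)

lemma qhop_D: assumes "s \<in> M" "t \<in> M"
  shows "qhop w s t * D v = q powi (v t - v s) \<bullet> qhop (\<lambda>p. v p + w p) s t"
  using hop_D[OF assms, of v] by (simp add: qhop_def mult.assoc) (simp add: D_D add.commute flip: mult.assoc)

lemma D_qhop_comm: assumes "s \<in> M" "t \<in> M"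
  shows "D v * qhop w s t = q powi (v s - v t) \<bullet> (qhop w s t * D v)"
  unfolding qhop_D[OF assms] D_qhop by (simp flip: power_int_add)

text \<open>Only the sites \<open>i\<close> and \<open>i + 1\<close> contribute, and their contributions are the same hop with opposite signs.\<close>

lemma commute_E:
  assumes "1 \<le> i" "i < N"
  shows "E * (e1 i (Suc i)) + E * e2 i (Suc i) = e1 i (Suc i) * E + e2 i (Suc i) * E"
proof -
  have 1: "E * e1 i (Suc i) = e1 i (Suc i) * E - qhop (\<lambda>p. K_weight {Suc i<..} p + 0) (i, False) (Suc i, True)"
    unfolding e1_def
    by (subst E_qhop[where k = 0]) (use assms in \<open>auto simp: K_weight_def\<close>)
  have 2: "E * e2 i (Suc i) = e2 i (Suc i) * E + q powi (- 1) \<bullet> qhop (\<lambda>p. K_weight {i<..} p + (at1 i p - at1 (Suc i) p)) (i, False) (Suc i, True)"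
    unfolding e2_def
    by (subst E_qhop[where k = 0]) (use assms in \<open>auto simp: K_weight_def at1_def\<close>)
  have 3: "qhop (\<lambda>p. K_weight {i<..} p + (at1 i p - at1 (Suc i) p)) (i, False) (Suc i, True) =
     q powi 1 \<bullet> qhop (\<lambda>p. K_weight {Suc i<..} p + 0) (i, False) (Suc i, True)"
    by (subst qhop_cong[where w' = "\<lambda>p. K_weight {Suc i<..} p + 0"]) (use assms in \<open>auto simp: K_weight_def at1_def\<close>)
  show ?thesis unfolding 1 2 3 by (simp flip: power_int_add)
qed

lemma commute_F:
  assumes "1 \<le> i" "i < N"
  shows "F * (e1 i (Suc i)) + F * e2 i (Suc i) = e1 i (Suc i) * F + e2 i (Suc i) * F"
proof -
  have 1: "F * e1 i (Suc i) = e1 i (Suc i) * F + qhop (\<lambda>p. - K_weight {..<i} p + 0) (i, True) (Suc i, False)"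
    unfolding e1_def
    by (subst F_qhop[where k = 0]) (use assms in \<open>auto simp: K_weight_def\<close>)
  have 2: "F * e2 i (Suc i) = e2 i (Suc i) * F - q powi (- 1) \<bullet> qhop (\<lambda>p. - K_weight {..<Suc i} p + (at1 i p - at1 (Suc i) p)) (i, True) (Suc i, False)"
    unfolding e2_def
    by (subst F_qhop[where k = 0]) (use assms in \<open>auto simp: K_weight_def at1_def\<close>)
  have 3: "qhop (\<lambda>p. - K_weight {..<Suc i} p + (at1 i p - at1 (Suc i) p)) (i, True) (Suc i, False) =
     q powi 1 \<bullet> qhop (\<lambda>p. - K_weight {..<i} p + 0) (i, True) (Suc i, False)"
    by (subst qhop_cong[where w' = "\<lambda>p. - K_weight {..<i} p + 0"]) (use assms in \<open>auto simp: K_weight_def at1_def\<close>)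
  show ?thesis unfolding 1 2 3 by (simp flip: power_int_add)
qed

definition V :: endo where "V = qhop (at1 N) (N, True) (1, False)"
definition U :: endo where "U = qhop (\<lambda>p. - at1 1 p) (N, False) (1, True)"

section \<open>The affine generator and its commutators\<close>

context
  assumes N: "N \<ge> 2"
begin

lemma rel_FX: "F * e1 N 1 = q \<bullet> (e1 N 1 * F) + (1 / q) \<bullet> (Ki * V)"
proof -
  have 1: "F * e1 N 1 = q \<bullet> (e1 N 1 * F) + qhop (\<lambda>p. - K_weight {..<N} p + 0) (N, True) (1, False)"
    unfolding e1_def
    by (subst F_qhop[where k = 1]) (use N in \<open>auto simp: K_weight_def\<close>)
  have 2: "Ki * V = q powi 1 \<bullet> qhop (\<lambda>p. - K_weight {..<N} p + 0) (N, True) (1, False)"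
    unfolding Ki_def V_def D_qhop
    by (subst qhop_cong[where w' = "\<lambda>p. - K_weight {..<N} p + 0"]) (use N in \<open>auto simp: K_weight_def at1_def\<close>)
  show ?thesis unfolding 1 2 by simp
qed

lemma rel_FY: "F * e2 N 1 = (1 / q) \<bullet> (e2 N 1 * F) - (1 / q) \<bullet> V"
proof -
  have 1: "F * e2 N 1 = (1 / q) \<bullet> (e2 N 1 * F) - (1 / q) \<bullet> qhop (\<lambda>p. - K_weight {..<1} p + (at1 N p - at1 1 p)) (N, True) (1, False)"
    unfolding e2_def
    by (subst F_qhop[where k = "-1"]) (use N in \<open>auto simp: K_weight_def at1_def power_int_minus divide_inverse\<close>)
  have 2: "qhop (\<lambda>p. - K_weight {..<1} p + (at1 N p - at1 1 p)) (N, True) (1, False) = V"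
    unfolding V_def
    by (subst qhop_cong[where w' = "at1 N"]) (use N in \<open>auto simp: K_weight_def at1_def\<close>)
  show ?thesis unfolding 1 2 by simp
qed

lemma rel_FV: "F * V = q \<bullet> (V * F)"
  unfolding V_def
  by (subst F_qhop[where k = 1]) (use N in \<open>auto simp: K_weight_def at1_def\<close>)

lemma rel_EU: "E * U = q \<bullet> (U * E)"
  unfolding U_def
  by (subst E_qhop[where k = 1]) (use N in \<open>auto simp: K_weight_def at1_def\<close>)

lemma rel_EX: "E * e1 N 1 = q \<bullet> (e1 N 1 * E) - q\<^sup>2 \<bullet> (U * K)"
proof -
  have 1: "E * e1 N 1 = q \<bullet> (e1 N 1 * E) - qhop (\<lambda>p. K_weight {1<..} p + 0) (N, False) (1, True)"
    unfolding e1_def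
    by (subst E_qhop[where k = 1]) (use N in \<open>auto simp: K_weight_def\<close>)
  have 2: "U * K = q powi (- 2) \<bullet> qhop (\<lambda>p. K_weight UNIV p + - at1 1 p) (N, False) (1, True)"
    unfolding K_def U_def by (subst qhop_D) (use N in \<open>auto simp: K_weight_def\<close>)
  have 3: "qhop (\<lambda>p. K_weight UNIV p + - at1 1 p) (N, False) (1, True) = qhop (\<lambda>p. K_weight {1<..} p + 0) (N, False) (1, True)"
    by (subst qhop_cong[where w' = "\<lambda>p. K_weight {1<..} p + 0"]) (use N in \<open>auto simp: K_weight_def at1_def\<close>)
  show ?thesis unfolding 1 2 3 by (simp add: power_int_minus)
qed

lemma rel_EY: "E * e2 N 1 = (1 / q) \<bullet> (e2 N 1 * E) + U"
proof -
  have 1: "E * e2 N 1 = (1 / q) \<bullet> (e2 N 1 * E) + (1 / q) \<bullet> qhop (\<lambda>p. K_weight {N<..} p + (at1 N p - at1 1 p)) (N, False) (1, True)"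
    unfolding e2_def
    by (subst E_qhop[where k = "-1"]) (use N in \<open>auto simp: K_weight_def at1_def power_int_minus divide_inverse\<close>)
  have 2: "qhop (\<lambda>p. K_weight {N<..} p + (at1 N p - at1 1 p)) (N, False) (1, True) = q powi 1 \<bullet> U"
    unfolding U_def
    by (subst qhop_cong[where w' = "\<lambda>p. - at1 1 p"]) (use N in \<open>auto simp: K_weight_def at1_def\<close>)
  show ?thesis unfolding 1 2 by simp
qed

lemma rel_EV: "E * V = (1 / q) \<bullet> (V * E) + e1 N 1 - e2 N 1 * K"
proof -
  have 1: "E * V = (1 / q) \<bullet> (V * E) + (1 / q) \<bullet> qhop (\<lambda>p. K_weight {N<..} p + at1 N p) (N, False) (1, False)
      - qhop (\<lambda>p. K_weight {1<..} p + at1 N p) (N, True) (1, True)"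
    unfolding V_def
    by (subst E_qhop[where k = "-1"]) (use N in \<open>auto simp: K_weight_def at1_def power_int_minus divide_inverse\<close>)
  have 2: "qhop (\<lambda>p. K_weight {N<..} p + at1 N p) (N, False) (1, False) = q powi 1 \<bullet> e1 N 1"
    unfolding e1_def
    by (subst qhop_cong[where w' = "\<lambda>p. 0"]) (use N in \<open>auto simp: K_weight_def at1_def\<close>)
  have 3: "e2 N 1 * K = qhop (\<lambda>p. K_weight {1<..} p + at1 N p) (N, True) (1, True)"
    unfolding K_def e2_def qhop_D[of "(N, True)" "(1, True)"]
    by (subst qhop_D, use N in simp, use N in simp,
        subst qhop_cong[where w' = "\<lambda>p. K_weight {1<..} p + at1 N p"]) (use N in \<open>auto simp: K_weight_def at1_def\<close>)
  show ?thesis unfolding 1 2 3 by simp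
qed

lemma rel_FU: "F * U = (1 / q) \<bullet> (U * F) - (1 / q) \<bullet> e1 N 1 + (1 / q) \<bullet> (e2 N 1 * Ki)"
proof -
  have 1: "F * U = (1 / q) \<bullet> (U * F) + qhop (\<lambda>p. - K_weight {..<N} p + - at1 1 p) (N, True) (1, True)
      - (1 / q) \<bullet> qhop (\<lambda>p. - K_weight {..<1} p + - at1 1 p) (N, False) (1, False)"
    unfolding U_def
    by (subst F_qhop[where k = "-1"]) (use N in \<open>auto simp: K_weight_def at1_def power_int_minus divide_inverse\<close>)
  have 2: "qhop (\<lambda>p. - K_weight {..<1} p + - at1 1 p) (N, False) (1, False) = e1 N 1"
    unfolding e1_def
    by (subst qhop_cong[where w' = "\<lambda>p. 0"]) (use N in \<open>auto simp: K_weight_def at1_def\<close>)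
  have 3: "e2 N 1 * Ki = q powi 1 \<bullet> qhop (\<lambda>p. - K_weight {..<N} p + - at1 1 p) (N, True) (1, True)"
    unfolding Ki_def e2_def
    by (subst qhop_D, use N in simp, use N in simp,
        subst qhop_cong[where w' = "\<lambda>p. - K_weight {..<N} p + - at1 1 p"]) (use N in \<open>auto simp: K_weight_def at1_def\<close>)
  show ?thesis unfolding 1 2 3 by simp
qed

lemma rel_KV: "K * V = (1 / q\<^sup>2) \<bullet> (V * K)"
  unfolding K_def V_def
  by (subst D_qhop_comm) (use N in \<open>auto simp: K_weight_def power_int_minus divide_inverse power_inverse\<close>)
lemma rel_KU: "K * U = q\<^sup>2 \<bullet> (U * K)"
  unfolding K_def U_def
  by (subst D_qhop_comm) (use N in \<open>auto simp: K_weight_def power_int_minus divide_inverse power_inverse\<close>)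

end

end

section \<open>The quantum sl2 of E and F\<close>

text \<open>Adding one site at a time, this bounds the nilpotency index of \<open>E\<close> by the number of sites.\<close>

lemma add_square_zero_power:
  fixes S e :: endo
  assumes "S ^ n = 0" "e * e = 0" "S * e = c \<bullet> (e * S)"
  shows "(S + e) ^ Suc n = 0"
proof -
  have "\<exists>d. (S + e) ^ Suc k = S ^ Suc k + d \<bullet> (e * S ^ k)" for k
  proof (induction k)
    case 0
    show ?case by (intro exI[of _ 1]) simp
  next
    case (Suc k)
    then obtain d where d: "(S + e) ^ Suc k = S ^ Suc k + d \<bullet> (e * S ^ k)" by blast
    have Se: "S * (e * z) = c \<bullet> (e * (S * z))" and e_comb: "e * (e * z) = 0" for z
      using assms(2,3) by (simp_all flip: mult.assoc)
    have "(S + e) ^ Suc (Suc k) = (S + e) * (S ^ Suc k + d \<bullet> (e * S ^ k))"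
      using d by simp
    also have "\<dots> = S ^ Suc (Suc k) + (1 + d * c) \<bullet> (e * S ^ Suc k)"
      by (simp add: distrib_left distrib_right Se e_comb scl_add_left)
    finally show ?case by blast
  qed
  from this[of n] show ?thesis using assms(1) by auto
qed

context fermions
begin

lemma E_nilpotent: "E ^ Suc N = 0"
proof -
  let ?e = "\<lambda>i. qhop (K_weight {i<..}) (i, False) (i, True)"
  have sq: "?e i * ?e i = 0" if "1 \<le> i" "i \<le> N" for i
    using that hop_hop_same(1)[of "(i, False)" "(i, True)" "(i, False)" "(i, True)"]
    by (subst qhop_mult) auto
  have comm: "?e i * ?e j = q powi 2 \<bullet> (?e j * ?e i)" if "1 \<le> i" "i < j" "j \<le> N" for i j
    using that by (subst qhop_comm[where k = 2]) (auto simp: K_weight_def)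
  have "n \<le> N \<Longrightarrow> (\<Sum>i=1..n. ?e i) ^ Suc n = 0" for n
  proof (induction n)
    case (Suc n)
    have "(\<Sum>i=1..n. ?e i) * ?e (Suc n) = q powi 2 \<bullet> (?e (Suc n) * (\<Sum>i=1..n. ?e i))"
      unfolding sum_distrib_left sum_distrib_right scl_sum
      using comm Suc.prems by (intro sum.cong) auto
    from add_square_zero_power[OF _ _ this, of "Suc n"]
    have "((\<Sum>i=1..n. ?e i) + ?e (Suc n)) ^ Suc (Suc n) = 0"
      using Suc sq[of "Suc n"] by simp
    moreover have "(\<Sum>i=1..Suc n. ?e i) = (\<Sum>i=1..n. ?e i) + ?e (Suc n)" by simp
    ultimately show ?case by (simp only:)
  qed simp
  then show ?thesis by (simp add: E_def)
qed

lemma K_E: "K * E = q\<^sup>2 \<bullet> (E * K)"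
  unfolding E_def sum_distrib_left sum_distrib_right scl_sum K_def
  by (intro sum.cong refl, subst D_qhop_comm) (auto simp: K_weight_def)

lemma K_F: "K * F = (1 / q\<^sup>2) \<bullet> (F * K)"
  unfolding F_def sum_distrib_left sum_distrib_right scl_sum K_def
  by (intro sum.cong refl, subst D_qhop_comm)
    (auto simp: K_weight_def power_int_minus divide_inverse)

lemma K_Ki: "K * Ki = 1" and Ki_K: "Ki * K = 1"
  unfolding K_def Ki_def D_D by (simp_all add: D_0)

lemma D_0_fun: "(\<And>p. p \<in> M \<Longrightarrow> w p = 0) \<Longrightarrow> D w = 1"
  using D_cong[of w "\<lambda>_. 0"] D_0 by simp

lemma D_pm_single:
  assumes "p \<in> M" "r \<in> M" "p \<noteq> r"
  shows "D (\<lambda>m. (if m = p then 1 else 0) - (if m = r then 1 else 0))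
       - D (\<lambda>m. (if m = r then 1 else 0) - (if m = p then 1 else 0))
     = (q - inverse q) \<bullet> (hop p p - hop r r)"
proof -
  have 1: "D (\<lambda>m. (if m = p then 1 else 0) - (if m = r then 1 else 0)) =
     (1 + (q - 1) \<bullet> hop p p) * (1 + (inverse q - 1) \<bullet> hop r r)" if "p \<in> M" "r \<in> M" for p r
  proof -
    have "(\<lambda>m. (if m = p then 1 else 0) - (if m = r then (1 :: int) else 0)) =
      (\<lambda>m. (if m = p then 1 else 0) + (if m = r then - 1 else 0))" by auto
    then show ?thesis
      using D_single[OF that(1), of 1] D_single[OF that(2), of "-1"]
      by (simp add: hop_def power_int_minus flip: D_D)
  qed
  have "hop p p * hop r r = hop r r * hop p p"
    using hop_comm[of p p r r] assms by simp
  then show ?thesis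
    unfolding 1[OF assms(1,2)] 1[OF assms(2,1)]
    by (simp add: distrib_left distrib_right scl_add scl_add_left algebra_simps)
qed

lemma scl_inv: "w \<noteq> 0 \<Longrightarrow> (1 / w) \<bullet> w \<bullet> T = T"
  by simp

lemma E_F: "E * F - F * E = (1 / (q - inverse q)) \<bullet> (K - Ki)"
proof -
  let ?e = "\<lambda>i. qhop (K_weight {i<..}) (i, False) (i, True)"
  let ?f = "\<lambda>i. qhop (\<lambda>p. - K_weight {..<i} p) (i, True) (i, False)"
  \<comment> \<open>Interpolates between \<open>K\<close> and its inverse: the diagonal part of the commutator telescopes.\<close>
  define c where "c i = D (\<lambda>p. K_weight {i<..} p - K_weight {..i} p)" for i
  have "?e i * ?f j = ?f j * ?e i + (if i = j then (1 / (q - inverse q)) \<bullet> (c (i - 1) - c i) else 0)"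
    if i: "i \<in> {1..N}" and j: "j \<in> {1..N}" for i j
  proof (cases "i = j")
    case False
    with i j show ?thesis by (subst qhop_comm[where k = 0]) (auto simp: K_weight_def)
  next
    case True
    define d where "d p = K_weight {i<..} p - K_weight {..<i} p" for p
    define u where "u p = (if p = (i, False) then 1 else 0 :: int) - (if p = (i, True) then 1 else 0)" for p
    have "c (i - 1) = D (\<lambda>p. d p + u p)" "c i = D (\<lambda>p. d p + - u p)"
      unfolding c_def using i
      by (intro arg_cong[of _ _ D] ext; force simp: d_def u_def K_weight_def prod_eq_iff)+
    then have "c (i - 1) - c i = D d * (D u - D (\<lambda>p. - u p))"
      by (simp add: D_D right_diff_distrib)
    also have "D u - D (\<lambda>p. - u p) = (q - inverse q) \<bullet> (hop (i, False) (i, False) - hop (i, True) (i, True))"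
      using D_pm_single[of "(i, False)" "(i, True)"] i by (simp add: u_def[abs_def])
    finally have "(1 / (q - inverse q)) \<bullet> (c (i - 1) - c i) =
        qhop d (i, False) (i, False) - qhop d (i, True) (i, True)"
      by (simp only: qhop_def right_diff_distrib times_scl scl_inv[OF q_diff_nz])
    moreover have "?e i * ?f i = ?f i * ?e i + (qhop d (i, False) (i, False) - qhop d (i, True) (i, True))"
      using i unfolding d_def[abs_def] by (subst qhop_comm[where k = 0]) (auto simp: K_weight_def)
    ultimately show ?thesis using True by simp
  qed
  then have "E * F - F * E = (\<Sum>i=1..N. \<Sum>j=1..N. if i = j then (1 / (q - inverse q)) \<bullet> (c (i - 1) - c i) else 0)"
    unfolding E_def F_def sum_product
    by (subst (2) sum.swap) (simp add: sum.distrib)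
  also have "\<dots> = (1 / (q - inverse q)) \<bullet> (\<Sum>i=1..N. c (i - 1) - c i)"
    by (simp add: scl_sum)
  also have "(\<Sum>i=1..N. c (i - 1) - c i) = c 0 - c N"
    by (induction N) simp_all
  also have "c 0 = K" unfolding c_def K_def by (rule D_cong) (auto simp: K_weight_def modes_def)
  also have "c N = Ki" unfolding c_def Ki_def by (rule D_cong) (auto simp: K_weight_def modes_def)
  finally show ?thesis .
qed

section \<open>Mirror symmetry\<close>

text \<open>Exchanging the two tensor factors and reversing the order of the indices swaps \<open>E\<close> with \<open>F\<close>
  and the summands of \<open>\<Delta>(e\<^sub>i)\<close> with those of \<open>\<Delta>(f\<^bsub>N-i\<^esub>)\<close>, so every relation has a mirror image.\<close>

definition mirror_mode :: "mode \<Rightarrow> mode" where "mirror_mode p = (N + 1 - fst p, \<not> snd p)"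

lemma mirror_mode_M: "p \<in> M \<Longrightarrow> mirror_mode p \<in> M" by (auto simp: mirror_mode_def modes_def)
lemma mirror_mode_involution: "p \<in> M \<Longrightarrow> mirror_mode (mirror_mode p) = p" by (auto simp: mirror_mode_def modes_def)
lemma mirror_mode_inj: "p \<in> M \<Longrightarrow> r \<in> M \<Longrightarrow> mirror_mode p = mirror_mode r \<longleftrightarrow> p = r" by (metis mirror_mode_involution)

lemma mirror_fermions: "fermions q N (\<lambda>p. An (mirror_mode p)) (\<lambda>p. Cr (mirror_mode p)) (\<lambda>w. D (\<lambda>p. w (mirror_mode p)))"
proof (intro fermions.intro fermions_axioms.intro)
  show "generic_q q" by unfold_locales
  fix p r :: mode and n :: int and v w :: "mode \<Rightarrow> int"
  show "D (\<lambda>p. 0) = 1" by (rule D_0)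
  show "D (\<lambda>p. v (mirror_mode p)) * D (\<lambda>p. w (mirror_mode p)) = D (\<lambda>p. v (mirror_mode p) + w (mirror_mode p))"
    by (rule D_D)
  show "D (\<lambda>p. v (mirror_mode p)) = D (\<lambda>p. w (mirror_mode p))" if "\<And>p. p \<in> M \<Longrightarrow> v p = w p"
    by (rule D_cong) (simp add: that mirror_mode_M)
  assume p: "p \<in> M"
  note p' = mirror_mode_M[OF p]
  show "An (mirror_mode p) * An (mirror_mode p) = 0" by (rule An_sq[OF p'])
  show "Cr (mirror_mode p) * Cr (mirror_mode p) = 0" by (rule Cr_sq[OF p'])
  show "D (\<lambda>p. w (mirror_mode p)) * Cr (mirror_mode p) = q powi w p \<bullet> (Cr (mirror_mode p) * D (\<lambda>p. w (mirror_mode p)))"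
    using D_Cr[OF p', of "\<lambda>p. w (mirror_mode p)"] by (simp add: mirror_mode_involution[OF p])
  show "D (\<lambda>p. w (mirror_mode p)) * An (mirror_mode p) = q powi - w p \<bullet> (An (mirror_mode p) * D (\<lambda>p. w (mirror_mode p)))"
    using D_An[OF p', of "\<lambda>p. w (mirror_mode p)"] by (simp add: mirror_mode_involution[OF p])
  have "D (\<lambda>pa. if mirror_mode pa = p then n else 0) = D (\<lambda>r. if r = mirror_mode p then n else 0)"
    by (rule D_cong) (use p in \<open>auto simp: mirror_mode_involution\<close>)
  then show "D (\<lambda>pa. if mirror_mode pa = p then n else 0) = 1 + (q powi n - 1) \<bullet> (Cr (mirror_mode p) * An (mirror_mode p))"
    using D_single[OF p'] by simp
  assume r: "r \<in> M"
  note r' = mirror_mode_M[OF r]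
  show "An (mirror_mode p) * An (mirror_mode r) = - (An (mirror_mode r) * An (mirror_mode p))" by (rule An_An[OF p' r'])
  show "Cr (mirror_mode p) * Cr (mirror_mode r) = - (Cr (mirror_mode r) * Cr (mirror_mode p))" by (rule Cr_Cr[OF p' r'])
  show "An (mirror_mode p) * Cr (mirror_mode r) = (if p = r then 1 else 0) - Cr (mirror_mode r) * An (mirror_mode p)"
    using An_Cr[OF p' r'] by (simp add: mirror_mode_inj[OF p r])
qed

interpretation dual: fermions q N "\<lambda>p. An (mirror_mode p)" "\<lambda>p. Cr (mirror_mode p)" "\<lambda>w. D (\<lambda>p. w (mirror_mode p))"
  by (rule mirror_fermions)

lemma dual_qhop: "dual.qhop w p r = qhop (\<lambda>p. w (mirror_mode p)) (mirror_mode p) (mirror_mode r)"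
  by (simp add: qhop_def dual.qhop_def hop_def dual.hop_def)

lemma qhop_cong': "p \<in> M \<Longrightarrow> r \<in> M \<Longrightarrow> (\<And>s. s \<in> M \<Longrightarrow> w s = w' s) \<Longrightarrow> p = p' \<Longrightarrow> r = r' \<Longrightarrow> qhop w p r = qhop w' p' r'"
  unfolding qhop_def using D_cong[of w w'] by simp

lemma dual_E: "dual.E = F" and dual_F: "dual.F = E"
proof -
  have *: "bij_betw (\<lambda>i. N + 1 - i) {1..N} {1..N}"
    by (rule bij_betw_byWitness[where f' = "\<lambda>i. N + 1 - i"]) auto
  show "dual.E = F" unfolding dual.E_def F_def
    by (subst sum.reindex_bij_betw[OF *, symmetric], intro sum.cong refl, unfold dual_qhop)
      (rule qhop_cong'; auto simp: mirror_mode_def K_weight_def modes_def)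
  show "dual.F = E" unfolding dual.F_def E_def
    by (subst sum.reindex_bij_betw[OF *, symmetric], intro sum.cong refl, unfold dual_qhop)
      (rule qhop_cong'; auto simp: mirror_mode_def K_weight_def modes_def)
qed

lemma dual_K: "dual.K = Ki" and dual_Ki: "dual.Ki = K"
  unfolding K_def Ki_def dual.K_def dual.Ki_def by (rule D_cong; simp add: K_weight_def mirror_mode_def)+

lemma F_nilpotent: "F ^ Suc N = 0"
  using dual.E_nilpotent by (simp add: dual_E)

lemma dual_e1: "1 \<le> c \<Longrightarrow> c \<le> N \<Longrightarrow> 1 \<le> d \<Longrightarrow> d \<le> N \<Longrightarrow> dual.e1 c d = f2 (N + 1 - d) (N + 1 - c)"
  unfolding dual.e1_def f2_def dual_qhop by (simp add: mirror_mode_def)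

lemma dual_e2: "1 \<le> c \<Longrightarrow> c \<le> N \<Longrightarrow> 1 \<le> d \<Longrightarrow> d \<le> N \<Longrightarrow> dual.e2 c d = f1 (N + 1 - d) (N + 1 - c)"
  unfolding dual.e2_def f1_def dual_qhop
  by (rule qhop_cong') (auto simp: mirror_mode_def dual.at1_def at2_def modes_def)

lemma commute_f:
  assumes "1 \<le> i" "i < N"
  shows "E * (f1 i (Suc i)) + E * f2 i (Suc i) = f1 i (Suc i) * E + f2 i (Suc i) * E"
    and "F * (f1 i (Suc i)) + F * f2 i (Suc i) = f1 i (Suc i) * F + f2 i (Suc i) * F"
proof -
  have "N + 1 - Suc (N - i) = i" "N + 1 - (N - i) = Suc i" using assms by auto
  then have "dual.e1 (N - i) (Suc (N - i)) = f2 i (Suc i)" "dual.e2 (N - i) (Suc (N - i)) = f1 i (Suc i)"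
    using assms by (simp_all add: dual_e1 dual_e2)
  then show "E * (f1 i (Suc i)) + E * f2 i (Suc i) = f1 i (Suc i) * E + f2 i (Suc i) * E"
    "F * (f1 i (Suc i)) + F * f2 i (Suc i) = f1 i (Suc i) * F + f2 i (Suc i) * F"
    using dual.commute_E[of "N - i"] dual.commute_F[of "N - i"] assms
    by (simp_all add: dual_E dual_F add.commute)
qed

lemma quantum_sl2: "quantum_sl2 q E F K Ki (Suc N)"
  by unfold_locales (rule K_Ki Ki_K K_E K_F E_F E_nilpotent F_nilpotent)+

lemma adjoint_e0: assumes "N \<ge> 2"
  shows "twisted_adjoint q E F K Ki (Suc N) (e1 N 1) (e2 N 1) V U"
proof -
  interpret quantum_sl2 q E F K Ki "Suc N" by (rule quantum_sl2)
  show ?thesis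
    by unfold_locales (rule rel_FX rel_FY rel_FV rel_EX rel_EY rel_EU rel_EV rel_KV assms)+
qed

text \<open>The mirror image of the relations for \<open>e\<^sub>0\<close> has \<open>E\<close> and \<open>F\<close> interchanged, hence also the roles of \<open>U\<close> and \<open>V\<close>;
  the scalars restore the original form.\<close>

lemma adjoint_f0: assumes "N \<ge> 2"
  shows "twisted_adjoint q E F K Ki (Suc N) (f2 N 1) (f1 N 1) (- q \<bullet> dual.U) (- (1 / q) \<bullet> dual.V)"
proof -
  interpret quantum_sl2 q E F K Ki "Suc N" by (rule quantum_sl2)
  have e: "dual.e1 N 1 = f2 N 1" "dual.e2 N 1 = f1 N 1" using assms by (simp_all add: dual_e1 dual_e2)
  note d = dual_E dual_F dual_K dual_Ki e
  have KU: "Ki * dual.U = q\<^sup>2 \<bullet> (dual.U * Ki)" and KV: "Ki * dual.V = (1 / q\<^sup>2) \<bullet> (dual.V * Ki)"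
    using dual.rel_KU[OF assms] dual.rel_KV[OF assms] unfolding d by simp_all
  have conj: "K * T = c \<bullet> (T * K)" if "Ki * T = inverse c \<bullet> (T * Ki)" "c \<noteq> 0" for T c
  proof -
    have "T * K = K * (Ki * T) * K" by (simp add: K_Ki flip: mult.assoc)
    also have "\<dots> = inverse c \<bullet> (K * T * (Ki * K))" unfolding that(1) by (simp add: mult.assoc)
    finally have "T * K = inverse c \<bullet> (K * T)" by (simp add: Ki_K)
    then show ?thesis using that(2) by simp
  qed
  have KU': "K * dual.U = (1 / q\<^sup>2) \<bullet> (dual.U * K)" and KV': "K * dual.V = q\<^sup>2 \<bullet> (dual.V * K)"
    using conj[of "dual.U" "1 / q\<^sup>2"] conj[of "dual.V" "q\<^sup>2"] KU KV by (simp_all add: divide_inverse)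
  show ?thesis
  proof unfold_locales
    show "F * f2 N 1 = q \<bullet> (f2 N 1 * F) + (1 / q) \<bullet> (Ki * (- q \<bullet> dual.U))"
      using dual.rel_EX[OF assms] unfolding d by (simp add: KU)
    show "F * f1 N 1 = (1 / q) \<bullet> (f1 N 1 * F) - (1 / q) \<bullet> (- q \<bullet> dual.U)"
      using dual.rel_EY[OF assms] unfolding d by simp
    show "F * (- q \<bullet> dual.U) = q \<bullet> (- q \<bullet> dual.U * F)"
      using dual.rel_EU[OF assms] unfolding d by simp
    show "E * f2 N 1 = q \<bullet> (f2 N 1 * E) - q\<^sup>2 \<bullet> (- (1 / q) \<bullet> dual.V * K)"
      using dual.rel_FX[OF assms] unfolding d by (simp add: KV' power2_eq_square)
    show "E * f1 N 1 = (1 / q) \<bullet> (f1 N 1 * E) + - (1 / q) \<bullet> dual.V"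
      using dual.rel_FY[OF assms] unfolding d by simp
    show "E * (- (1 / q) \<bullet> dual.V) = q \<bullet> (- (1 / q) \<bullet> dual.V * E)"
      using dual.rel_FV[OF assms] unfolding d by simp
    show "E * (- q \<bullet> dual.U) = (1 / q) \<bullet> (- q \<bullet> dual.U * E) + f2 N 1 - f1 N 1 * K"
      using dual.rel_FU[OF assms] unfolding d by (simp add: scl_add)
    show "K * (- q \<bullet> dual.U) = (1 / q\<^sup>2) \<bullet> (- q \<bullet> dual.U * K)"
      using KU' by simp
  qed
qed

end

section \<open>The relations of the loop algebra\<close>

text \<open>The Serre relations for the coproduct \<open>e = a + b\<close> follow from those of the summands, because
  \<open>a\<close> and \<open>b\<close> square to zero and \<open>q\<close>-commute: all words are reordered with the \<open>a\<close> to the left of the \<open>b\<close>.\<close>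

lemma serre_adjacent:
  fixes a b a' b' :: endo
  assumes r: "r \<noteq> 0" and sq: "a * a = 0" "b * b = 0" and aba: "a * a' * a = 0" "b * b' * b = 0"
    and ba: "b * a = r\<^sup>2 \<bullet> (a * b)" and ba': "b * a' = (1 / r) \<bullet> (a' * b)" and b'a: "b' * a = (1 / r) \<bullet> (a * b')"
  defines "e \<equiv> a + b" and "e' \<equiv> a' + b'"
  shows "e * (e * e') - (r + 1 / r) \<bullet> (e * (e' * e)) + e' * (e * e) = 0"
proof -
  have n: "b * (a * z) = r\<^sup>2 \<bullet> (a * (b * z))" "b * (a' * z) = (1 / r) \<bullet> (a' * (b * z))"
    "b' * (a * z) = (1 / r) \<bullet> (a * (b' * z))" "a * (a * z) = 0" "b * (b * z) = 0" for z
    using ba ba' b'a sq by (simp_all flip: mult.assoc)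
  have z: "a * (a' * a) = 0" "b * (b' * b) = 0" "a * (a' * (a * w)) = 0" for w
    using aba by (simp_all add: mult.assoc flip: mult.assoc)
  have c: "r\<^sup>2 * (1 / r) = r" "(1 / r) * r\<^sup>2 = r" "r\<^sup>2 / r = r" using r by (simp_all add: power2_eq_square)
  have e_comb: "e * e = (1 + r\<^sup>2) \<bullet> (a * b)"
    by (simp add: e_def distrib_left distrib_right sq ba scl_add_left)
  have L: "e * (e * e') = (1 + r\<^sup>2) \<bullet> ((1 / r) \<bullet> (a * (a' * b)) + a * (b * b'))"
    unfolding mult.assoc[symmetric, of e e] e_comb e'_def
    by (simp add: distrib_left mult.assoc ba' n scl_add)
  have R: "e' * (e * e) = (1 + r\<^sup>2) \<bullet> (a' * (a * b) + (1 / r) \<bullet> (a * (b' * b)))"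
    unfolding e_comb e'_def by (simp add: distrib_right n scl_add)
  have Mi: "e * (e' * e) = a * (a' * b) + a * (b' * b) + r \<bullet> (a' * (a * b)) + r \<bullet> (a * (b * b'))"
    unfolding e_def e'_def
    by (simp add: distrib_left distrib_right n z sq ba ba' b'a c mult.assoc)
  have k: "(r + 1 / r) * r = 1 + r\<^sup>2" "(1 + r\<^sup>2) * (1 / r) = r + 1 / r"
    using r by (simp_all add: field_simps power2_eq_square)
  show ?thesis unfolding L R Mi scl_add scl_scl k by (simp add: scl_add_left)
qed

text \<open>The case of two roots with inner product \<open>-2\<close>, which occurs for \<open>N = 2\<close>. Here \<open>e\<close> itself cubes to zero, and of
  the four terms of the relation the two middle ones cancel.\<close>

lemma serre_double:
  fixes a b a' b' :: endo
  assumes r: "r \<noteq> 0" and sq: "a * a = 0" "b * b = 0"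
    and ba: "b * a = r\<^sup>2 \<bullet> (a * b)" and ba': "b * a' = (1 / r\<^sup>2) \<bullet> (a' * b)" and b'a: "b' * a = (1 / r\<^sup>2) \<bullet> (a * b')"
  defines "e \<equiv> a + b" and "e' \<equiv> a' + b'"
  shows "e * (e * e) = 0" and "e * (e * (e' * e)) = e * (e' * (e * e))"
proof -
  have n: "b * (a * z) = r\<^sup>2 \<bullet> (a * (b * z))" "b * (a' * z) = (1 / r\<^sup>2) \<bullet> (a' * (b * z))"
    "b' * (a * z) = (1 / r\<^sup>2) \<bullet> (a * (b' * z))" "a * (a * z) = 0" "b * (b * z) = 0" for z
    using ba ba' b'a sq by (simp_all flip: mult.assoc)
  have e_comb: "e * e = (1 + r\<^sup>2) \<bullet> (a * b)"
    by (simp add: e_def distrib_left distrib_right sq ba scl_add_left)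
  have k: "(r\<^sup>2 + r ^ 4) / r\<^sup>2 = 1 + r\<^sup>2" using r by (simp add: field_simps flip: power_add)
  show "e * (e * e) = 0" unfolding e_comb by (simp add: e_def distrib_right n sq)
  have "e * (e * (e' * e)) = (1 + r\<^sup>2) \<bullet> (a * (b * (e' * e)))"
    using e_comb by (simp flip: mult.assoc)
  also have "\<dots> = (1 + r\<^sup>2) \<bullet> (a * (a' * (a * b)) + a * (b * (b' * b)))"
    using r by (simp add: e_def e'_def distrib_left distrib_right n sq ba b'a)
  also have "\<dots> = e * (e' * (e * e))"
    unfolding e_comb using r by (simp add: e_def e'_def distrib_left distrib_right n sq scl_add k algebra_simps)
  finally show "e * (e * (e' * e)) = e * (e' * (e * e))" .
qed

context fermions
begin

definition e_comb :: "complex \<Rightarrow> complex \<Rightarrow> nat \<Rightarrow> nat \<Rightarrow> endo"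
  where "e_comb x y c d = x \<bullet> e1 c d + y \<bullet> e2 c d"
definition f_comb :: "complex \<Rightarrow> complex \<Rightarrow> nat \<Rightarrow> nat \<Rightarrow> endo"
  where "f_comb x y c d = x \<bullet> f1 c d + y \<bullet> f2 c d"
definition t_act :: "(nat \<Rightarrow> int) \<Rightarrow> endo"
  where "t_act \<nu> = D (\<lambda>p. \<nu> (fst p))"

lemma t_act_e_comb:
  assumes "c \<in> {1..N}" "d \<in> {1..N}"
  shows "t_act \<nu> * e_comb x y c d = q powi (\<nu> c - \<nu> d) \<bullet> (e_comb x y c d * t_act \<nu>)"
  using assms by (simp add: t_act_def e_comb_def e1_def e2_def distrib_left distrib_right D_qhop_comm scl_add mult.commute)

lemma t_act_f_comb:
  assumes "c \<in> {1..N}" "d \<in> {1..N}"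
  shows "t_act \<nu> * f_comb x y c d = q powi (\<nu> d - \<nu> c) \<bullet> (f_comb x y c d * t_act \<nu>)"
  using assms by (simp add: t_act_def f_comb_def f1_def f2_def distrib_left distrib_right D_qhop_comm scl_add mult.commute)

lemma e_f_parts:
  assumes "c \<in> {1..N}" "d \<in> {1..N}" "c' \<in> {1..N}" "d' \<in> {1..N}"
  shows "e1 c d * f1 c' d' = f1 c' d' * e1 c d
      + (if d = d' then qhop (\<lambda>p. at2 d' p - at2 c' p) (c, False) (c', False) else 0)
      - (if c = c' then qhop (\<lambda>p. at2 d' p - at2 c' p) (d', False) (d, False) else 0)"
    and "e1 c d * f2 c' d' = f2 c' d' * e1 c d"
    and "e2 c d * f1 c' d' = f1 c' d' * e2 c d"
    and "e2 c d * f2 c' d' = f2 c' d' * e2 c d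
      + (if d = d' then qhop (\<lambda>p. at1 c p - at1 d p) (c, True) (c', True) else 0)
      - (if c = c' then qhop (\<lambda>p. at1 c p - at1 d p) (d', True) (d, True) else 0)"
proof -
  show "e1 c d * f1 c' d' = f1 c' d' * e1 c d
      + (if d = d' then qhop (\<lambda>p. at2 d' p - at2 c' p) (c, False) (c', False) else 0)
      - (if c = c' then qhop (\<lambda>p. at2 d' p - at2 c' p) (d', False) (d, False) else 0)"
    unfolding e1_def f1_def by (subst qhop_comm[where k = 0]) (use assms in \<open>auto simp: at2_def\<close>)
  show "e1 c d * f2 c' d' = f2 c' d' * e1 c d"
    unfolding e1_def f2_def by (subst qhop_comm[where k = 0]) (use assms in auto)
  show "e2 c d * f1 c' d' = f1 c' d' * e2 c d"
    unfolding e2_def f1_def by (subst qhop_comm[where k = 0]) (use assms in \<open>auto simp: at1_def at2_def\<close>)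
  show "e2 c d * f2 c' d' = f2 c' d' * e2 c d
      + (if d = d' then qhop (\<lambda>p. at1 c p - at1 d p) (c, True) (c', True) else 0)
      - (if c = c' then qhop (\<lambda>p. at1 c p - at1 d p) (d', True) (d, True) else 0)"
    unfolding e2_def f2_def by (subst qhop_comm[where k = 0]) (use assms in \<open>auto simp: at1_def\<close>)
qed

lemma e_comb_f_comb_distinct:
  assumes "c \<in> {1..N}" "d \<in> {1..N}" "c' \<in> {1..N}" "d' \<in> {1..N}" "c \<noteq> c'" "d \<noteq> d'"
  shows "e_comb x y c d * f_comb x' y' c' d' = f_comb x' y' c' d' * e_comb x y c d"
  using assms by (simp add: e_comb_def f_comb_def distrib_left distrib_right e_f_parts scl_add mult.commute)

text \<open>The occupation numbers of \<open>c\<close> and \<open>d\<close> differ by \<open>x \<in> {-1, 0, 1}\<close> in each factor, and for these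
  \<open>x\<close> coincides with its quantum integer.\<close>

lemma e_comb_f_comb_same:
  assumes cd: "c \<in> {1..N}" "d \<in> {1..N}" "c \<noteq> d" and "x \<noteq> 0" "y \<noteq> 0"
  defines "\<alpha> \<equiv> \<lambda>l. (if l = c then 1 else 0) - (if l = d then 1 else 0)"
  shows "e_comb x y c d * f_comb (inverse x) (inverse y) c d - f_comb (inverse x) (inverse y) c d * e_comb x y c d =
    (1 / (q - inverse q)) \<bullet> (t_act \<alpha> - t_act (\<lambda>l. - \<alpha> l))"
proof -
  define \<alpha>1 \<alpha>2 where "\<alpha>1 = (\<lambda>p. at1 c p - at1 d p)" and "\<alpha>2 = (\<lambda>p. at2 c p - at2 d p)"
  have h: "(1 / (q - inverse q)) \<bullet> (D \<alpha>1 - D (\<lambda>p. - \<alpha>1 p)) = hop (c, False) (c, False) - hop (d, False) (d, False)"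
    "(1 / (q - inverse q)) \<bullet> (D \<alpha>2 - D (\<lambda>p. - \<alpha>2 p)) = hop (c, True) (c, True) - hop (d, True) (d, True)"
    using D_pm_single[of "(c, False)" "(d, False)"] D_pm_single[of "(c, True)" "(d, True)"] cd
    by (simp_all only: \<alpha>1_def \<alpha>2_def at1_def at2_def minus_diff_eq scl_inv[OF q_diff_nz] M_iff
        atLeastAtMost_iff prod.inject not_False_eq_True simp_thms)
  have "e_comb x y c d * f_comb (inverse x) (inverse y) c d - f_comb (inverse x) (inverse y) c d * e_comb x y c d
     = D (\<lambda>p. - \<alpha>2 p) * (hop (c, False) (c, False) - hop (d, False) (d, False))
      + D \<alpha>1 * (hop (c, True) (c, True) - hop (d, True) (d, True))"
    using assms(1-5)
    by (simp add: e_comb_def f_comb_def distrib_left distrib_right e_f_parts scl_add qhop_def \<alpha>1_def \<alpha>2_def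
        right_diff_distrib mult.commute)
  also have "\<dots> = (1 / (q - inverse q)) \<bullet> (D (\<lambda>p. - \<alpha>2 p) * (D \<alpha>1 - D (\<lambda>p. - \<alpha>1 p)) + D \<alpha>1 * (D \<alpha>2 - D (\<lambda>p. - \<alpha>2 p)))"
    unfolding h[symmetric] by (simp only: times_scl scl_add(1))
  also have "D (\<lambda>p. - \<alpha>2 p) * (D \<alpha>1 - D (\<lambda>p. - \<alpha>1 p)) + D \<alpha>1 * (D \<alpha>2 - D (\<lambda>p. - \<alpha>2 p)) =
      D (\<lambda>p. \<alpha>1 p + \<alpha>2 p) - D (\<lambda>p. - \<alpha>2 p + - \<alpha>1 p)"
    by (simp add: right_diff_distrib D_D add.commute)
  also have "D (\<lambda>p. \<alpha>1 p + \<alpha>2 p) = t_act \<alpha>"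
    unfolding t_act_def by (rule D_cong) (auto simp: \<alpha>1_def \<alpha>2_def \<alpha>_def at1_def at2_def modes_def)
  also have "D (\<lambda>p. - \<alpha>2 p + - \<alpha>1 p) = t_act (\<lambda>l. - \<alpha> l)"
    unfolding t_act_def by (rule D_cong) (auto simp: \<alpha>1_def \<alpha>2_def \<alpha>_def at1_def at2_def modes_def)
  finally show ?thesis .
qed

lemma e_parts:
  assumes "c \<in> {1..N}" "d \<in> {1..N}" "c' \<in> {1..N}" "d' \<in> {1..N}"
  shows "c \<noteq> d \<Longrightarrow> e1 c d * e1 c d = 0" and "c \<noteq> d \<Longrightarrow> e2 c d * e2 c d = 0"
    and "e2 c d * e1 c' d' = q powi (of_bool (c = c') + of_bool (d = d') - of_bool (c = d') - of_bool (d = c')) \<bullet> (e1 c' d' * e2 c d)"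
    and "c \<noteq> d' \<Longrightarrow> d \<noteq> c' \<Longrightarrow> e1 c d * e1 c' d' = e1 c' d' * e1 c d"
    and "c \<noteq> d' \<Longrightarrow> d \<noteq> c' \<Longrightarrow> e2 c d * e2 c' d' = e2 c' d' * e2 c d"
proof -
  show "c \<noteq> d \<Longrightarrow> e1 c d * e1 c d = 0"
    unfolding e1_def using assms
    by (subst qhop_mult) (auto simp: hop_hop_same(1))
  show "c \<noteq> d \<Longrightarrow> e2 c d * e2 c d = 0"
    unfolding e2_def using assms
    by (subst qhop_mult) (auto simp: hop_hop_same(1))
  show "e2 c d * e1 c' d' = q powi (of_bool (c = c') + of_bool (d = d') - of_bool (c = d') - of_bool (d = c')) \<bullet> (e1 c' d' * e2 c d)"
    unfolding e2_def e1_def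
    by (subst qhop_comm[where k = "of_bool (c = c') + of_bool (d = d') - of_bool (c = d') - of_bool (d = c')"])
      (use assms in \<open>auto simp: at1_def\<close>)
  show "c \<noteq> d' \<Longrightarrow> d \<noteq> c' \<Longrightarrow> e1 c d * e1 c' d' = e1 c' d' * e1 c d"
    unfolding e1_def by (subst qhop_comm[where k = 0]) (use assms in auto)
  show "e2 c d * e2 c' d' = e2 c' d' * e2 c d" if "c \<noteq> d'" "d \<noteq> c'"
    unfolding e2_def by (subst qhop_comm[where k = 0]) (use assms that in \<open>auto simp: at1_def\<close>)
qed

text \<open>A hop, another hop and the first hop again must create or annihilate some mode twice, unless the second hop
  undoes the first.\<close>

lemma qhop_alternate_zero:
  assumes "s \<in> M" "t \<in> M" "p \<in> M" "r \<in> M" "s \<noteq> t" "p \<noteq> r" "\<not> (s = r \<and> t = p)"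
  shows "qhop w s t * qhop l p r * qhop w s t = 0"
proof -
  have "hop s t * hop p r * hop s t = 0"
  proof (cases "t = p")
    case True
    then have "s \<noteq> r" using assms by simp
    have "hop p r * hop s t = hop s t * hop p r - hop s r"
      using hop_comm[of p r s t] assms \<open>s \<noteq> r\<close> True by simp
    then show ?thesis
      using hop_hop_same(1)[of s t s t] hop_hop_same(1)[of s r s t] assms
      by (simp add: mult.assoc right_diff_distrib) (simp flip: mult.assoc)
  next
    case False
    have "hop s t * hop p r = hop p r * hop s t - (if s = r then hop p t else 0)"
      using hop_comm[of s t p r] assms False by simp
    then have "hop s t * hop p r * hop s t =
        hop p r * (hop s t * hop s t) - (if s = r then hop p t * hop s t else 0)"
      by (simp only: left_diff_distrib mult.assoc) auto
    also have "hop s t * hop s t = 0" using hop_hop_same(1)[of s t s t] assms by simp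
    also have "hop p t * hop s t = 0" using hop_hop_same(2)[of s t p t] assms False by simp
    finally show ?thesis by simp
  qed
  moreover have "hop a b * (D v * z) = q powi (v b - v a) \<bullet> (D v * (hop a b * z))"
    if "a \<in> M" "b \<in> M" for a b v z
    using hop_D[OF that, of v] by (simp flip: mult.assoc)
  ultimately show ?thesis using assms(1-4) by (simp add: qhop_def mult.assoc)
qed

lemma e_comb_commute:
  assumes "c \<in> {1..N}" "d \<in> {1..N}" "c' \<in> {1..N}" "d' \<in> {1..N}" "c \<noteq> c'" "d \<noteq> d'" "c \<noteq> d'" "d \<noteq> c'"
  shows "e_comb x y c d * e_comb x' y' c' d' = e_comb x' y' c' d' * e_comb x y c d"
  using assms by (simp add: e_comb_def distrib_left distrib_right e_parts(3-5) scl_add mult.commute add_ac)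

lemma e_comb_serre:
  fixes x y x' y' :: complex
  assumes "c \<in> {1..N}" "d \<in> {1..N}" "c' \<in> {1..N}" "d' \<in> {1..N}" "c \<noteq> d" "c' \<noteq> d'" "c \<noteq> c'" "d \<noteq> d'" "c = d' \<longleftrightarrow> d \<noteq> c'"
  defines "e \<equiv> e_comb x y c d" and "e' \<equiv> e_comb x' y' c' d'"
  shows "e * (e * e') - (q + 1 / q) \<bullet> (e * (e' * e)) + e' * (e * e) = 0"
  unfolding e_def e'_def e_comb_def
proof (rule serre_adjacent)
  have "e1 c d * e1 c' d' * e1 c d = 0" "e2 c d * e2 c' d' * e2 c d = 0"
    unfolding e1_def e2_def by (rule qhop_alternate_zero; use assms(1-9) in auto)+
  then show "x \<bullet> e1 c d * (x' \<bullet> e1 c' d') * (x \<bullet> e1 c d) = 0"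
    "y \<bullet> e2 c d * (y' \<bullet> e2 c' d') * (y \<bullet> e2 c d) = 0" by simp_all
qed (use assms(1-9) in \<open>auto simp: e_parts(1-3) power_int_minus divide_inverse mult_ac\<close>)

lemma e_comb_serre_double:
  fixes x y x' y' :: complex
  assumes "c \<in> {1..N}" "d \<in> {1..N}" "c \<noteq> d"
  defines "e \<equiv> e_comb x y c d" and "e' \<equiv> e_comb x' y' d c"
  shows "e * (e * e) = 0" and "e * (e * (e' * e)) = e * (e' * (e * e))"
proof -
  have *: "q \<noteq> 0"
    "x \<bullet> e1 c d * (x \<bullet> e1 c d) = 0"
    "y \<bullet> e2 c d * (y \<bullet> e2 c d) = 0"
    "y \<bullet> e2 c d * (x \<bullet> e1 c d) = q\<^sup>2 \<bullet> (x \<bullet> e1 c d * (y \<bullet> e2 c d))"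
    "y \<bullet> e2 c d * (x' \<bullet> e1 d c) = (1 / q\<^sup>2) \<bullet> (x' \<bullet> e1 d c * (y \<bullet> e2 c d))"
    "y' \<bullet> e2 d c * (x \<bullet> e1 c d) = (1 / q\<^sup>2) \<bullet> (x \<bullet> e1 c d * (y' \<bullet> e2 d c))"
    using assms(1-3) by (auto simp: e_parts(1-3) power_int_minus divide_inverse mult_ac)
  show "e * (e * e) = 0" "e * (e * (e' * e)) = e * (e' * (e * e))"
    unfolding e_def e'_def e_comb_def using serre_double[OF *] by simp_all
qed

interpretation dual: fermions q N "\<lambda>p. An (mirror_mode p)" "\<lambda>p. Cr (mirror_mode p)" "\<lambda>w. D (\<lambda>p. w (mirror_mode p))"
  by (rule mirror_fermions)

lemma f_comb_dual: "c \<in> {1..N} \<Longrightarrow> d \<in> {1..N} \<Longrightarrow> f_comb x y c d = dual.e_comb y x (N + 1 - d) (N + 1 - c)"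
  unfolding f_comb_def dual.e_comb_def using dual_e1[of "N + 1 - d" "N + 1 - c"] dual_e2[of "N + 1 - d" "N + 1 - c"] by auto

lemma f_comb_commute:
  assumes "c \<in> {1..N}" "d \<in> {1..N}" "c' \<in> {1..N}" "d' \<in> {1..N}" "c \<noteq> c'" "d \<noteq> d'" "c \<noteq> d'" "d \<noteq> c'"
  shows "f_comb x y c d * f_comb x' y' c' d' = f_comb x' y' c' d' * f_comb x y c d"
  unfolding f_comb_dual[OF assms(1,2)] f_comb_dual[OF assms(3,4)]
  by (rule dual.e_comb_commute) (use assms in auto)

lemma f_comb_serre:
  fixes x y x' y' :: complex
  assumes "c \<in> {1..N}" "d \<in> {1..N}" "c' \<in> {1..N}" "d' \<in> {1..N}" "c \<noteq> d" "c' \<noteq> d'" "c \<noteq> c'" "d \<noteq> d'" "c = d' \<longleftrightarrow> d \<noteq> c'"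
  defines "e \<equiv> f_comb x y c d" and "e' \<equiv> f_comb x' y' c' d'"
  shows "e * (e * e') - (q + 1 / q) \<bullet> (e * (e' * e)) + e' * (e * e) = 0"
  unfolding e_def e'_def f_comb_dual[OF assms(1,2)] f_comb_dual[OF assms(3,4)]
  by (rule dual.e_comb_serre) (use assms(1-9) in auto)

lemma f_comb_serre_double:
  fixes x y x' y' :: complex
  assumes "c \<in> {1..N}" "d \<in> {1..N}" "c \<noteq> d"
  defines "e \<equiv> f_comb x y c d" and "e' \<equiv> f_comb x' y' d c"
  shows "e * (e * e) = 0" and "e * (e * (e' * e)) = e * (e' * (e * e))"
  unfolding e_def e'_def f_comb_dual[OF assms(1,2)] f_comb_dual[OF assms(2,1)]
  by (rule dual.e_comb_serre_double; use assms(1-3) in auto)+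

end

section \<open>The exterior algebra as a fermionic Fock space\<close>

definition wsign :: "nat \<Rightarrow> nat set \<Rightarrow> complex"
  where "wsign i A = (-1) ^ card {a \<in> A. a < i}"

lemma wsign_sq [simp]: "wsign i A * wsign i A = 1" "wsign i A * (wsign i A * z) = z"
proof -
  show 1: "wsign i A * wsign i A = 1" by (simp add: wsign_def flip: power_mult_distrib)
  show "wsign i A * (wsign i A * z) = z" using 1 by (simp flip: mult.assoc)
qed

lemma wsign_insert: "i \<notin> A \<Longrightarrow> wsign j (insert i A) = (if i < j then - wsign j A else wsign j A)"
proof -
  assume "i \<notin> A"
  have "{a \<in> insert i A. a < j} = (if i < j then insert i {a \<in> A. a < j} else {a \<in> A. a < j})" by auto
  moreover have "finite {a \<in> A. a < j}" by simp
  ultimately show ?thesis using \<open>i \<notin> A\<close> by (simp add: wsign_def)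
qed

lemma wsign_remove: "i \<in> A \<Longrightarrow> wsign j (A - {i}) = (if i < j then - wsign j A else wsign j A)"
  using wsign_insert[of i "A - {i}" j] by (auto simp: insert_absorb)

lemma psi_eval: "psi i u A = (if i \<in> A then 0 else wsign i A * u (insert i A))"
  and psi_star_eval: "psi_star i u A = (if i \<in> A then wsign i A * u (A - {i}) else 0)"
  by (simp_all add: psi_def psi_star_def wsign_def)

lemma psi_psi: "psi i (psi j u) A = - psi j (psi i u) A"
  by (cases "i = j"; cases "i < j") (auto simp: psi_eval wsign_insert insert_commute)

lemma psi_star_psi_star: "psi_star i (psi_star j u) A = - psi_star j (psi_star i u) A"
proof -
  have "A - {i} - {j} = A - {j} - {i}" by auto
  then show ?thesis
    by (cases "i = j"; cases "i < j") (auto simp: psi_star_eval wsign_remove)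
qed

lemma psi_psi_star: "psi i (psi_star j u) A = (if i = j then u A else 0) - psi_star j (psi i u) A"
proof (cases "i = j")
  case True
  then show ?thesis
    by (cases "i \<in> A") (auto simp: psi_eval psi_star_eval wsign_insert wsign_remove insert_absorb)
next
  case False
  then have "insert i A - {j} = insert i (A - {j})" by auto
  with False show ?thesis
    by (cases "i < j") (auto simp: psi_eval psi_star_eval wsign_insert wsign_remove)
qed

lemma psi_linear: "linear_map_on UNIV (psi i)" "linear_map_on UNIV (psi_star i)"
  by (auto simp: linear_map_on_def fun_eq_iff psi_eval psi_star_eval cscale_def algebra_simps)

text \<open>The sign of a state of the first factor, counting only the elements of \<open>{1..N}\<close> so that the
  canonical anticommutation relations hold on all functions.\<close>

definition parity_sign :: "nat \<Rightarrow> nat set \<Rightarrow> complex" where "parity_sign N A = (-1) ^ card (A \<inter> {1..N})"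

lemma parity_sign_insert: "i \<notin> A \<Longrightarrow> 1 \<le> i \<Longrightarrow> i \<le> N \<Longrightarrow> parity_sign N (insert i A) = - parity_sign N A"
  by (simp add: parity_sign_def)

lemma parity_sign_remove: "i \<in> A \<Longrightarrow> 1 \<le> i \<Longrightarrow> i \<le> N \<Longrightarrow> parity_sign N (A - {i}) = - parity_sign N A"
  using parity_sign_insert[of i "A - {i}" N] by (auto simp: insert_absorb)

lemma parity_sign_sq [simp]: "parity_sign N A * parity_sign N A = 1" "parity_sign N A * (parity_sign N A * z) = z"
proof -
  show 1: "parity_sign N A * parity_sign N A = 1" by (simp add: parity_sign_def flip: power_mult_distrib)
  show "parity_sign N A * (parity_sign N A * z) = z" using 1 by (simp flip: mult.assoc)
qed

text \<open>The fermions of the second factor carry the sign of the first, as the sign rule for tensor products of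
  maps prescribes; hence they anticommute with those of the first factor.\<close>

lift_definition annihilate :: "nat \<Rightarrow> mode \<Rightarrow> endo" is
  "\<lambda>N (i, s) x (A, B). if s then parity_sign N A * psi i (\<lambda>J. x (A, J)) B else psi i (\<lambda>I. x (I, B)) A"
  by (auto simp: linear_map_on_def fun_eq_iff psi_eval cscale_def algebra_simps)

lift_definition create :: "nat \<Rightarrow> mode \<Rightarrow> endo" is
  "\<lambda>N (i, s) x (A, B). if s then parity_sign N A * psi_star i (\<lambda>J. x (A, J)) B else psi_star i (\<lambda>I. x (I, B)) A"
  by (auto simp: linear_map_on_def fun_eq_iff psi_star_eval cscale_def algebra_simps)

definition energy :: "nat \<Rightarrow> (mode \<Rightarrow> int) \<Rightarrow> nat set \<Rightarrow> nat set \<Rightarrow> int"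
  where "energy N w A B = (\<Sum>i\<in>A \<inter> {1..N}. w (i, False)) + (\<Sum>i\<in>B \<inter> {1..N}. w (i, True))"

lift_definition weight_op :: "complex \<Rightarrow> nat \<Rightarrow> (mode \<Rightarrow> int) \<Rightarrow> endo" is
  "\<lambda>q N w x (A, B). q powi (energy N w A B) * x (A, B)"
  by (auto simp: linear_map_on_def fun_eq_iff cscale_def algebra_simps)

lemma ap_annihilate: "ap (annihilate N (i, False)) x (A, B) = psi i (\<lambda>I. x (I, B)) A"
  "ap (annihilate N (i, True)) x (A, B) = parity_sign N A * psi i (\<lambda>J. x (A, J)) B"
  by (simp_all add: annihilate.rep_eq)
lemma ap_create: "ap (create N (i, False)) x (A, B) = psi_star i (\<lambda>I. x (I, B)) A"
  "ap (create N (i, True)) x (A, B) = parity_sign N A * psi_star i (\<lambda>J. x (A, J)) B"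
  by (simp_all add: create.rep_eq)
lemma ap_weight_op: "ap (weight_op q N w) x (A, B) = q powi (energy N w A B) * x (A, B)"
  by (simp add: weight_op.rep_eq)

lemma endo_eqI: "(\<And>x A B. ap S x (A, B) = ap T x (A, B)) \<Longrightarrow> S = T"
  by (rule ap_eqI) (auto simp: fun_eq_iff)

lemma psi_scale: "psi i (\<lambda>J. c * u J) B = c * psi i u B" "psi_star i (\<lambda>J. c * u J) B = c * psi_star i u B"
  by (simp_all add: psi_eval psi_star_eval)

lemma energy_insert1: "i \<notin> A \<Longrightarrow> 1 \<le> i \<Longrightarrow> i \<le> N \<Longrightarrow> energy N w (insert i A) B = w (i, False) + energy N w A B"
  and energy_insert2: "i \<notin> B \<Longrightarrow> 1 \<le> i \<Longrightarrow> i \<le> N \<Longrightarrow> energy N w A (insert i B) = w (i, True) + energy N w A B"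
  by (simp_all add: energy_def)

lemma energy_remove1: "i \<in> A \<Longrightarrow> 1 \<le> i \<Longrightarrow> i \<le> N \<Longrightarrow> energy N w (A - {i}) B = energy N w A B - w (i, False)"
  and energy_remove2: "i \<in> B \<Longrightarrow> 1 \<le> i \<Longrightarrow> i \<le> N \<Longrightarrow> energy N w A (B - {i}) = energy N w A B - w (i, True)"
  using energy_insert1[of i "A - {i}" N w B] energy_insert2[of i "B - {i}" N w A] by (auto simp: insert_absorb)

lemma fermions_model:
  assumes "generic_q q"
  shows "fermions q N (annihilate N) (create N) (weight_op q N)"
proof (intro fermions.intro fermions_axioms.intro)
  interpret generic_q q by fact
  show "generic_q q" by fact
  show "weight_op q N (\<lambda>_. 0) = 1"
    by (rule endo_eqI) (simp add: ap_weight_op energy_def ap_simps)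
  show "weight_op q N v * weight_op q N w = weight_op q N (\<lambda>p. v p + w p)" for v w
    by (rule endo_eqI) (simp add: ap_weight_op energy_def ap_simps sum.distrib power_int_add)
  show "weight_op q N v = weight_op q N w" if "\<And>p. p \<in> modes N \<Longrightarrow> v p = w p" for v w
  proof -
    have "energy N v A B = energy N w A B" for A B
      unfolding energy_def using that by (intro arg_cong2[of _ _ _ _ "(+)"] sum.cong) (auto simp: modes_def)
    then show ?thesis by (intro endo_eqI) (simp add: ap_weight_op)
  qed
  fix p assume p: "p \<in> modes N"
  obtain i s where ps: "p = (i, s)" and i: "1 \<le> i" "i \<le> N" using p by (cases p) (auto simp: modes_def)
  note ev = ap_simps ap_annihilate ap_create ap_weight_op psi_eval psi_star_eval
  show "annihilate N p * annihilate N p = 0"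
    by (rule endo_eqI; cases s) (auto simp: ev ps)
  show "create N p * create N p = 0"
    by (rule endo_eqI; cases s) (auto simp: ev ps)
  show "weight_op q N w * create N p = q powi w p \<bullet> (create N p * weight_op q N w)" for w
    by (rule endo_eqI; cases s)
      (use i in \<open>auto simp: ev ps cscale_def energy_remove1 energy_remove2 power_int_diff\<close>)
  show "weight_op q N w * annihilate N p = q powi (- w p) \<bullet> (annihilate N p * weight_op q N w)" for w
    by (rule endo_eqI; cases s)
      (use i in \<open>auto simp: ev ps cscale_def energy_insert1 energy_insert2 power_int_add power_int_minus\<close>)
  show "weight_op q N (\<lambda>r. if r = p then n else 0) = 1 + (q powi n - 1) \<bullet> (create N p * annihilate N p)" for n
  proof (rule endo_eqI)
    fix x A B
    have "energy N (\<lambda>r. if r = p then n else 0) A B = (if (if s then i \<in> B else i \<in> A) then n else 0)"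
      using i by (cases s) (auto simp: energy_def ps sum.delta)
    then show "ap (weight_op q N (\<lambda>r. if r = p then n else 0)) x (A, B) =
        ap (1 + (q powi n - 1) \<bullet> (create N p * annihilate N p)) x (A, B)"
      by (cases s) (auto simp: ev ps cscale_def wsign_remove insert_absorb algebra_simps)
  qed
  fix r assume r: "r \<in> modes N"
  obtain j t where jt: "r = (j, t)" and j: "1 \<le> j" "j \<le> N" using r by (cases r) (auto simp: modes_def)
  show "annihilate N p * annihilate N r = - (annihilate N r * annihilate N p)"
  proof (cases "s = t")
    case True
    then show ?thesis
      by (intro endo_eqI; cases t) (auto simp: ps jt ap_simps ap_annihilate psi_scale intro: psi_psi)
  next
    case False
    then show ?thesis
      by (intro endo_eqI; cases t) (use i j in \<open>auto simp: ps jt ev parity_sign_insert\<close>)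
  qed
  show "create N p * create N r = - (create N r * create N p)"
  proof (cases "s = t")
    case True
    then show ?thesis
      by (intro endo_eqI; cases t) (auto simp: ps jt ap_simps ap_create psi_scale intro: psi_star_psi_star)
  next
    case False
    then show ?thesis
      by (intro endo_eqI; cases t) (use i j in \<open>auto simp: ps jt ev parity_sign_remove\<close>)
  qed
  show "annihilate N p * create N r = (if p = r then 1 else 0) - create N r * annihilate N p"
  proof (cases "s = t")
    case True
    then show ?thesis
      by (intro endo_eqI; cases t) (auto simp: ps jt ap_simps ap_create ap_annihilate psi_scale psi_psi_star)
  next
    case False
    then show ?thesis
      by (intro endo_eqI; cases t) (use i j in \<open>auto simp: ps jt ev parity_sign_remove parity_sign_insert\<close>)
  qed
qed

section \<open>From tensor products of maps to the operator ring\<close>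

locale braiding_setting = generic_q +
  fixes N :: nat
  assumes N2: "N \<ge> 2"

sublocale braiding_setting \<subseteq> fermions q N "annihilate N" "create N" "weight_op q N"
  by (rule fermions_model) unfold_locales

context braiding_setting
begin

definition sector :: "nat \<Rightarrow> nat \<Rightarrow> ext2 set" where
  "sector k k' = {x. \<forall>A B. x (A, B) \<noteq> 0 \<longrightarrow> A \<subseteq> {1..N} \<and> B \<subseteq> {1..N} \<and> card A = k \<and> card B = k'}"

definition on_sites :: "ext2 set" where
  "on_sites = {x. \<forall>A B. x (A, B) \<noteq> 0 \<longrightarrow> A \<subseteq> {1..N} \<and> B \<subseteq> {1..N}}"

lemma sector_on_sites: "x \<in> sector k k' \<Longrightarrow> x \<in> on_sites"
  by (auto simp: sector_def on_sites_def)

lemma sectorD: "x \<in> sector k k' \<Longrightarrow> x (A, B) \<noteq> 0 \<Longrightarrow> A \<subseteq> {1..N} \<and> B \<subseteq> {1..N} \<and> card A = k \<and> card B = k'"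
  unfolding sector_def by blast

lemma on_sitesD: "x \<in> on_sites \<Longrightarrow> x (A, B) \<noteq> 0 \<Longrightarrow> A \<subseteq> {1..N} \<and> B \<subseteq> {1..N}"
  unfolding on_sites_def by blast

lemma linear_0: "linear_map_on UNIV f \<Longrightarrow> f 0 = 0"
  unfolding linear_map_on_def by (metis UNIV_I cfun.scale_zero_left)

lemma linear_sum: "linear_map_on UNIV f \<Longrightarrow> f (\<Sum>i\<in>S. c i \<odot> g i) = (\<Sum>i\<in>S. c i \<odot> f (g i))"
proof (induction S rule: infinite_finite_induct)
  case (insert x F)
  then show ?case
    by (simp only: sum.insert[OF insert.hyps(1,2)] linear_map_on_def UNIV_I Ball_def simp_thms)
qed (simp_all only: sum.infinite sum.empty linear_0 not_False_eq_True)

lemma sum_fun_eval: "(\<Sum>i\<in>S. f i) b = (\<Sum>i\<in>S. f i b)" for f :: "'i \<Rightarrow> 'b \<Rightarrow> complex"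
  by (induction S rule: infinite_finite_induct) simp_all

lemma linear_expand:
  assumes "linear_map_on UNIV f" "\<And>I. u I \<noteq> 0 \<Longrightarrow> I \<subseteq> {1..N}"
  shows "f u A = (\<Sum>I\<in>Pow {1..N}. u I * f (basis_vec I) A)"
proof -
  have "u = (\<Sum>I\<in>Pow {1..N}. u I \<odot> basis_vec I)"
  proof
    fix J
    have "(\<Sum>I\<in>Pow {1..N}. u I \<odot> basis_vec I) J = (\<Sum>I\<in>Pow {1..N}. if I = J then u I else 0)"
      unfolding sum_fun_eval by (intro sum.cong) (auto simp: cscale_def basis_vec_def)
    also have "\<dots> = u J" using assms(2) by (auto simp: sum.delta)
    finally show "u J = (\<Sum>I\<in>Pow {1..N}. u I \<odot> basis_vec I) J" by simp
  qed
  then have "f u A = f (\<Sum>I\<in>Pow {1..N}. u I \<odot> basis_vec I) A" by simp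
  then show ?thesis unfolding linear_sum[OF assms(1)] sum_fun_eval by (simp add: cscale_def)
qed

text \<open>For maps that are homogeneous of parity \<open>p\<close> on the second factor, the double sum over basis vectors is the
  successive application of the two maps.\<close>

lemma tensor_op_eval:
  assumes f: "linear_map_on UNIV f" and g: "linear_map_on UNIV g"
    and parity_sign: "\<And>J B. J \<subseteq> {1..N} \<Longrightarrow> g (basis_vec J) B \<noteq> 0 \<Longrightarrow> even (card J + card B + p)"
    and x: "x \<in> on_sites"
  shows "tensor_op N f g x (A, B) = f (\<lambda>I. (-1) ^ (p * card I) * g (\<lambda>J. x (I, J)) B) A"
proof -
  have g0: "g (\<lambda>J. x (I, J)) B = (\<Sum>J\<in>Pow {1..N}. x (I, J) * g (basis_vec J) B)" for I
    by (rule linear_expand[OF g]) (use x in \<open>auto simp: on_sites_def\<close>)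
  have "f (\<lambda>I. (-1) ^ (p * card I) * g (\<lambda>J. x (I, J)) B) A =
      (\<Sum>I\<in>Pow {1..N}. ((-1) ^ (p * card I) * g (\<lambda>J. x (I, J)) B) * f (basis_vec I) A)"
  proof (rule linear_expand[OF f])
    fix I assume "(-1) ^ (p * card I) * g (\<lambda>J. x (I, J)) B \<noteq> 0"
    then have "\<exists>J. x (I, J) \<noteq> 0"
      unfolding g0 by (metis (no_types, lifting) mult_eq_0_iff sum.neutral)
    then show "I \<subseteq> {1..N}" using x by (auto simp: on_sites_def)
  qed
  also have "\<dots> = (\<Sum>I\<in>Pow {1..N}. \<Sum>J\<in>Pow {1..N}.
    (-1) ^ ((card J + card B) * card I) * x (I, J) * f (basis_vec I) A * g (basis_vec J) B)"
  proof (intro sum.cong refl)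
    fix I
    have "(-1) ^ (p * card I) * (x (I, J) * g (basis_vec J) B) * f (basis_vec I) A =
        (-1) ^ ((card J + card B) * card I) * x (I, J) * f (basis_vec I) A * g (basis_vec J) B"
      if "J \<in> Pow {1..N}" for J
    proof (cases "g (basis_vec J) B = 0")
      case False
      then have "even (card J + card B + p)" using parity_sign that by simp
      then have "((-1) :: complex) ^ ((card J + card B) * card I) = (-1) ^ (p * card I)"
        by (simp add: minus_one_power_iff)
      then show ?thesis by simp
    qed simp
    then show "(-1) ^ (p * card I) * g (\<lambda>J. x (I, J)) B * f (basis_vec I) A =
       (\<Sum>J\<in>Pow {1..N}. (-1) ^ ((card J + card B) * card I) * x (I, J) * f (basis_vec I) A * g (basis_vec J) B)"
      unfolding g0 sum_distrib_left sum_distrib_right by (intro sum.cong) auto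
  qed
  finally show ?thesis by (simp add: tensor_op_def)
qed

section \<open>Weights\<close>

lemma t_pow_eval: "t_pow q i n u A = (if i \<in> A then q powi n else 1) * u A"
  by (auto simp: t_pow_def psi_eval psi_star_eval cscale_def wsign_insert wsign_remove insert_absorb)

text \<open>The diagonal map by which \<open>t\<^sub>\<nu>\<close> acts on the exterior algebra.\<close>

definition tdiag :: "(nat \<Rightarrow> int) \<Rightarrow> ext \<Rightarrow> ext"
  where "tdiag \<nu> u = (\<lambda>A. q powi (\<Sum>i\<in>A \<inter> {1..N}. \<nu> i) * u A)"

lemma op_prod_t_pow:
  "op_prod (map (\<lambda>i. t_pow q i (\<nu> i)) [1..<n + 1]) u = (\<lambda>A. q powi (\<Sum>i\<in>A \<inter> {1..n}. \<nu> i) * u A)"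
proof (induction n arbitrary: u)
  case 0
  then show ?case by (simp add: op_prod_def)
next
  case (Suc n)
  have "op_prod (map (\<lambda>i. t_pow q i (\<nu> i)) [1..<Suc n + 1]) u =
      op_prod (map (\<lambda>i. t_pow q i (\<nu> i)) [1..<n + 1]) (t_pow q (Suc n) (\<nu> (Suc n)) u)"
  proof -
    have "foldr (\<circ>) fs (g \<circ> h) = foldr (\<circ>) fs g \<circ> h" for fs :: "(ext \<Rightarrow> ext) list" and g h
      by (induction fs) (auto simp: o_assoc)
    from this[of _ id "t_pow q (Suc n) (\<nu> (Suc n))"] show ?thesis
      by (simp add: op_prod_def)
  qed
  also have "\<dots> = (\<lambda>A. q powi (\<Sum>i\<in>A \<inter> {1..Suc n}. \<nu> i) * u A)"
  proof
    fix A
    have "A \<inter> {1..Suc n} = (if Suc n \<in> A then insert (Suc n) (A \<inter> {1..n}) else A \<inter> {1..n})"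
      by (auto simp: le_Suc_eq)
    then show "op_prod (map (\<lambda>i. t_pow q i (\<nu> i)) [1..<n + 1]) (t_pow q (Suc n) (\<nu> (Suc n)) u) A =
       q powi (\<Sum>i\<in>A \<inter> {1..Suc n}. \<nu> i) * u A"
      unfolding Suc by (simp add: t_pow_eval power_int_add)
  qed
  finally show ?case .
qed

lemma act_t_ext: "act_t (ext_module q N j z) \<nu> = tdiag \<nu>"
  by (rule ext) (simp only: ext_module_def uq_mod.select_convs op_prod_t_pow tdiag_def)

lemma tdiag_linear: "linear_map_on UNIV (tdiag \<nu>)"
  by (auto simp: linear_map_on_def tdiag_def cscale_def fun_eq_iff algebra_simps)

lemma id_linear: "linear_map_on UNIV (id :: ext \<Rightarrow> ext)"
  by (simp add: linear_map_on_def)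

lemma even_tdiag: "tdiag \<nu> (basis_vec J) B \<noteq> 0 \<Longrightarrow> even (card J + card B + 0)"
  by (auto simp: tdiag_def basis_vec_def split: if_splits)

lemma even_id: "id (basis_vec J) B \<noteq> 0 \<Longrightarrow> even (card J + card B + 0)"
  by (auto simp: basis_vec_def split: if_splits)

lemma tensor_tdiag:
  assumes "x \<in> on_sites"
  shows "tensor_op N (tdiag \<nu>) (tdiag \<mu>) x = ap (weight_op q N (\<lambda>p. if snd p then \<mu> (fst p) else \<nu> (fst p))) x"
proof (rule ext, clarify)
  fix A B
  show "tensor_op N (tdiag \<nu>) (tdiag \<mu>) x (A, B) = ap (weight_op q N (\<lambda>p. if snd p then \<mu> (fst p) else \<nu> (fst p))) x (A, B)"
    by (subst tensor_op_eval[OF tdiag_linear tdiag_linear even_tdiag assms])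
      (simp_all add: tdiag_def ap_weight_op energy_def power_int_add)
qed

section \<open>The generators\<close>

definition hop1 :: "complex \<Rightarrow> nat \<Rightarrow> nat \<Rightarrow> ext \<Rightarrow> ext"
  where "hop1 w c d u = w \<odot> psi_star c (psi d u)"

lemma hop1_linear: "linear_map_on UNIV (hop1 w c d)"
  using psi_linear[of d] psi_linear[of c]
  by (simp add: linear_map_on_def hop1_def cfun.scale_right_distrib mult.commute)

lemma even_hop1:
  assumes "J \<subseteq> {1..N}" "hop1 w c d (basis_vec J) B \<noteq> 0"
  shows "even (card J + card B + 0)"
proof -
  have J: "J = insert d (B - {c})" "c \<in> B" "d \<notin> B - {c}"
    using assms(2) by (auto simp: hop1_def cscale_def psi_eval psi_star_eval basis_vec_def split: if_splits)
  have "finite (B - {c})" using assms(1) J(1) by (metis finite_atLeastAtMost finite_insert finite_subset)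
  then have "card J = card B" using J by (metis card.insert card_insert_if insert_Diff finite_insert card_Suc_Diff1)
  then show ?thesis by simp
qed

lemma ext_act_e: "i < N \<Longrightarrow> act_e (ext_module q N j z) i = hop1 (if i = 0 then z else 1) (cyc N i) (i + 1)"
  by (rule ext) (simp add: ext_module_def hop1_def cyc_def)

lemma ext_act_f: "i < N \<Longrightarrow> act_f (ext_module q N j z) i = hop1 (inverse (if i = 0 then z else 1)) (i + 1) (cyc N i)"
  by (rule ext) (simp add: ext_module_def hop1_def cyc_def)

definition spectral :: "nat \<Rightarrow> complex \<Rightarrow> complex" where "spectral i z = (if i = 0 then z else 1)"

lemma sroot_eq: "sroot N i l = (if l = cyc N i then 1 else 0) - (if l = i + 1 then 1 else 0)"
  by (simp add: sroot_def eps_def)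

lemma cyc_range: "i < N \<Longrightarrow> cyc N i \<in> {1..N} \<and> i + 1 \<in> {1..N} \<and> cyc N i \<noteq> i + 1"
  using N2 by (auto simp: cyc_def)

lemma ap_hop:
  assumes "1 \<le> c" "c \<le> N" "1 \<le> d" "d \<le> N"
  shows "ap (hop (c, False) (d, False)) x (A, B) = psi_star c (psi d (\<lambda>I. x (I, B))) A"
    and "ap (hop (c, True) (d, True)) x (A, B) = psi_star c (psi d (\<lambda>J. x (A, J))) B"
  by (simp_all add: hop_def ap_simps ap_annihilate ap_create psi_scale)

lemma psi_scale_right: "psi i (\<lambda>J. u J * c) = (\<lambda>B. psi i u B * c)"
  "psi_star i (\<lambda>J. u J * c) = (\<lambda>B. psi_star i u B * c)"
  by (simp_all add: fun_eq_iff psi_eval psi_star_eval)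

lemma act_e_tensor:
  assumes "i < N" "x \<in> on_sites"
  shows "act_e (ext_tensor q N k z k' z') i x = ap (e_comb (spectral i z) (spectral i z') (cyc N i) (i + 1)) x"
proof (rule ext, clarify)
  fix A B
  let ?c = "cyc N i" and ?d = "i + 1"
  have cd: "1 \<le> ?c" "?c \<le> N" "1 \<le> ?d" "?d \<le> N" using cyc_range[OF assms(1)] by auto
  have "act_e (ext_tensor q N k z k' z') i x (A, B) =
      hop1 (spectral i z) ?c ?d (\<lambda>I. x (I, B)) A + tdiag (sroot N i) (\<lambda>I. hop1 (spectral i z') ?c ?d (\<lambda>J. x (I, J)) B) A"
    unfolding ext_tensor_def tensor_module_def uq_mod.select_convs ext_act_e[OF assms(1)] act_t_ext plus_fun_apply
      spectral_def[symmetric]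
    by (subst tensor_op_eval[OF hop1_linear id_linear even_id assms(2)], simp,
        subst tensor_op_eval[OF tdiag_linear hop1_linear even_hop1 assms(2)]) simp_all
  also have "\<dots> = ap (e_comb (spectral i z) (spectral i z') ?c ?d) x (A, B)"
    using cd
    by (simp add: e_comb_def e1_def e2_def qhop_def ap_simps ap_weight_op ap_hop hop1_def cscale_def tdiag_def energy_def
        D_0 at1_def sroot_eq mult_ac)
  finally show "act_e (ext_tensor q N k z k' z') i x (A, B) = ap (e_comb (spectral i z) (spectral i z') ?c ?d) x (A, B)" .
qed

lemma act_f_tensor:
  assumes "i < N" "x \<in> on_sites"
  shows "act_f (ext_tensor q N k z k' z') i x = ap (f_comb (inverse (spectral i z)) (inverse (spectral i z')) (cyc N i) (i + 1)) x"
proof (rule ext, clarify)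
  fix A B
  let ?c = "cyc N i" and ?d = "i + 1"
  have cd: "1 \<le> ?c" "?c \<le> N" "1 \<le> ?d" "?d \<le> N" using cyc_range[OF assms(1)] by auto
  have "act_f (ext_tensor q N k z k' z') i x (A, B) =
      hop1 (inverse (spectral i z)) ?d ?c (\<lambda>I. tdiag (- sroot N i) (\<lambda>J. x (I, J)) B) A
      + hop1 (inverse (spectral i z')) ?d ?c (\<lambda>J. x (A, J)) B"
    unfolding ext_tensor_def tensor_module_def uq_mod.select_convs ext_act_f[OF assms(1)] act_t_ext plus_fun_apply
      spectral_def[symmetric]
    by (subst tensor_op_eval[OF hop1_linear tdiag_linear even_tdiag assms(2)], simp,
        subst tensor_op_eval[OF id_linear hop1_linear even_hop1 assms(2)]) simp_all
  also have "\<dots> = ap (f_comb (inverse (spectral i z)) (inverse (spectral i z')) ?c ?d) x (A, B)"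
    using cd
    by (simp add: f_comb_def f1_def f2_def qhop_def ap_simps ap_weight_op ap_hop hop1_def cscale_def tdiag_def energy_def
        D_0 at2_def sroot_eq psi_scale psi_scale_right mult_ac)
  finally show "act_f (ext_tensor q N k z k' z') i x (A, B) =
    ap (f_comb (inverse (spectral i z)) (inverse (spectral i z')) ?c ?d) x (A, B)" .
qed

lemma act_t_tensor:
  assumes "x \<in> on_sites"
  shows "act_t (ext_tensor q N k z k' z') \<nu> x = ap (t_act \<nu>) x"
  unfolding ext_tensor_def tensor_module_def uq_mod.select_convs act_t_ext tensor_tdiag[OF assms] t_act_def
  by simp

lemma space_tensor: "space_of (ext_tensor q N k z k' z') = sector k k'"
proof -
  have e: "space_of (ext_tensor q N k z k' z') =
      cfun.span {tensor_vec u w | u w. u \<in> ext_power N k \<and> w \<in> ext_power N k'}"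
    by (simp add: ext_tensor_def tensor_module_def ext_module_def)
  have sub: "cfun.subspace (sector k k')"
  proof (rule cfun.subspaceI)
    fix x y :: ext2 and c assume "x \<in> sector k k'"
    moreover have "x (A, B) \<noteq> 0" if "(c \<odot> x) (A, B) \<noteq> 0" for A B
      using that by (simp add: cscale_def)
    ultimately show "c \<odot> x \<in> sector k k'" unfolding sector_def by blast
    assume "x \<in> sector k k'" "y \<in> sector k k'"
    moreover have "x (A, B) \<noteq> 0 \<or> y (A, B) \<noteq> 0" if "(x + y) (A, B) \<noteq> 0" for A B
      using that by auto
    ultimately show "x + y \<in> sector k k'" unfolding sector_def by blast
  qed (simp add: sector_def)
  have "{tensor_vec u w | u w. u \<in> ext_power N k \<and> w \<in> ext_power N k'} \<subseteq> sector k k'"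
    by (auto simp: tensor_vec_def ext_power_def sector_def)
  then have 1: "space_of (ext_tensor q N k z k' z') \<subseteq> sector k k'"
    unfolding e using cfun.span_minimal[OF _ sub] by blast
  have "x \<in> space_of (ext_tensor q N k z k' z')" if x: "x \<in> sector k k'" for x
  proof -
    let ?S = "{(A, B). A \<subseteq> {1..N} \<and> B \<subseteq> {1..N} \<and> card A = k \<and> card B = k'}"
    have fin: "finite ?S"
      by (rule finite_subset[of _ "Pow {1..N} \<times> Pow {1..N}"]) auto
    have "x = (\<Sum>p\<in>?S. x p \<odot> tensor_vec (basis_vec (fst p)) (basis_vec (snd p)))"
    proof (rule ext, clarify)
      fix A B
      have "(\<Sum>p\<in>?S. x p \<odot> tensor_vec (basis_vec (fst p)) (basis_vec (snd p))) (A, B) =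
         (\<Sum>p\<in>?S. if p = (A, B) then x p else 0)"
        unfolding sum_fun_eval by (intro sum.cong) (auto simp: cscale_def tensor_vec_def basis_vec_def)
      also have "\<dots> = x (A, B)" using sectorD[OF x, of A B] fin by (cases "x (A, B) = 0") (auto simp: sum.delta)
      finally show "x (A, B) = (\<Sum>p\<in>?S. x p \<odot> tensor_vec (basis_vec (fst p)) (basis_vec (snd p))) (A, B)" by simp
    qed
    moreover have "(\<Sum>p\<in>?S. x p \<odot> tensor_vec (basis_vec (fst p)) (basis_vec (snd p))) \<in> space_of (ext_tensor q N k z k' z')"
      unfolding e
    proof (intro cfun.span_sum cfun.span_scale cfun.span_base)
      fix p assume "p \<in> ?S"
      then have "basis_vec (fst p) \<in> ext_power N k" "basis_vec (snd p) \<in> ext_power N k'"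
        by (auto simp: ext_power_def basis_vec_def)
      then show "tensor_vec (basis_vec (fst p)) (basis_vec (snd p)) \<in>
          {tensor_vec u w | u w. u \<in> ext_power N k \<and> w \<in> ext_power N k'}" by blast
    qed
    ultimately show ?thesis by simp
  qed
  with 1 show ?thesis by blast
qed

lemma sector_subspace: "cfun.subspace (sector k k')"
  unfolding space_tensor[of k 1 k' 1, symmetric] ext_tensor_def tensor_module_def by simp

section \<open>The operators E and F\<close>

lemma psi_even: "J \<subseteq> {1..N} \<Longrightarrow> psi i (basis_vec J) B \<noteq> 0 \<Longrightarrow> even (card J + card B + 1)"
proof -
  assume J: "J \<subseteq> {1..N}" "psi i (basis_vec J) B \<noteq> 0"
  then have "J = insert i B" "i \<notin> B" by (auto simp: psi_eval basis_vec_def split: if_splits)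
  moreover have "finite J" using J(1) finite_subset by blast
  ultimately show ?thesis by simp
qed

lemma psi_star_even: "J \<subseteq> {1..N} \<Longrightarrow> psi_star i (basis_vec J) B \<noteq> 0 \<Longrightarrow> even (card J + card B + 1)"
proof -
  assume J: "J \<subseteq> {1..N}" "psi_star i (basis_vec J) B \<noteq> 0"
  then have "J = B - {i}" "i \<in> B" by (auto simp: psi_star_eval basis_vec_def split: if_splits)
  moreover have "finite J" using J(1) finite_subset by blast
  ultimately have "card B = Suc (card J)" by (metis card.insert finite_Diff_insert finite_Diff2 finite_insert insert_Diff Diff_iff insertI1)
  then show ?thesis by simp
qed

lemma card_parity_sign: "x \<in> on_sites \<Longrightarrow> linear_map_on UNIV g \<Longrightarrow>
  (-1) ^ (1 * card I) * g (\<lambda>J. x (I, J)) B = parity_sign N I * g (\<lambda>J. x (I, J)) B"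
proof (cases "I \<subseteq> {1..N}")
  case True
  then show ?thesis by (simp add: parity_sign_def Int_absorb2)
next
  case False
  assume "x \<in> on_sites" "linear_map_on UNIV g"
  then have "x (I, J) = 0" for J using False on_sitesD[of x I J] by auto
  then have "(\<lambda>J. x (I, J)) = 0" by auto
  then show ?thesis using linear_0[OF \<open>linear_map_on UNIV g\<close>] by simp
qed

lemma tensor_star_psi: "x \<in> on_sites \<Longrightarrow> tensor_op N (psi_star i) (psi i) x = ap (hop (i, False) (i, True)) x"
proof (rule ext, clarify)
  fix A B assume x: "x \<in> on_sites"
  show "tensor_op N (psi_star i) (psi i) x (A, B) = ap (hop (i, False) (i, True)) x (A, B)"
    by (subst tensor_op_eval[OF psi_linear(2,1) psi_even x])
      (simp_all only: card_parity_sign[OF x psi_linear(1)] hop_def ap_simps ap_annihilate ap_create)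
qed

lemma tensor_psi_star: "x \<in> on_sites \<Longrightarrow> 1 \<le> i \<Longrightarrow> i \<le> N \<Longrightarrow> tensor_op N (psi i) (psi_star i) x = - ap (hop (i, True) (i, False)) x"
proof (rule ext, clarify)
  fix A B assume x: "x \<in> on_sites" and i: "1 \<le> i" "i \<le> N"
  have "annihilate N (i, False) * create N (i, True) = - hop (i, True) (i, False)"
    using An_Cr[of "(i, False)" "(i, True)"] i by (simp add: hop_def)
  then have "ap (annihilate N (i, False) * create N (i, True)) x (A, B) = (- ap (hop (i, True) (i, False)) x) (A, B)"
    by (simp add: ap_simps)
  then show "tensor_op N (psi i) (psi_star i) x (A, B) = (- ap (hop (i, True) (i, False)) x) (A, B)"
    by (subst tensor_op_eval[OF psi_linear(1,2) psi_star_even x])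
      (simp_all only: card_parity_sign[OF x psi_linear(2)] ap_simps ap_annihilate ap_create)
qed

lemma on_sites_weight_op: "x \<in> on_sites \<Longrightarrow> ap (weight_op q N w) x \<in> on_sites"
  by (auto simp: on_sites_def ap_weight_op)

lemma t_pow_tdiag: "1 \<le> i \<Longrightarrow> i \<le> N \<Longrightarrow> t_pow q i n = tdiag (\<lambda>l. if l = i then n else 0)"
  by (rule ext, rule ext) (auto simp: t_pow_eval tdiag_def sum.delta)

lemma K_op_eval:
  assumes "1 \<le> i" "i \<le> N" "x \<in> on_sites"
  shows "K_op q N i x = ap (weight_op q N (K_weight {i})) x" and "K_inv_op q N i x = ap (weight_op q N (\<lambda>p. - K_weight {i} p)) x"
  unfolding K_op_def K_inv_op_def t_pow_tdiag[OF assms(1,2)] tensor_tdiag[OF assms(3)]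
  by (intro arg_cong2[of _ _ _ _ ap] D_cong; auto simp: K_weight_def)+

lemma op_prod_K:
  assumes "\<And>i. i \<in> set xs \<Longrightarrow> 1 \<le> i \<and> i \<le> N" "distinct xs" "x \<in> on_sites"
  shows "op_prod (map (K_op q N) xs) x = ap (weight_op q N (K_weight (set xs))) x"
    and "op_prod (map (K_inv_op q N) xs) x = ap (weight_op q N (\<lambda>p. - K_weight (set xs) p)) x"
proof -
  have "op_prod (map (K_op q N) xs) x = ap (weight_op q N (K_weight (set xs))) x
    \<and> op_prod (map (K_inv_op q N) xs) x = ap (weight_op q N (\<lambda>p. - K_weight (set xs) p)) x"
    using assms(1,2)
  proof (induction xs)
    case Nil
    show ?case using D_0_fun[of "K_weight {}"] D_0_fun[of "\<lambda>p. - K_weight {} p"]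
      by (simp add: op_prod_def K_weight_def ap_simps)
  next
    case (Cons i xs)
    have "op_prod (map (K_op q N) (i # xs)) x = ap (weight_op q N (K_weight {i})) (ap (weight_op q N (K_weight (set xs))) x)"
      "op_prod (map (K_inv_op q N) (i # xs)) x = ap (weight_op q N (\<lambda>p. - K_weight {i} p)) (ap (weight_op q N (\<lambda>p. - K_weight (set xs) p)) x)"
      using Cons K_op_eval[of i] on_sites_weight_op[OF assms(3)] by (simp_all add: op_prod_def)
    moreover have "weight_op q N (K_weight {i}) * weight_op q N (K_weight (set xs)) = weight_op q N (K_weight (set (i # xs)))"
      "weight_op q N (\<lambda>p. - K_weight {i} p) * weight_op q N (\<lambda>p. - K_weight (set xs) p) = weight_op q N (\<lambda>p. - K_weight (set (i # xs)) p)"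
      unfolding D_D using Cons.prems(2) by (intro D_cong; auto simp: K_weight_def)+
    ultimately show ?case by (metis times_endo.rep_eq)
  qed
  then show "op_prod (map (K_op q N) xs) x = ap (weight_op q N (K_weight (set xs))) x"
    "op_prod (map (K_inv_op q N) xs) x = ap (weight_op q N (\<lambda>p. - K_weight (set xs) p)) x" by auto
qed

lemma on_sites_hop:
  assumes "x \<in> on_sites" "1 \<le> i" "i \<le> N" "1 \<le> j" "j \<le> N"
  shows "ap (hop (i, s) (j, t)) x \<in> on_sites"
proof -
  have "A \<subseteq> {1..N} \<and> B \<subseteq> {1..N}" if nz: "ap (hop (i, s) (j, t)) x (A, B) \<noteq> 0" for A B
  proof -
    have "x (if s then A else A - {i}, if s then B - {i} else B) \<noteq> 0
       \<or> x (if t then (if s then A else A - {i}) else insert j (if s then A else A - {i}),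
            if t then insert j (if s then B - {i} else B) else (if s then B - {i} else B)) \<noteq> 0"
      using nz by (cases s; cases t)
        (auto simp: hop_def ap_simps ap_annihilate ap_create psi_eval psi_star_eval split: if_splits)
    then obtain A' B' where "x (A', B') \<noteq> 0" "A - {i} \<subseteq> A'" "B - {i} \<subseteq> B'"
      by (cases s; cases t) auto
    with on_sitesD[OF assms(1), of A' B'] assms(2,3) show ?thesis by auto
  qed
  then show ?thesis unfolding on_sites_def by blast
qed

lemma E_op_eval:
  assumes x: "x \<in> on_sites"
  shows "E_op q N x = ap E x"
  unfolding E_op_def E_def ap_sum_left
proof (rule sum.cong[OF refl])
  fix i assume i: "i \<in> {1..N}"
  have "op_prod (map (K_op q N) [i + 1..<N + 1]) x = ap (weight_op q N (K_weight (set [i + 1..<N + 1]))) x"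
    by (rule op_prod_K(1)[OF _ _ x]) (auto simp del: upt_Suc)
  also have "weight_op q N (K_weight (set [i + 1..<N + 1])) = weight_op q N (K_weight {i<..})"
    by (rule D_cong) (auto simp: K_weight_def modes_def simp del: upt_Suc)
  finally have *: "op_prod (map (K_op q N) [i + 1..<N + 1]) x = ap (weight_op q N (K_weight {i<..})) x" .
  have "hop (i, False) (i, True) * weight_op q N (K_weight {i<..}) = qhop (K_weight {i<..}) (i, False) (i, True)"
    using hop_D[of "(i, False)" "(i, True)" "K_weight {i<..}"] i by (simp add: qhop_def K_weight_def)
  then show "tensor_op N (psi_star i) (psi i) (op_prod (map (K_op q N) [i + 1..<N + 1]) x) =
      ap (qhop (K_weight {i<..}) (i, False) (i, True)) x"
    unfolding * using tensor_star_psi[OF on_sites_weight_op[OF x]] by (metis times_endo.rep_eq)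
qed

lemma F_op_eval:
  assumes x: "x \<in> on_sites"
  shows "F_op q N x = ap F x"
proof -
  have "op_prod (map (K_inv_op q N) [1..<i]) (tensor_op N (psi i) (psi_star i) x) =
      - ap (qhop (\<lambda>p. - K_weight {..<i} p) (i, True) (i, False)) x" if i: "i \<in> {1..N}" for i
  proof -
    have s: "- ap (hop (i, True) (i, False)) x \<in> on_sites"
      using on_sites_hop[OF x, of i i True False] i by (simp add: on_sites_def)
    have "op_prod (map (K_inv_op q N) [1..<i]) (tensor_op N (psi i) (psi_star i) x) =
        ap (weight_op q N (\<lambda>p. - K_weight {1..<i} p)) (- ap (hop (i, True) (i, False)) x)"
      using op_prod_K(2)[of "[1..<i]", OF _ _ s] i tensor_psi_star[OF x] by simp
    also have "weight_op q N (\<lambda>p. - K_weight {1..<i} p) = weight_op q N (\<lambda>p. - K_weight {..<i} p)"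
      by (rule D_cong) (auto simp: K_weight_def modes_def)
    also have "ap (weight_op q N (\<lambda>p. - K_weight {..<i} p)) (- ap (hop (i, True) (i, False)) x) =
       - ap (weight_op q N (\<lambda>p. - K_weight {..<i} p)) (ap (hop (i, True) (i, False)) x)"
      using ap_scale[of _ "-1"] by (simp add: cfun.scale_minus_left)
    finally show ?thesis by (simp add: qhop_def ap_simps)
  qed
  then have "F_op q N x = - (\<Sum>i=1..N. - ap (qhop (\<lambda>p. - K_weight {..<i} p) (i, True) (i, False)) x)"
    unfolding F_op_def by (intro arg_cong[of _ _ uminus] sum.cong) auto
  also have "\<dots> = ap F x"
    unfolding F_def ap_sum_left sum_negf by simp
  finally show ?thesis .
qed

end

context braiding_setting
begin

section \<open>The module axioms\<close>

lemma card_exchange: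
  assumes "i \<in> A" "j \<notin> A - {i}" "insert j (A - {i}) \<subseteq> {1..N}"
  shows "card A = card (insert j (A - {i}))"
proof -
  have "finite (A - {i})" using assms(3) by (meson finite_atLeastAtMost finite_subset subset_insertI subset_trans)
  then show ?thesis using assms(1,2)
    by (metis card_insert_disjoint finite_insert insert_Diff insert_iff Diff_iff)
qed

lemma sector_hop:
  assumes x: "x \<in> sector k k'" and i: "1 \<le> i" "i \<le> N" and j: "1 \<le> j" "j \<le> N"
  shows "ap (hop (i, s) (j, s)) x \<in> sector k k'"
proof -
  have "A \<subseteq> {1..N} \<and> B \<subseteq> {1..N} \<and> card A = k \<and> card B = k'"
    if nz: "ap (hop (i, s) (j, s)) x (A, B) \<noteq> 0" for A B
  proof (cases s)
    case True
    then have *: "i \<in> B" "j \<notin> B - {i}" "x (A, insert j (B - {i})) \<noteq> 0"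
      using nz ap_hop(2)[OF i j] by (auto simp: psi_eval psi_star_eval split: if_splits)
    note d = sectorD[OF x *(3)]
    have "B \<subseteq> {1..N}" using d i by auto
    then show ?thesis using card_exchange[OF *(1,2)] d by auto
  next
    case False
    then have *: "i \<in> A" "j \<notin> A - {i}" "x (insert j (A - {i}), B) \<noteq> 0"
      using nz ap_hop(1)[OF i j] by (auto simp: psi_eval psi_star_eval split: if_splits)
    note d = sectorD[OF x *(3)]
    have "A \<subseteq> {1..N}" using d i by auto
    then show ?thesis using card_exchange[OF *(1,2)] d by auto
  qed
  then show ?thesis unfolding sector_def by blast
qed

lemma sector_weight_op: "x \<in> sector k k' \<Longrightarrow> ap (weight_op q N w) x \<in> sector k k'"
  unfolding sector_def by (simp add: ap_weight_op)

lemma sector_qhop: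
  "x \<in> sector k k' \<Longrightarrow> 1 \<le> i \<Longrightarrow> i \<le> N \<Longrightarrow> 1 \<le> j \<Longrightarrow> j \<le> N \<Longrightarrow> ap (qhop w (i, s) (j, s)) x \<in> sector k k'"
  using sector_weight_op[OF sector_hop] by (simp add: qhop_def ap_simps)

lemma sector_scale: "x \<in> sector k k' \<Longrightarrow> c \<odot> x \<in> sector k k'"
  and sector_add: "x \<in> sector k k' \<Longrightarrow> y \<in> sector k k' \<Longrightarrow> x + y \<in> sector k k'"
  and sector_zero: "0 \<in> sector k k'"
  using cfun.subspace_scale[OF sector_subspace] cfun.subspace_add[OF sector_subspace]
    cfun.subspace_0[OF sector_subspace] by auto

lemma sector_e_comb: "x \<in> sector k k' \<Longrightarrow> c \<in> {1..N} \<Longrightarrow> d \<in> {1..N} \<Longrightarrow> ap (e_comb y z c d) x \<in> sector k k'"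
  by (simp add: e_comb_def e1_def e2_def ap_simps sector_qhop sector_scale sector_add)

lemma sector_f_comb: "x \<in> sector k k' \<Longrightarrow> c \<in> {1..N} \<Longrightarrow> d \<in> {1..N} \<Longrightarrow> ap (f_comb y z c d) x \<in> sector k k'"
  by (simp add: f_comb_def f1_def f2_def ap_simps sector_qhop sector_scale sector_add)

lemma sector_t_act: "x \<in> sector k k' \<Longrightarrow> ap (t_act \<nu>) x \<in> sector k k'"
  by (simp add: t_act_def sector_weight_op)

definition e_act :: "complex \<Rightarrow> complex \<Rightarrow> nat \<Rightarrow> endo"
  where "e_act z z' i = e_comb (spectral i z) (spectral i z') (cyc N i) (i + 1)"
definition f_act :: "complex \<Rightarrow> complex \<Rightarrow> nat \<Rightarrow> endo"
  where "f_act z z' i = f_comb (inverse (spectral i z)) (inverse (spectral i z')) (cyc N i) (i + 1)"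

lemma act_on_sector:
  assumes "x \<in> sector k k'"
  shows "i < N \<Longrightarrow> act_e (ext_tensor q N k z k' z') i x = ap (e_act z z' i) x"
    and "i < N \<Longrightarrow> act_f (ext_tensor q N k z k' z') i x = ap (f_act z z' i) x"
    and "act_t (ext_tensor q N k z k' z') \<nu> x = ap (t_act \<nu>) x"
  using act_e_tensor act_f_tensor act_t_tensor sector_on_sites[OF assms] by (simp_all add: e_act_def f_act_def)

lemma sector_ops:
  assumes "x \<in> sector k k'"
  shows "i < N \<Longrightarrow> ap (e_act z z' i) x \<in> sector k k'" and "i < N \<Longrightarrow> ap (f_act z z' i) x \<in> sector k k'"
  using sector_e_comb[OF assms] sector_f_comb[OF assms] cyc_range[of i] by (simp_all add: e_act_def f_act_def)

lemma funpow_ap: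
  assumes "\<And>u. u \<in> W \<Longrightarrow> g u = ap T u" "\<And>u. u \<in> W \<Longrightarrow> ap T u \<in> W" "u \<in> W"
  shows "(g ^^ r) u = ap (T ^ r) u \<and> ap (T ^ r) u \<in> W"
  by (induction r) (use assms in \<open>auto simp: ap_simps\<close>)

lemma sum_two_points:
  assumes "c \<in> {1..N}" "d \<in> {1..N}"
  shows "(\<Sum>l=1..N. f l * ((if l = c then 1 else 0) - (if l = d then 1 else 0))) = f c - (f d :: int)"
proof -
  have "(\<Sum>l=1..N. f l * ((if l = c then 1 else 0) - (if l = d then 1 else 0))) =
     (\<Sum>l=1..N. if l = c then f l else 0) - (\<Sum>l=1..N. if l = d then f l else 0)"
    unfolding sum_subtractf[symmetric] by (intro sum.cong) auto
  then show ?thesis using assms by (simp add: sum.delta)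
qed

lemma weight_inner_sroot: "i < N \<Longrightarrow> weight_inner N \<nu> (sroot N i) = \<nu> (cyc N i) - \<nu> (i + 1)"
  unfolding weight_inner_def sroot_eq using sum_two_points cyc_range by blast

lemma cyc_inj: "i < N \<Longrightarrow> j < N \<Longrightarrow> cyc N i = cyc N j \<longleftrightarrow> i = j"
  by (auto simp: cyc_def)

lemma cartan_eq:
  assumes "i < N" "j < N" "i \<noteq> j"
  shows "cartan N i j = - of_bool (cyc N i = j + 1) - of_bool (i + 1 = cyc N j)"
  using assms cyc_inj[OF assms(1,2)]
  unfolding cartan_def weight_inner_sroot[OF assms(2)] by (auto simp: sroot_eq)

text \<open>The three possible off-diagonal Cartan entries \<open>0\<close>, \<open>-1\<close>, \<open>-2\<close>, according to how many ends the two
  oriented edges of the cyclic Dynkin diagram share.\<close>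

lemma serre_ring:
  fixes x :: "nat \<Rightarrow> endo"
  assumes ij: "i < N" "j < N" "i \<noteq> j"
    and "cyc N i \<noteq> j + 1 \<Longrightarrow> i + 1 \<noteq> cyc N j \<Longrightarrow> x i * x j = x j * x i"
    and "cyc N i = j + 1 \<longleftrightarrow> i + 1 \<noteq> cyc N j \<Longrightarrow>
      x i * (x i * x j) - (q + 1 / q) \<bullet> (x i * (x j * x i)) + x j * (x i * x i) = 0"
    and "cyc N i = j + 1 \<Longrightarrow> i + 1 = cyc N j \<Longrightarrow>
      x i * (x i * x i) = 0 \<and> x i * (x i * (x j * x i)) = x i * (x j * (x i * x i))"
  shows "(\<Sum>r=0..nat (1 - cartan N i j). ((-1) ^ r * qbinom q (nat (1 - cartan N i j)) r) \<bullet>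
     (x i ^ (nat (1 - cartan N i j) - r) * (x j * x i ^ r))) = 0"
proof -
  have f: "qfact q 0 = 1" "qfact q (Suc 0) = 1" "qfact q 2 = qint 2" "qfact q 3 = qint 2 * qint 3"
    using qfact_Suc[of 1] qfact_Suc[of 2] by (simp_all add: qfact_def numeral_2_eq_2 numeral_3_eq_3 mult.commute qnum_qint)
  have qi2: "qint 2 = q + 1 / q"
    using qint_Suc[of 1] by (simp add: divide_inverse)
  have nz: "qint 2 \<noteq> 0" "qint 3 \<noteq> 0" by (simp_all add: qint_nz)
  consider (0) "cyc N i \<noteq> j + 1" "i + 1 \<noteq> cyc N j" | (1) "cyc N i = j + 1 \<longleftrightarrow> i + 1 \<noteq> cyc N j"
    | (2) "cyc N i = j + 1" "i + 1 = cyc N j" by blast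
  then show ?thesis
  proof cases
    case 0
    then have m: "nat (1 - cartan N i j) = 1" using cartan_eq[OF ij] by simp
    show ?thesis unfolding m using assms(4)[OF 0] by (simp add: qbinom_def f)
  next
    case 1
    then have m: "nat (1 - cartan N i j) = 2" using cartan_eq[OF ij] by auto
    have b: "qbinom q 2 0 = 1" "qbinom q 2 1 = q + 1 / q" "qbinom q 2 2 = 1"
      using nz by (simp_all add: qbinom_def f flip: qi2)
    have "(\<Sum>r=0..2. ((-1) ^ r * qbinom q 2 r) \<bullet> (x i ^ (2 - r) * (x j * x i ^ r))) =
        x i * (x i * x j) - (q + 1 / q) \<bullet> (x i * (x j * x i)) + x j * (x i * x i)"
      by (simp add: numeral_2_eq_2 sum.atLeast0_atMost_Suc b[unfolded numeral_2_eq_2 One_nat_def] mult.assoc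
          scl_add_left algebra_simps)
    then show ?thesis unfolding m using assms(5)[OF 1] by simp
  next
    case 2
    then have m: "nat (1 - cartan N i j) = 3" using cartan_eq[OF ij] by auto
    have b: "qbinom q 3 0 = 1" "qbinom q 3 1 = qint 3" "qbinom q 3 2 = qint 3" "qbinom q 3 3 = 1"
      using nz by (simp_all add: qbinom_def f)
    have "(\<Sum>r=0..3. ((-1) ^ r * qbinom q 3 r) \<bullet> (x i ^ (3 - r) * (x j * x i ^ r))) =
        (x i * (x i * x i)) * x j - qint 3 \<bullet> (x i * (x i * (x j * x i)))
        + qint 3 \<bullet> (x i * (x j * (x i * x i))) - x j * (x i * (x i * x i))"
      by (simp add: numeral_3_eq_3 numeral_2_eq_2 sum.atLeast0_atMost_Suc
          b[unfolded numeral_3_eq_3 numeral_2_eq_2 One_nat_def] mult.assoc)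
    then show ?thesis unfolding m using assms(6)[OF 2] by simp
  qed
qed

text \<open>Reduces the Serre relation on a subspace to an identity in the operator ring.\<close>

lemma serre_at_endo:
  assumes W: "u \<in> W" and ij: "i < N" "j < N"
    and x: "\<And>l u. l < N \<Longrightarrow> u \<in> W \<Longrightarrow> x l u = ap (T l) u" "\<And>l u. l < N \<Longrightarrow> u \<in> W \<Longrightarrow> ap (T l) u \<in> W"
    and rel: "(\<Sum>r=0..nat (1 - cartan N i j). ((-1) ^ r * qbinom q (nat (1 - cartan N i j)) r) \<bullet>
     (T i ^ (nat (1 - cartan N i j) - r) * (T j * T i ^ r))) = 0"
  shows "serre_at q N x i j u"
proof -
  have "(x i ^^ s) (x j ((x i ^^ r) u)) = ap (T i ^ s * (T j * T i ^ r)) u" for r s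
  proof -
    have pw: "(x i ^^ r) v = ap (T i ^ r) v \<and> ap (T i ^ r) v \<in> W" if "v \<in> W" for v r
      by (rule funpow_ap) (use x ij that in auto)
    have "x j ((x i ^^ r) u) = ap (T j * T i ^ r) u" "ap (T j * T i ^ r) u \<in> W"
      using pw[OF W, of r] x[OF ij(2)] by (simp_all add: ap_simps)
    then show ?thesis using pw[of "ap (T j * T i ^ r) u" s] by (simp add: ap_simps)
  qed
  then have "(\<Sum>r=0..nat (1 - cartan N i j). ((-1) ^ r * qbinom q (nat (1 - cartan N i j)) r) \<odot>
      (x i ^^ (nat (1 - cartan N i j) - r)) (x j ((x i ^^ r) u))) = ap 0 u"
    unfolding rel[symmetric] ap_sum_left by (simp add: scl.rep_eq)
  then show ?thesis by (simp only: serre_at_def Let_def zero_endo.rep_eq)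
qed

lemma t_act_add: "t_act \<nu> * t_act \<mu> = t_act (\<nu> + \<mu>)"
  unfolding t_act_def D_D by simp

lemma t_act_0: "t_act 0 = 1" unfolding t_act_def using D_0 by simp

lemma t_act_conj:
  assumes "t_act \<nu> * T = c \<bullet> (T * t_act \<nu>)"
  shows "t_act \<nu> * (T * t_act (- \<nu>)) = c \<bullet> T"
proof -
  have "t_act \<nu> * (T * t_act (- \<nu>)) = c \<bullet> (T * (t_act \<nu> * t_act (- \<nu>)))"
    using assms by (simp flip: mult.assoc)
  then show ?thesis by (simp add: t_act_add t_act_0)
qed

lemma module_ext_tensor:
  assumes z: "z \<noteq> 0" "z' \<noteq> 0"
  shows "is_uq_module q N (ext_tensor q N k z k' z')"
proof -
  let ?M = "ext_tensor q N k z k' z'" and ?W = "sector k k'"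
  note act = act_on_sector[where z = z and z' = z' and k = k and k' = k']
  have spectral: "spectral i z \<noteq> 0" "spectral i z' \<noteq> 0" for i using z by (auto simp: spectral_def)
  have lin: "linear_map_on ?W g" if "\<And>u. u \<in> ?W \<Longrightarrow> g u = ap T u" for g T
    using that by (simp add: linear_map_on_def sector_add sector_scale ap_add ap_scale)
  have e: "linear_map_on ?W (act_e ?M i) \<and> act_e ?M i ` ?W \<subseteq> ?W"
    and f: "linear_map_on ?W (act_f ?M i) \<and> act_f ?M i ` ?W \<subseteq> ?W" if "i < N" for i
    using that lin[OF act(1)] lin[OF act(2)] by (auto simp: act sector_ops)
  have t: "linear_map_on ?W (act_t ?M \<nu>) \<and> act_t ?M \<nu> ` ?W \<subseteq> ?W" for \<nu>
    using lin[OF act(3)] by (auto simp: act sector_t_act)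
  have te: "act_t ?M \<nu> (act_e ?M i (act_t ?M (- \<nu>) u)) = (q powi weight_inner N \<nu> (sroot N i)) \<odot> act_e ?M i u"
    and tf: "act_t ?M \<nu> (act_f ?M i (act_t ?M (- \<nu>) u)) = (q powi (- weight_inner N \<nu> (sroot N i))) \<odot> act_f ?M i u"
    if u: "u \<in> ?W" and i: "i < N" for u i \<nu>
  proof -
    have "t_act \<nu> * (e_act z z' i * t_act (- \<nu>)) = (q powi weight_inner N \<nu> (sroot N i)) \<bullet> e_act z z' i"
      unfolding weight_inner_sroot[OF i] e_act_def by (intro t_act_conj t_act_e_comb) (use cyc_range[OF i] in auto)
    from arg_cong[OF this, of "\<lambda>T. ap T u"]
    show "act_t ?M \<nu> (act_e ?M i (act_t ?M (- \<nu>) u)) = (q powi weight_inner N \<nu> (sroot N i)) \<odot> act_e ?M i u"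
      using u i by (simp add: act sector_t_act sector_ops ap_simps)
    have "t_act \<nu> * (f_act z z' i * t_act (- \<nu>)) = (q powi (\<nu> (i + 1) - \<nu> (cyc N i))) \<bullet> f_act z z' i"
      unfolding f_act_def by (intro t_act_conj t_act_f_comb) (use cyc_range[OF i] in auto)
    from arg_cong[OF this, of "\<lambda>T. ap T u"]
    show "act_t ?M \<nu> (act_f ?M i (act_t ?M (- \<nu>) u)) = (q powi (- weight_inner N \<nu> (sroot N i))) \<odot> act_f ?M i u"
      using u i by (simp add: weight_inner_sroot act sector_t_act sector_ops ap_simps)
  qed
  have ef: "act_e ?M i (act_f ?M j u) - act_f ?M j (act_e ?M i u) =
          (if i = j then (1 / (q - inverse q)) \<odot> (act_t ?M (sroot N i) u - act_t ?M (- sroot N i) u) else 0)"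
    if u: "u \<in> ?W" and i: "i < N" and j: "j < N" for u i j
  proof -
    have "e_act z z' i * f_act z z' j - f_act z z' j * e_act z z' i =
      (if i = j then (1 / (q - inverse q)) \<bullet> (t_act (sroot N i) - t_act (- sroot N i)) else 0)"
    proof (cases "i = j")
      case True
      have s: "sroot N j = (\<lambda>l. (if l = cyc N j then 1 else 0) - (if l = j + 1 then 1 else 0))"
        "- sroot N j = (\<lambda>l. - ((if l = cyc N j then 1 else 0) - (if l = j + 1 then 1 else 0)))"
        by (auto simp: sroot_eq)
      have "e_act z z' j * f_act z z' j - f_act z z' j * e_act z z' j =
          (1 / (q - inverse q)) \<bullet> (t_act (sroot N j) - t_act (- sroot N j))"
        unfolding e_act_def f_act_def s(2) unfolding s(1)
        by (rule e_comb_f_comb_same) (use cyc_range[OF j] spectral in auto)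
      then show ?thesis using True by simp
    next
      case False
      then show ?thesis using e_comb_f_comb_distinct cyc_range[OF i] cyc_range[OF j] cyc_inj[OF i j]
        by (simp add: e_act_def f_act_def)
    qed
    from arg_cong[OF this, of "\<lambda>T. ap T u"] show ?thesis
      using u i j by (simp add: act sector_ops ap_simps if_distrib[of "\<lambda>T. ap T u"])
  qed
  have serre: "serre_at q N (act_e ?M) i j u \<and> serre_at q N (act_f ?M) i j u"
    if u: "u \<in> ?W" and i: "i < N" and j: "j < N" and ij: "i \<noteq> j" for u i j
  proof
    have c: "cyc N i \<noteq> cyc N j" using cyc_inj[OF i j] ij by simp
    show "serre_at q N (act_e ?M) i j u"
    proof (rule serre_at_endo[OF u i j, of _ "e_act z z'"])
      show "(\<Sum>r=0..nat (1 - cartan N i j). ((-1) ^ r * qbinom q (nat (1 - cartan N i j)) r) \<bullet>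
         (e_act z z' i ^ (nat (1 - cartan N i j) - r) * (e_act z z' j * e_act z z' i ^ r))) = 0"
      proof (rule serre_ring[OF i j ij])
        show "cyc N i \<noteq> j + 1 \<Longrightarrow> i + 1 \<noteq> cyc N j \<Longrightarrow> e_act z z' i * e_act z z' j = e_act z z' j * e_act z z' i"
          unfolding e_act_def by (rule e_comb_commute) (use cyc_range[OF i] cyc_range[OF j] c ij in auto)
        show "cyc N i = j + 1 \<longleftrightarrow> i + 1 \<noteq> cyc N j \<Longrightarrow>
          e_act z z' i * (e_act z z' i * e_act z z' j) - (q + 1 / q) \<bullet> (e_act z z' i * (e_act z z' j * e_act z z' i))
          + e_act z z' j * (e_act z z' i * e_act z z' i) = 0"
          unfolding e_act_def by (rule e_comb_serre) (use cyc_range[OF i] cyc_range[OF j] c ij in auto)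
        show "cyc N i = j + 1 \<Longrightarrow> i + 1 = cyc N j \<Longrightarrow>
          e_act z z' i * (e_act z z' i * e_act z z' i) = 0 \<and>
          e_act z z' i * (e_act z z' i * (e_act z z' j * e_act z z' i)) = e_act z z' i * (e_act z z' j * (e_act z z' i * e_act z z' i))"
          unfolding e_act_def using e_comb_serre_double[of "cyc N i" "i + 1"] cyc_range[OF i] by metis
      qed
    qed (auto simp: act sector_ops)
    show "serre_at q N (act_f ?M) i j u"
    proof (rule serre_at_endo[OF u i j, of _ "f_act z z'"])
      show "(\<Sum>r=0..nat (1 - cartan N i j). ((-1) ^ r * qbinom q (nat (1 - cartan N i j)) r) \<bullet>
         (f_act z z' i ^ (nat (1 - cartan N i j) - r) * (f_act z z' j * f_act z z' i ^ r))) = 0"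
      proof (rule serre_ring[OF i j ij])
        show "cyc N i \<noteq> j + 1 \<Longrightarrow> i + 1 \<noteq> cyc N j \<Longrightarrow> f_act z z' i * f_act z z' j = f_act z z' j * f_act z z' i"
          unfolding f_act_def by (rule f_comb_commute) (use cyc_range[OF i] cyc_range[OF j] c ij in auto)
        show "cyc N i = j + 1 \<longleftrightarrow> i + 1 \<noteq> cyc N j \<Longrightarrow>
          f_act z z' i * (f_act z z' i * f_act z z' j) - (q + 1 / q) \<bullet> (f_act z z' i * (f_act z z' j * f_act z z' i))
          + f_act z z' j * (f_act z z' i * f_act z z' i) = 0"
          unfolding f_act_def by (rule f_comb_serre) (use cyc_range[OF i] cyc_range[OF j] c ij in auto)
        show "cyc N i = j + 1 \<Longrightarrow> i + 1 = cyc N j \<Longrightarrow>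
          f_act z z' i * (f_act z z' i * f_act z z' i) = 0 \<and>
          f_act z z' i * (f_act z z' i * (f_act z z' j * f_act z z' i)) = f_act z z' i * (f_act z z' j * (f_act z z' i * f_act z z' i))"
          unfolding f_act_def using f_comb_serre_double[of "cyc N i" "i + 1"] cyc_range[OF i] by metis
      qed
    qed (auto simp: act sector_ops)
  qed
  have t0: "act_t ?M 0 u = u" "act_t ?M \<nu> (act_t ?M \<mu> u) = act_t ?M (\<nu> + \<mu>) u" if "u \<in> ?W" for u \<nu> \<mu>
    using that t_act_0 by (simp_all add: act sector_t_act ap_simps flip: t_act_add)
  show ?thesis
    unfolding is_uq_module_def Let_def space_tensor
    by (intro conjI ballI allI impI)
      (simp_all only: sector_subspace e f t t0 te tf ef serre not_False_eq_True)
qed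

end

context braiding_setting
begin

interpretation sl2: quantum_sl2 q E F K Ki "Suc N" by (rule quantum_sl2)

section \<open>The braiding matrix as an element of the operator ring\<close>

lemma qhop_transfer_sector:
  assumes i: "1 \<le> i" "i \<le> N"
  shows "x \<in> sector (Suc k) k' \<Longrightarrow> ap (qhop w (i, True) (i, False)) x \<in> sector k (Suc k')"
    and "x \<in> sector k (Suc k') \<Longrightarrow> ap (qhop w (i, False) (i, True)) x \<in> sector (Suc k) k'"
    and "x \<in> sector 0 k' \<Longrightarrow> ap (qhop w (i, True) (i, False)) x = 0"
proof -
  have *: "i \<in> B \<and> i \<notin> A \<and> x (insert i A, B - {i}) \<noteq> 0"
    if "ap (qhop w (i, True) (i, False)) x (A, B) \<noteq> 0" for A B x
    using that by (auto simp: qhop_def hop_def ap_simps ap_weight_op ap_annihilate ap_create psi_eval psi_star_eval split: if_splits)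
  have **: "i \<in> A \<and> i \<notin> B \<and> x (A - {i}, insert i B) \<noteq> 0"
    if "ap (qhop w (i, False) (i, True)) x (A, B) \<noteq> 0" for A B x
    using that by (auto simp: qhop_def hop_def ap_simps ap_weight_op ap_annihilate ap_create psi_eval psi_star_eval split: if_splits)
  have cI: "card (insert i A) = Suc (card A)" if "insert i A \<subseteq> {1..N}" "i \<notin> A" for A
    using that finite_subset[of A "{1..N}"] by simp
  have cD: "card A = Suc (card (A - {i}))" if "A - {i} \<subseteq> {1..N}" "i \<in> A" for A
  proof -
    have "insert i (A - {i}) \<subseteq> {1..N}" using that(1) i by auto
    from cI[OF this] show ?thesis using that(2) by (simp add: insert_absorb)
  qed
  show "ap (qhop w (i, True) (i, False)) x \<in> sector k (Suc k')" if x: "x \<in> sector (Suc k) k'"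
  proof -
    have "A \<subseteq> {1..N} \<and> B \<subseteq> {1..N} \<and> card A = k \<and> card B = Suc k'"
      if "ap (qhop w (i, True) (i, False)) x (A, B) \<noteq> 0" for A B
    proof -
      have a: "i \<in> B" "i \<notin> A" "x (insert i A, B - {i}) \<noteq> 0" using *[OF that] by auto
      note d = sectorD[OF x a(3)]
      have "A \<subseteq> {1..N}" "B \<subseteq> {1..N}" using d i by auto
      then show ?thesis using d cI[of A] cD[of B] a(1,2) by simp
    qed
    then show ?thesis unfolding sector_def by blast
  qed
  show "ap (qhop w (i, False) (i, True)) x \<in> sector (Suc k) k'" if x: "x \<in> sector k (Suc k')"
  proof -
    have "A \<subseteq> {1..N} \<and> B \<subseteq> {1..N} \<and> card A = Suc k \<and> card B = k'"
      if "ap (qhop w (i, False) (i, True)) x (A, B) \<noteq> 0" for A B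
    proof -
      have a: "i \<in> A" "i \<notin> B" "x (A - {i}, insert i B) \<noteq> 0" using **[OF that] by auto
      note d = sectorD[OF x a(3)]
      have "A \<subseteq> {1..N}" "B \<subseteq> {1..N}" using d i by auto
      then show ?thesis using d cI[of B] cD[of A] a(1,2) by simp
    qed
    then show ?thesis unfolding sector_def by blast
  qed
  show "ap (qhop w (i, True) (i, False)) x = 0" if x: "x \<in> sector 0 k'"
  proof (rule ext, clarify, rule ccontr)
    fix A B assume "ap (qhop w (i, True) (i, False)) x (A, B) \<noteq> 0 (A, B)"
    then have "ap (qhop w (i, True) (i, False)) x (A, B) \<noteq> 0" by simp
    from *[OF this] have a: "x (insert i A, B - {i}) \<noteq> 0" by auto
    have "insert i A \<subseteq> {1..N}" "card (insert i A) = 0" using sectorD[OF x a] by auto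
    then show False using finite_subset[of "insert i A" "{1..N}"] by simp
  qed
qed

lemma sector_sum: "(\<And>i. i \<in> S \<Longrightarrow> f i \<in> sector k k') \<Longrightarrow> sum f S \<in> sector k k'"
  using cfun.subspace_sum[OF sector_subspace] by blast

lemma F_sector: "x \<in> sector (Suc k) k' \<Longrightarrow> ap F x \<in> sector k (Suc k')"
  and E_sector: "x \<in> sector k (Suc k') \<Longrightarrow> ap E x \<in> sector (Suc k) k'"
  and F_sector_0: "x \<in> sector 0 k' \<Longrightarrow> ap F x = 0"
  unfolding E_def F_def ap_sum_left
  by (auto intro!: sector_sum qhop_transfer_sector(1,2) sum.neutral simp: qhop_transfer_sector(3))

lemma F_power_sector: "x \<in> sector (k + l) k' \<Longrightarrow> ap (F ^ l) x \<in> sector k (k' + l)"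
proof (induction l arbitrary: k)
  case (Suc l)
  have "ap (F ^ l) x \<in> sector (Suc k) (k' + l)" using Suc.IH[of "Suc k"] Suc.prems by simp
  then show ?case using F_sector by (simp add: ap_simps)
qed (simp_all add: ap_simps)

lemma E_power_sector: "x \<in> sector k (k' + l) \<Longrightarrow> ap (E ^ l) x \<in> sector (k + l) k'"
proof (induction l arbitrary: k')
  case (Suc l)
  have "ap (E ^ l) x \<in> sector (k + l) (Suc k')" using Suc.IH[of "Suc k'"] Suc.prems by simp
  then show ?case using E_sector by (simp add: ap_simps)
qed (simp_all add: ap_simps)

lemma sector_large: assumes "x \<in> sector k k'" "k > N \<or> k' > N" shows "x = 0"
proof (rule ext, clarify, rule ccontr)
  fix A B assume "x (A, B) \<noteq> 0 (A, B)"
  then have "x (A, B) \<noteq> 0" by simp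
  note d = sectorD[OF assms(1) this]
  then have "card A \<le> N" "card B \<le> N" using card_mono[of "{1..N}"] by auto
  then show False using d assms(2) by auto
qed

lemma F_power_zero:
  assumes x: "x \<in> sector k k'" and l: "l > k \<or> k' + l > N"
  shows "ap (F ^ l) x = 0"
proof (cases "l > k")
  case True
  have "ap (F ^ k) x \<in> sector 0 (k' + k)" using F_power_sector[of x 0 k k'] x by simp
  then have "ap (F ^ Suc k) x = 0" using F_sector_0 by (simp add: ap_simps)
  moreover have "F ^ l = F ^ (l - Suc k) * F ^ Suc k" using True by (simp flip: power_add power_Suc)
  ultimately show ?thesis by (simp add: ap_simps)
next
  case False
  then have "ap (F ^ l) x \<in> sector (k - l) (k' + l)" using F_power_sector[of x "k - l" l k'] x by simp
  then show ?thesis using l False by (intro sector_large) auto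
qed

lemma dpow_F_zero:
  assumes "x \<in> sector k k'" "l > int k \<or> int k' + l > int N"
  shows "ap (dpow F l) x = 0"
proof (cases "l < 0")
  case True
  then show ?thesis by (simp add: ap_simps)
next
  case False
  then obtain n where "l = int n" by (metis nonneg_int_cases not_less)
  then show ?thesis using F_power_zero[OF assms(1), of n] assms(2) by (auto simp: dpow_def ap_simps)
qed

text \<open>For \<open>b = j + max m 0\<close> and \<open>a = j + max (- m) 0\<close> the exponent \<open>2 j + \<bar>m\<bar>\<close> is \<open>a + b\<close>, so that both signs of \<open>m\<close> are
  covered by one formula. Terms with \<open>j\<close> above the minimum in the statement vanish on the tensor product
  in question, and the sum is extended to an index at which everything has died.\<close>

definition A_endo :: "int \<Rightarrow> complex \<Rightarrow> endo" where
  "A_endo m z = (1 - q ^ nat \<bar>m\<bar> * z) \<bullet> (\<Sum>j\<le>Suc N. ((- q) ^ j / (1 - q ^ (2 * j + nat \<bar>m\<bar>) * z)) \<bullet>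
      (dpow E (int j + max (- m) 0) * dpow F (int j + max m 0)))"

lemma on_sites_F: "x \<in> on_sites \<Longrightarrow> ap F x \<in> on_sites" and on_sites_E: "x \<in> on_sites \<Longrightarrow> ap E x \<in> on_sites"
proof -
  have s: "sum f S \<in> on_sites" if "\<And>i. i \<in> S \<Longrightarrow> f i \<in> on_sites" for f and S :: "nat set"
  proof -
    have "A \<subseteq> {1..N} \<and> B \<subseteq> {1..N}" if nz: "sum f S (A, B) \<noteq> 0" for A B
    proof -
      obtain i where "i \<in> S" "f i (A, B) \<noteq> 0"
        using nz unfolding sum_fun_eval by (rule sum.not_neutral_contains_not_neutral)
      then show ?thesis using on_sitesD that \<open>\<And>i. i \<in> S \<Longrightarrow> f i \<in> on_sites\<close> by blast
    qed
    then show ?thesis unfolding on_sites_def by blast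
  qed
  show "x \<in> on_sites \<Longrightarrow> ap F x \<in> on_sites" "x \<in> on_sites \<Longrightarrow> ap E x \<in> on_sites"
    unfolding E_def F_def ap_sum_left
    by (auto intro!: s on_sites_weight_op on_sites_hop simp: qhop_def ap_simps)
qed

lemma div_pow_eval:
  assumes "x \<in> on_sites"
  shows "div_pow q (E_op q N) l x = ap (dpow E (int l)) x" "div_pow q (F_op q N) l x = ap (dpow F (int l)) x"
  using funpow_ap[of on_sites "E_op q N" E x l] funpow_ap[of on_sites "F_op q N" F x l] E_op_eval F_op_eval on_sites_E on_sites_F assms
  by (auto simp: div_pow_def dpow_def ap_simps)

lemma on_sites_power: "x \<in> on_sites \<Longrightarrow> ap (F ^ l) x \<in> on_sites"
  by (induction l) (auto simp: ap_simps on_sites_F)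

lemma on_sites_scale: "x \<in> on_sites \<Longrightarrow> c \<odot> x \<in> on_sites" by (auto simp: on_sites_def cscale_def)

lemma on_sites_dpow: "x \<in> on_sites \<Longrightarrow> ap (dpow F l) x \<in> on_sites"
proof (cases "l < 0")
  case True
  have "(0 :: ext2) \<in> on_sites" by (simp add: on_sites_def)
  then show ?thesis using True by (simp add: ap_simps)
next
  case False
  assume "x \<in> on_sites"
  from on_sites_scale[OF on_sites_power[OF this]] show ?thesis using False by (simp add: dpow_def ap_simps)
qed

lemma A_op_eval:
  assumes x: "x \<in> sector k k'" and k: "k \<le> N" "k' \<le> N"
  shows "A_op q N (Min {k, k', N - k, N - k'}) (int k - int k') z x = ap (A_endo (int k - int k') z) x"
proof -
  define n where "n = Min {k, k', N - k, N - k'}"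
  define m where "m = int k - int k'"
  define c where "c j = (- q) ^ j * ((1 - q ^ nat \<bar>m\<bar> * z) / (1 - q ^ (2 * j + nat \<bar>m\<bar>) * z))" for j
  define T where "T j = dpow E (int j + max (- m) 0) * dpow F (int j + max m 0)" for j
  have xs: "x \<in> on_sites" by (rule sector_on_sites[OF x])
  have nN: "n \<le> Suc N" using k unfolding n_def by (simp add: Min_le_iff)
  have z: "ap (T j) x = 0" if "j > n" for j
  proof -
    have "j > k \<or> j > k' \<or> j > N - k \<or> j > N - k'"
      using that unfolding n_def by (subst (asm) Min_less_iff) auto
    then have "int j + max m 0 > int k \<or> int k' + (int j + max m 0) > int N"
      using k unfolding m_def by linarith
    then show ?thesis using dpow_F_zero[OF x] by (simp add: T_def ap_simps)
  qed
  have t: "(if m \<ge> 0 then div_pow q (E_op q N) j (div_pow q (F_op q N) (j + nat m) x)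
       else div_pow q (E_op q N) (j + nat (- m)) (div_pow q (F_op q N) j x)) = ap (T j) x" for j
  proof (cases "m \<ge> 0")
    case True
    then have m: "max m 0 = m" "max (- m) 0 = 0" "int (j + nat m) = int j + m" by auto
    show ?thesis unfolding T_def m(1,2) times_endo.rep_eq
      using True m(3) by (simp only: if_True div_pow_eval(2)[OF xs] div_pow_eval(1)[OF on_sites_dpow[OF xs]] add_0_right)
  next
    case False
    then have m: "max m 0 = 0" "max (- m) 0 = - m" "int (j + nat (- m)) = int j + - m" by auto
    show ?thesis unfolding T_def m(1,2) times_endo.rep_eq
      using False m(3) by (simp only: if_False div_pow_eval(2)[OF xs] div_pow_eval(1)[OF on_sites_dpow[OF xs]] add_0_right)
  qed
  have "A_op q N n m z x = (\<Sum>j=0..n. ap (c j \<bullet> T j) x)"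
    unfolding A_op_def t c_def by (simp add: ap_simps)
  also have "\<dots> = (\<Sum>j\<le>Suc N. ap (c j \<bullet> T j) x)"
    by (rule sum.mono_neutral_left) (use nN z in \<open>auto simp: ap_simps\<close>)
  also have "\<dots> = ap (A_endo m z) x"
    unfolding ap_sum_left[symmetric] A_endo_def scl_sum scl_scl
    by (intro arg_cong2[of _ _ _ _ ap] sum.cong) (simp_all add: c_def T_def mult.commute)
  finally show ?thesis by (simp add: n_def m_def)
qed

lemma A_endo_sector:
  assumes x: "x \<in> sector k k'"
  shows "ap (A_endo (int k - int k') z) x \<in> sector k' k"
proof -
  have "ap (dpow E (int j + max (- (int k - int k')) 0) * dpow F (int j + max (int k - int k') 0)) x \<in> sector k' k" for j
  proof -
    define b where "b = nat (int j + max (int k - int k') 0)"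
    define a where "a = nat (int j + max (- (int k - int k')) 0)"
    have ab: "dpow E (int j + max (- (int k - int k')) 0) * dpow F (int j + max (int k - int k') 0) =
        (1 / qfact q a * (1 / qfact q b)) \<bullet> (E ^ a * F ^ b)"
    proof -
      have "dpow S l = (1 / qfact q (nat l)) \<bullet> S ^ nat l" if "l \<ge> 0" for S l
        using that by (simp add: dpow_def)
      then show ?thesis by (simp add: a_def b_def mult.commute)
    qed
    have "ap (E ^ a) (ap (F ^ b) x) \<in> sector k' k"
    proof (cases "b \<le> k")
      case True
      then have y: "ap (F ^ b) x \<in> sector (k - b) (k' + b)"
        using F_power_sector[of x "k - b" b k'] x by simp
      have "k' + b = k + a" "k - b + a = k'" using True unfolding a_def b_def by (auto simp: max_def split: if_splits)
      then show ?thesis using E_power_sector[of "ap (F ^ b) x" "k - b" k a] y by simp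
    next
      case False
      then show ?thesis using F_power_zero[OF x, of b] sector_zero by simp
    qed
    then show ?thesis unfolding ab by (simp add: ap_simps sector_scale)
  qed
  then show ?thesis unfolding A_endo_def by (simp add: scl.rep_eq ap_sum_left sector_scale sector_sum del: sum.atMost_Suc)
qed

section \<open>Equivariance\<close>

text \<open>This covers \<open>e\<^sub>i\<close> and \<open>f\<^sub>i\<close> for \<open>1 \<le> i < N\<close> and the \<open>t\<^sub>\<nu>\<close>: each summand commutes with them.\<close>

lemma commute_A_endo:
  assumes "E * T = T * E" "F * T = T * F"
  shows "A_endo m z * T = T * A_endo m z"
proof -
  have pw: "dpow S l * T = T * dpow S l" if "S * T = T * S" for S l
    using that by (auto simp: dpow_def power_commuting_commutes)
  have "dpow E a * dpow F b * T = T * (dpow E a * dpow F b)" for a b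
    using pw[OF assms(1), of a] pw[OF assms(2), of b] by (metis mult.assoc)
  then show ?thesis
    by (simp add: A_endo_def sum_distrib_left sum_distrib_right del: sum.atMost_Suc)
qed

lift_definition sector_proj :: "nat \<Rightarrow> nat \<Rightarrow> endo" is
  "\<lambda>k k' x (A, B). if A \<subseteq> {1..N} \<and> B \<subseteq> {1..N} \<and> card A = k \<and> card B = k' then x (A, B) else 0"
  by (auto simp: linear_map_on_def fun_eq_iff cscale_def)

lemma sector_proj_id: "x \<in> sector k k' \<Longrightarrow> ap (sector_proj k k') x = x"
  using sectorD[of x k k'] by (force simp: fun_eq_iff sector_proj.rep_eq)

lemma weight_sector_proj: "sl2.has_weight (sector_proj k k') (int k - int k')"
proof -
  have "energy N (K_weight UNIV) A B = int (card A) - int (card B)" if "A \<subseteq> {1..N}" "B \<subseteq> {1..N}" for A B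
    using that by (simp add: energy_def K_weight_def Int_absorb2)
  then have "K * sector_proj k k' = q powi (int k - int k') \<bullet> sector_proj k k'"
    by (intro endo_eqI) (auto simp: K_def ap_simps ap_weight_op sector_proj.rep_eq cscale_def)
  then show ?thesis by (simp add: sl2.has_weight_def)
qed

text \<open>No denominator of \<open>A_endo m z\<close> vanishes, for all \<open>\<bar>m\<bar> \<le> N\<close>.\<close>

definition regular :: "complex \<Rightarrow> bool" where
  "regular z \<longleftrightarrow> (\<forall>j \<le> 2 * Suc N + N. 1 - q ^ j * z \<noteq> 0)"

lemma A_endo_intertwines_pair:
  assumes adj: "twisted_adjoint q E F K Ki (Suc N) X Y V' U'" and k: "k \<le> N" "k' \<le> N" and z: "regular z"
    and x: "x \<in> sector k k'"
  shows "ap (A_endo (int k - int k') z) (ap (z \<bullet> X + Y) x) = ap (X + z \<bullet> Y) (ap (A_endo (int k - int k') z) x)"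
proof -
  interpret tw: twisted_adjoint q E F K Ki "Suc N" X Y V' U' by (rule adj)
  let ?m = "int k - int k'"
  let ?T = "\<Sum>j\<le>Suc N. ((- q) ^ j / (1 - q ^ (2 * j + nat \<bar>?m\<bar>) * z)) \<bullet>
      (dpow E (int j + max (- ?m) 0) * dpow F (int j + max ?m 0))"
  have "?T * ((z \<bullet> X + Y) * sector_proj k k') = (X + z \<bullet> Y) * (?T * sector_proj k k')"
    by (rule tw.braiding_sum_intertwines[OF weight_sector_proj]) (use z k in \<open>auto simp: regular_def\<close>)
  then have "A_endo ?m z * ((z \<bullet> X + Y) * sector_proj k k') = (X + z \<bullet> Y) * (A_endo ?m z * sector_proj k k')"
    unfolding A_endo_def by simp
  from arg_cong[OF this, of "\<lambda>T. ap T x"] show ?thesis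
    by (simp only: times_endo.rep_eq sector_proj_id[OF x])
qed

lemma E_t_act: "E * t_act \<nu> = t_act \<nu> * E" and F_t_act: "F * t_act \<nu> = t_act \<nu> * F"
  unfolding E_def F_def sum_distrib_left sum_distrib_right t_act_def
  by (intro sum.cong refl; subst D_qhop_comm; auto)+

lemma A_endo_equivariant:
  assumes k: "k \<le> N" "k' \<le> N" and z: "z1 \<noteq> 0" "z2 \<noteq> 0" "regular (z1 / z2)" and x: "x \<in> sector k k'"
  defines "T \<equiv> A_endo (int k - int k') (z1 / z2)"
  shows "i < N \<Longrightarrow> ap T (ap (e_act z1 z2 i) x) = ap (e_act z2 z1 i) (ap T x)"
    and "i < N \<Longrightarrow> ap T (ap (f_act z1 z2 i) x) = ap (f_act z2 z1 i) (ap T x)"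
    and "ap T (ap (t_act \<nu>) x) = ap (t_act \<nu>) (ap T x)"
proof -
  show "ap T (ap (t_act \<nu>) x) = ap (t_act \<nu>) (ap T x)"
    using commute_A_endo[OF E_t_act F_t_act] unfolding T_def by (metis times_endo.rep_eq)
  assume i: "i < N"
  show "ap T (ap (e_act z1 z2 i) x) = ap (e_act z2 z1 i) (ap T x)"
  proof (cases "i = 0")
    case True
    have "e_act z1 z2 i = z2 \<bullet> ((z1 / z2) \<bullet> e1 N 1 + e2 N 1)" "e_act z2 z1 i = z2 \<bullet> (e1 N 1 + (z1 / z2) \<bullet> e2 N 1)"
      using z True by (simp_all add: e_act_def e_comb_def spectral_def cyc_def scl_add)
    then show ?thesis
      using A_endo_intertwines_pair[OF adjoint_e0[OF N2] k z(3) x] unfolding T_def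
      by (simp add: scl.rep_eq ap_scale)
  next
    case False
    then have e: "e_act z1 z2 i = e1 i (Suc i) + e2 i (Suc i)" "e_act z2 z1 i = e1 i (Suc i) + e2 i (Suc i)"
      by (simp_all add: e_act_def e_comb_def spectral_def cyc_def)
    have "T * (e1 i (Suc i) + e2 i (Suc i)) = (e1 i (Suc i) + e2 i (Suc i)) * T"
      unfolding T_def by (rule commute_A_endo)
        (use commute_E[of i] commute_F[of i] False i in \<open>simp_all add: distrib_left distrib_right\<close>)
    then show ?thesis unfolding e by (metis times_endo.rep_eq)
  qed
  show "ap T (ap (f_act z1 z2 i) x) = ap (f_act z2 z1 i) (ap T x)"
  proof (cases "i = 0")
    case True
    have "f_act z1 z2 i = inverse z1 \<bullet> ((z1 / z2) \<bullet> f2 N 1 + f1 N 1)"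
      "f_act z2 z1 i = inverse z1 \<bullet> (f2 N 1 + (z1 / z2) \<bullet> f1 N 1)"
      using z True by (simp_all add: f_act_def f_comb_def spectral_def cyc_def scl_add add.commute field_simps)
    then show ?thesis
      using A_endo_intertwines_pair[OF adjoint_f0[OF N2] k z(3) x] unfolding T_def
      by (simp add: scl.rep_eq ap_scale)
  next
    case False
    then have f: "f_act z1 z2 i = f1 i (Suc i) + f2 i (Suc i)" "f_act z2 z1 i = f1 i (Suc i) + f2 i (Suc i)"
      by (simp_all add: f_act_def f_comb_def spectral_def cyc_def)
    have "T * (f1 i (Suc i) + f2 i (Suc i)) = (f1 i (Suc i) + f2 i (Suc i)) * T"
      unfolding T_def by (rule commute_A_endo)
        (use commute_f[of i] False i in \<open>simp_all add: distrib_left distrib_right\<close>)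
    then show ?thesis unfolding f by (metis times_endo.rep_eq)
  qed
qed

end

context braiding_setting
begin

interpretation sl2: quantum_sl2 q E F K Ki "Suc N" by (rule quantum_sl2)

section \<open>Normalisation\<close>

definition supported_below :: "nat \<Rightarrow> ext2 set" where
  "supported_below n = {x. \<forall>A B. x (A, B) \<noteq> 0 \<longrightarrow> A \<subseteq> {1..<n} \<and> B \<subseteq> {1..<n}}"

lemma supported_belowD: "x \<in> supported_below n \<Longrightarrow> x (A, B) \<noteq> 0 \<Longrightarrow> A \<subseteq> {1..<n} \<and> B \<subseteq> {1..<n}"
  unfolding supported_below_def by blast

lemma supported_below_annihilate: assumes "y \<in> supported_below n" "n \<le> i" shows "ap (annihilate N (i, s)) y = 0"
proof (rule ext, clarify, rule ccontr)
  fix A B assume "ap (annihilate N (i, s)) y (A, B) \<noteq> 0 (A, B)"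
  then have "y (insert i A, B) \<noteq> 0 \<or> y (A, insert i B) \<noteq> 0"
    by (cases s) (auto simp: ap_annihilate psi_eval split: if_splits)
  then show False using supported_belowD[OF assms(1)] assms(2) by force
qed

lemma supported_below_sum: "(\<And>i. i \<in> S \<Longrightarrow> f i \<in> supported_below n) \<Longrightarrow> sum f S \<in> supported_below n" for S :: "nat set"
proof -
  assume f: "\<And>i. i \<in> S \<Longrightarrow> f i \<in> supported_below n"
  have "A \<subseteq> {1..<n} \<and> B \<subseteq> {1..<n}" if nz: "sum f S (A, B) \<noteq> 0" for A B
  proof -
    obtain i where "i \<in> S" "f i (A, B) \<noteq> 0"
      using nz unfolding sum_fun_eval by (rule sum.not_neutral_contains_not_neutral)
    then show ?thesis using supported_belowD f by blast
  qed
  then show ?thesis unfolding supported_below_def by blast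
qed

lemma qhop_transfer_nonzero:
  "ap (qhop w (i, True) (i, False)) x (A, B) \<noteq> 0 \<Longrightarrow> i \<in> B \<and> i \<notin> A \<and> x (insert i A, B - {i}) \<noteq> 0"
  "ap (qhop w (i, False) (i, True)) x (A, B) \<noteq> 0 \<Longrightarrow> i \<in> A \<and> i \<notin> B \<and> x (A - {i}, insert i B) \<noteq> 0"
  by (auto simp: qhop_def hop_def ap_simps ap_weight_op ap_annihilate ap_create psi_eval psi_star_eval split: if_splits)

lemma supported_below_qhop:
  assumes "x \<in> supported_below n"
  shows "ap (qhop w (i, True) (i, False)) x \<in> supported_below n" and "ap (qhop w (i, False) (i, True)) x \<in> supported_below n"
proof -
  have "A \<subseteq> {1..<n} \<and> B \<subseteq> {1..<n}" if "ap (qhop w (i, True) (i, False)) x (A, B) \<noteq> 0" for A B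
    using supported_belowD[OF assms, of "insert i A" "B - {i}"] qhop_transfer_nonzero(1)[OF that] by auto
  then show "ap (qhop w (i, True) (i, False)) x \<in> supported_below n" unfolding supported_below_def by blast
  have "A \<subseteq> {1..<n} \<and> B \<subseteq> {1..<n}" if "ap (qhop w (i, False) (i, True)) x (A, B) \<noteq> 0" for A B
    using supported_belowD[OF assms, of "A - {i}" "insert i B"] qhop_transfer_nonzero(2)[OF that] by auto
  then show "ap (qhop w (i, False) (i, True)) x \<in> supported_below n" unfolding supported_below_def by blast
qed

lemma supported_below_E: "x \<in> supported_below n \<Longrightarrow> ap E x \<in> supported_below n" and supported_below_F: "x \<in> supported_below n \<Longrightarrow> ap F x \<in> supported_below n"
  unfolding E_def F_def ap_sum_left by (auto intro!: supported_below_sum supported_below_qhop)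

lemma supported_below_scale: assumes "x \<in> supported_below n" shows "c \<odot> x \<in> supported_below n"
proof -
  have "x (A, B) \<noteq> 0" if "(c \<odot> x) (A, B) \<noteq> 0" for A B using that by (simp add: cscale_def)
  then show ?thesis using assms unfolding supported_below_def by blast
qed

lemma supported_below_dpow:
  assumes "x \<in> supported_below n"
  shows "ap (dpow E l) x \<in> supported_below n" and "ap (dpow F l) x \<in> supported_below n"
proof -
  have z: "(0 :: ext2) \<in> supported_below n" by (simp add: supported_below_def)
  have "ap (E ^ j) x \<in> supported_below n" "ap (F ^ j) x \<in> supported_below n" for j
    by (induction j) (auto simp: ap_simps assms supported_below_E supported_below_F)
  then show "ap (dpow E l) x \<in> supported_below n" "ap (dpow F l) x \<in> supported_below n"
    by (cases "l < 0"; simp add: dpow_def ap_simps supported_below_scale z)+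
qed

lemma supported_below_weight_op:
  assumes "x \<in> supported_below n" "\<And>i s. i < n \<Longrightarrow> w (i, s) = w' (i, s)"
  shows "ap (weight_op q N w) x = ap (weight_op q N w') x"
proof (rule ext, clarify)
  fix A B
  show "ap (weight_op q N w) x (A, B) = ap (weight_op q N w') x (A, B)"
  proof (cases "x (A, B) = 0")
    case False
    then have "A \<subseteq> {1..<n}" "B \<subseteq> {1..<n}" using supported_belowD[OF assms(1)] by auto
    then have "energy N w A B = energy N w' A B"
      unfolding energy_def using assms(2) by (intro arg_cong2[of _ _ _ _ "(+)"] sum.cong) auto
    then show ?thesis by (simp add: ap_weight_op)
  qed (simp add: ap_weight_op)
qed

lemma qhop_Cr:
  assumes i: "1 \<le> i" "i \<le> N" and n: "1 \<le> n" "n \<le> N" "i \<noteq> n"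
  shows "qhop w (i, s) (i, t) * create N (n, u) = q powi w (n, u) \<bullet> (create N (n, u) * qhop w (i, s) (i, t))"
proof -
  have "hop (i, s) (i, t) * create N (n, u) = create N (i, s) * (annihilate N (i, t) * create N (n, u))"
    by (simp add: hop_def mult.assoc)
  also have "\<dots> = - (create N (i, s) * create N (n, u) * annihilate N (i, t))"
    using An_Cr[of "(i, t)" "(n, u)"] i n by (simp add: mult.assoc)
  also have "\<dots> = create N (n, u) * hop (i, s) (i, t)"
    using Cr_Cr[of "(i, s)" "(n, u)"] i n by (simp add: hop_def mult.assoc)
  finally have "qhop w (i, s) (i, t) * create N (n, u) = (weight_op q N w * create N (n, u)) * hop (i, s) (i, t)"
    by (simp add: qhop_def mult.assoc)
  then show ?thesis using D_Cr[of "(n, u)" w] n by (simp add: qhop_def mult.assoc)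
qed

lemma qhop_Cr_same:
  assumes n: "1 \<le> n" "n \<le> N" and y: "y \<in> supported_below n"
  shows "s \<noteq> t \<Longrightarrow> w (n, s) = 0 \<Longrightarrow>
      ap (qhop w (n, s) (n, t)) (ap (create N (n, t)) y) = ap (create N (n, s)) (ap (weight_op q N w) y)"
    and "s \<noteq> t \<Longrightarrow> ap (qhop w (n, s) (n, t)) (ap (create N (n, s)) y) = 0"
proof -
  assume st: "s \<noteq> t"
  have z: "ap (annihilate N (n, u)) y = 0" for u by (rule supported_below_annihilate[OF y]) simp
  have "annihilate N (n, t) * create N (n, s) = - (create N (n, s) * annihilate N (n, t))"
    using An_Cr[of "(n, t)" "(n, s)"] st n by simp
  then have "ap (annihilate N (n, t)) (ap (create N (n, s)) y) = 0"
    using z by (metis times_endo.rep_eq uminus_endo.rep_eq ap_0 neg_equal_0_iff_equal)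
  then show "ap (qhop w (n, s) (n, t)) (ap (create N (n, s)) y) = 0"
    by (simp add: qhop_def hop_def ap_simps)
  assume w: "w (n, s) = 0"
  have "annihilate N (n, t) * create N (n, t) = 1 - create N (n, t) * annihilate N (n, t)"
    using An_Cr[of "(n, t)" "(n, t)"] n by simp
  from arg_cong[OF this, of "\<lambda>T. ap T y"] have "ap (annihilate N (n, t)) (ap (create N (n, t)) y) = y"
    using z by (simp add: ap_simps)
  then have "ap (qhop w (n, s) (n, t)) (ap (create N (n, t)) y) = ap (weight_op q N w * create N (n, s)) y"
    by (simp add: qhop_def hop_def ap_simps)
  also have "weight_op q N w * create N (n, s) = create N (n, s) * weight_op q N w"
    using D_Cr[of "(n, s)" w] n w by simp
  finally show "ap (qhop w (n, s) (n, t)) (ap (create N (n, t)) y) = ap (create N (n, s)) (ap (weight_op q N w) y)"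
    by (simp add: ap_simps)
qed

lemma qhop_supported_below_zero: "y \<in> supported_below n \<Longrightarrow> n \<le> i \<Longrightarrow> ap (qhop w (i, s) (i, t)) y = 0"
  using supported_below_annihilate[of y n i t] by (simp add: qhop_def hop_def ap_simps)

text \<open>Splits off the last site \<open>n\<close> in a sum over all sites: the sites before \<open>n\<close> see the new particle only
  through the weight \<open>c\<close>, and the sites after \<open>n\<close> are empty.\<close>

lemma peel_sum:
  assumes n: "1 \<le> n" "n \<le> N" and y: "y \<in> supported_below n"
    and w: "\<And>i. i < n \<Longrightarrow> w i (n, u) = c"
    and same: "ap (qhop (w n) (n, s) (n, t)) (ap (create N (n, u)) y) = r"
  shows "ap (\<Sum>i=1..N. qhop (w i) (i, s) (i, t)) (ap (create N (n, u)) y) =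
    q powi c \<odot> ap (create N (n, u)) (ap (\<Sum>i=1..N. qhop (w i) (i, s) (i, t)) y) + r"
proof -
  have "ap (qhop (w i) (i, s) (i, t)) (ap (create N (n, u)) y) =
      q powi c \<odot> ap (create N (n, u)) (ap (qhop (w i) (i, s) (i, t)) y) + (if i = n then r else 0)"
    if i: "i \<in> {1..N}" for i
  proof (cases "i = n")
    case True
    then show ?thesis using same qhop_supported_below_zero[OF y, of n] by simp
  next
    case False
    then have "ap (qhop (w i) (i, s) (i, t)) (ap (create N (n, u)) y) =
        q powi w i (n, u) \<odot> ap (create N (n, u)) (ap (qhop (w i) (i, s) (i, t)) y)"
      using qhop_Cr[of i n "w i" s t u] i n by (metis atLeastAtMost_iff scl.rep_eq times_endo.rep_eq)
    then show ?thesis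
      using False w[of i] qhop_supported_below_zero[OF y, of i] by (cases "i < n") simp_all
  qed
  then have "ap (\<Sum>i=1..N. qhop (w i) (i, s) (i, t)) (ap (create N (n, u)) y) =
      (\<Sum>i=1..N. q powi c \<odot> ap (create N (n, u)) (ap (qhop (w i) (i, s) (i, t)) y) + (if i = n then r else 0))"
    unfolding ap_sum_left by (intro sum.cong) auto
  also have "\<dots> = q powi c \<odot> ap (create N (n, u)) (ap (\<Sum>i=1..N. qhop (w i) (i, s) (i, t)) y) + r"
    using n by (simp add: sum.distrib ap_sum_left ap_sum cfun.scale_sum_right)
  finally show ?thesis .
qed

text \<open>The coproduct of \<open>E\<close> and \<open>F\<close> for the decomposition into the sites below \<open>n\<close> and the site \<open>n\<close>, on states where
  \<open>n\<close> is occupied in one of the two factors.\<close>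

lemma peel:
  assumes n: "1 \<le> n" "n \<le> N" and y: "y \<in> supported_below n"
  shows "ap F (ap (create N (n, False)) y) = ap (create N (n, False)) (ap F y) + ap (create N (n, True)) (ap Ki y)"
    and "ap F (ap (create N (n, True)) y) = ap (create N (n, True)) (ap F y)"
    and "ap E (ap (create N (n, True)) y) = (1 / q) \<odot> ap (create N (n, True)) (ap E y) + ap (create N (n, False)) y"
    and "ap E (ap (create N (n, False)) y) = q \<odot> ap (create N (n, False)) (ap E y)"
proof -
  have 1: "ap (weight_op q N (\<lambda>p. - K_weight {..<n} p)) y = ap Ki y"
    unfolding Ki_def by (rule supported_below_weight_op[OF y]) (simp add: K_weight_def)
  have 2: "ap (weight_op q N (K_weight {n<..})) y = y"
    using supported_below_weight_op[OF y, of "K_weight {n<..}" "\<lambda>_. 0"] by (simp add: K_weight_def D_0 ap_simps)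
  show "ap F (ap (create N (n, False)) y) = ap (create N (n, False)) (ap F y) + ap (create N (n, True)) (ap Ki y)"
    unfolding F_def
    by (subst peel_sum[OF n y, where c = 0 and r = "ap (create N (n, True)) (ap Ki y)"])
      (simp_all add: K_weight_def qhop_Cr_same(1)[OF n y] flip: 1)
  show "ap F (ap (create N (n, True)) y) = ap (create N (n, True)) (ap F y)"
    unfolding F_def
    by (subst peel_sum[OF n y, where c = 0 and r = 0])
      (simp_all add: K_weight_def qhop_Cr_same(2)[OF n y])
  show "ap E (ap (create N (n, True)) y) = (1 / q) \<odot> ap (create N (n, True)) (ap E y) + ap (create N (n, False)) y"
    unfolding E_def
    by (subst peel_sum[OF n y, where c = "-1" and r = "ap (create N (n, False)) y"])
      (simp_all add: K_weight_def[of "{_<..}" "(n, True)"] K_weight_def[of "{n<..}" "(n, False)"]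
        qhop_Cr_same(1)[OF n y] 2 power_int_minus divide_inverse)
  show "ap E (ap (create N (n, False)) y) = q \<odot> ap (create N (n, False)) (ap E y)"
    unfolding E_def
    by (subst peel_sum[OF n y, where c = 1 and r = 0])
      (simp_all add: K_weight_def qhop_Cr_same(2)[OF n y])
qed

lemma ap_zero: "ap 0 u = 0" and ap_one: "ap 1 u = u"
  by (simp_all only: zero_endo.rep_eq one_endo.rep_eq)

lemma cscale_cancel: "c \<noteq> 0 \<Longrightarrow> c \<odot> x = c \<odot> y \<Longrightarrow> x = y" for x y :: ext2
  by (metis cfun.scale_scale cfun.scale_one left_inverse)

lemma dpow_step: "ap T (ap (dpow T l) x) = qint (l + 1) \<odot> ap (dpow T (l + 1)) x"
  using dpow_left[of T l] by (metis times_endo.rep_eq scl.rep_eq)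

lemma Ki_dpowF:
  assumes "y \<in> sector k k'"
  shows "ap Ki (ap (dpow F l) y) = q powi (2 * l - (int k - int k')) \<odot> ap (dpow F l) y"
proof -
  have "Ki * (dpow F l * sector_proj k k') = q powi (- (int k - int k' - 2 * l)) \<bullet> (dpow F l * sector_proj k k')"
    by (rule sl2.weight_Ki[OF sl2.weight_dpowF[OF weight_sector_proj]])
  from arg_cong[OF this, of "\<lambda>T. ap T y"] show ?thesis
    by (simp add: ap_simps sector_proj_id[OF assms])
qed

lemma peel_dpowF:
  assumes n: "1 \<le> n" "n \<le> N" and y: "y \<in> supported_below n" "y \<in> sector k k'"
  shows "ap (dpow F l) (ap (create N (n, False)) y) = ap (create N (n, False)) (ap (dpow F l) y)
    + q powi (l - 1 - (int k - int k')) \<odot> ap (create N (n, True)) (ap (dpow F (l - 1)) y)"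
proof (induction l rule: int_step_induct)
  case (3 l)
  let ?m = "int k - int k'"
  let ?lhs = "ap (dpow F (l + 1)) (ap (create N (n, False)) y)"
  let ?rhs = "ap (create N (n, False)) (ap (dpow F (l + 1)) y)
      + q powi (l - ?m) \<odot> ap (create N (n, True)) (ap (dpow F l) y)"
  have pos: "l + 1 \<noteq> 0" using 3(1) by simp
  have c: "q powi (2 * l - ?m) + q powi (l - 1 - ?m) * qint l = qint (l + 1) * q powi (l - ?m)"
  proof -
    have "q powi (2 * l - ?m) = q powi l * q powi (l - ?m)"
      "q powi (l - 1 - ?m) = inverse q * q powi (l - ?m)"
      by (simp_all add: power_int_diff power_int_minus divide_inverse flip: power_int_add mult.assoc)
    then show ?thesis by (simp only: qint_Suc[of l] distrib_right distrib_left mult_ac)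
  qed
  have "qint (l + 1) \<odot> ap (dpow F (l + 1)) (ap (create N (n, False)) y) = ap F (ap (dpow F l) (ap (create N (n, False)) y))"
    by (simp only: dpow_step)
  also have "\<dots> = ap F (ap (create N (n, False)) (ap (dpow F l) y))
      + q powi (l - 1 - ?m) \<odot> ap F (ap (create N (n, True)) (ap (dpow F (l - 1)) y))"
    unfolding 3(2) by (simp only: ap_add ap_scale)
  also have "\<dots> = ap (create N (n, False)) (ap F (ap (dpow F l) y)) + ap (create N (n, True)) (ap Ki (ap (dpow F l) y))
      + q powi (l - 1 - ?m) \<odot> ap (create N (n, True)) (ap F (ap (dpow F (l - 1)) y))"
    using peel(1)[OF n supported_below_dpow(2)[OF y(1)]] peel(2)[OF n supported_below_dpow(2)[OF y(1)]] by simp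
  also have "\<dots> = qint (l + 1) \<odot> ap (create N (n, False)) (ap (dpow F (l + 1)) y)
      + (q powi (2 * l - ?m) + q powi (l - 1 - ?m) * qint l) \<odot> ap (create N (n, True)) (ap (dpow F l) y)"
    unfolding dpow_step Ki_dpowF[OF y(2)]
    by (simp add: ap_scale cfun.scale_left_distrib algebra_simps)
  also have "\<dots> = qint (l + 1) \<odot> (ap (create N (n, False)) (ap (dpow F (l + 1)) y)
      + q powi (l - ?m) \<odot> ap (create N (n, True)) (ap (dpow F l) y))"
    unfolding c by (simp add: cfun.scale_right_distrib)
  finally have "qint (l + 1) \<odot> ?lhs = qint (l + 1) \<odot> ?rhs" .
  then have "?lhs = ?rhs" by (rule cscale_cancel[OF qint_nz[OF pos]])
  then show ?case by (simp only: add_diff_cancel_right')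
qed (simp_all only: dpow_neg dpow_0 ap_zero ap_one ap_0 cfun.scale_zero_right cfun.scale_one add_0 add_0_right
      diff_0 minus_zero power_int_0_right diff_less_eq simp_thms less_add_same_cancel2 zero_less_one neg_less_0_iff_less less_trans[OF _ zero_less_one])

lemma peel_dpowE:
  assumes n: "1 \<le> n" "n \<le> N" and y: "y \<in> supported_below n"
  shows "ap (dpow E l) (ap (create N (n, True)) y) = q powi (- l) \<odot> ap (create N (n, True)) (ap (dpow E l) y)
    + ap (create N (n, False)) (ap (dpow E (l - 1)) y)"
proof (induction l rule: int_step_induct)
  case (3 l)
  let ?lhs = "ap (dpow E (l + 1)) (ap (create N (n, True)) y)"
  let ?rhs = "q powi (- (l + 1)) \<odot> ap (create N (n, True)) (ap (dpow E (l + 1)) y)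
      + ap (create N (n, False)) (ap (dpow E l) y)"
  have pos: "l + 1 \<noteq> 0" using 3(1) by simp
  have "qint (l + 1) \<odot> ap (dpow E (l + 1)) (ap (create N (n, True)) y) = ap E (ap (dpow E l) (ap (create N (n, True)) y))"
    by (simp only: dpow_step)
  also have "\<dots> = q powi (- l) \<odot> ap E (ap (create N (n, True)) (ap (dpow E l) y))
      + ap E (ap (create N (n, False)) (ap (dpow E (l - 1)) y))"
    unfolding 3(2) by (simp only: ap_add ap_scale)
  also have "\<dots> = q powi (- l) \<odot> ((1 / q) \<odot> ap (create N (n, True)) (ap E (ap (dpow E l) y)) + ap (create N (n, False)) (ap (dpow E l) y))
      + q \<odot> ap (create N (n, False)) (ap E (ap (dpow E (l - 1)) y))"
    using peel(3)[OF n supported_below_dpow(1)[OF y]] peel(4)[OF n supported_below_dpow(1)[OF y]] by simp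
  also have "\<dots> = (q powi (- l) * (1 / q) * qint (l + 1)) \<odot> ap (create N (n, True)) (ap (dpow E (l + 1)) y)
      + (q powi (- l) + q * qint l) \<odot> ap (create N (n, False)) (ap (dpow E l) y)"
    unfolding dpow_step
    by (simp add: ap_scale cfun.scale_left_distrib cfun.scale_right_distrib algebra_simps)
  also have "\<dots> = qint (l + 1) \<odot> (q powi (- (l + 1)) \<odot> ap (create N (n, True)) (ap (dpow E (l + 1)) y)
      + ap (create N (n, False)) (ap (dpow E l) y))"
  proof -
    have "q powi (- (l + 1)) = q powi (- l) * (1 / q)"
      by (simp only: power_int_minus power_int_add_1[of q] q_nz inverse_mult_distrib divide_inverse mult_1_left simp_thms)
    then show ?thesis unfolding qint_Suc'[symmetric] by (simp add: cfun.scale_right_distrib mult_ac)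
  qed
  finally have "qint (l + 1) \<odot> ?lhs = qint (l + 1) \<odot> ?rhs" .
  then have "?lhs = ?rhs" by (rule cscale_cancel[OF qint_nz[OF pos]])
  then show ?case by (simp only: add_diff_cancel_right')
qed (simp_all only: dpow_neg dpow_0 ap_zero ap_one ap_0 cfun.scale_zero_right cfun.scale_one add_0 add_0_right
      diff_0 minus_zero power_int_0_right diff_less_eq simp_thms less_add_same_cancel2 zero_less_one neg_less_0_iff_less less_trans[OF _ zero_less_one])

definition pair_vec :: "nat set \<Rightarrow> nat set \<Rightarrow> ext2" where "pair_vec I J = basis_vec (I, J)"

lemma pair_vec_supported_below: "I \<subseteq> {1..<n} \<Longrightarrow> J \<subseteq> {1..<n} \<Longrightarrow> pair_vec I J \<in> supported_below n"
  by (auto simp: pair_vec_def basis_vec_def supported_below_def split: if_splits)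

lemma pair_vec_sector: "I \<subseteq> {1..N} \<Longrightarrow> J \<subseteq> {1..N} \<Longrightarrow> card I = k \<Longrightarrow> card J = k' \<Longrightarrow> pair_vec I J \<in> sector k k'"
  by (auto simp: pair_vec_def basis_vec_def sector_def split: if_splits)

lemma wsign_interval: "wsign (Suc n) {1..Suc n} = (-1) ^ n"
proof -
  have "{a \<in> {1..Suc n}. a < Suc n} = {1..n}" by auto
  then show ?thesis by (simp add: wsign_def)
qed

lemma psi_star_indicator:
  assumes "\<And>I. u I = (if I = {1..n} then c else 0)"
  shows "psi_star (Suc n) u A = (if A = {1..Suc n} then (-1) ^ n * c else 0)"
proof (cases "A = {1..Suc n}")
  case True
  have "{1..Suc n} - {Suc n} = {1..n}" "Suc n \<in> {1..Suc n}" by auto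
  then show ?thesis unfolding True psi_star_eval assms wsign_interval by (simp only: simp_thms if_True)
next
  case False
  then have "Suc n \<in> A \<Longrightarrow> A - {Suc n} \<noteq> {1..n}" by (auto simp: atLeastAtMostSuc_conv)
  then show ?thesis using False unfolding psi_star_eval assms by simp
qed

lemma create_pair_vec:
  assumes "Suc n \<le> N"
  shows "ap (create N (Suc n, False)) (pair_vec {1..n} J) = (-1) ^ n \<odot> pair_vec {1..Suc n} J"
    and "I \<subseteq> {1..N} \<Longrightarrow> ap (create N (Suc n, True)) (pair_vec I {1..n}) = (-1) ^ (card I + n) \<odot> pair_vec I {1..Suc n}"
proof -
  show "ap (create N (Suc n, False)) (pair_vec {1..n} J) = (-1) ^ n \<odot> pair_vec {1..Suc n} J"
  proof (rule ext, clarify)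
    fix A B
    have "psi_star (Suc n) (\<lambda>I. pair_vec {1..n} J (I, B)) A =
        (if A = {1..Suc n} then (-1) ^ n * (if B = J then 1 else 0) else 0)"
      by (rule psi_star_indicator) (simp add: pair_vec_def basis_vec_def)
    then show "ap (create N (Suc n, False)) (pair_vec {1..n} J) (A, B) = ((-1) ^ n \<odot> pair_vec {1..Suc n} J) (A, B)"
      unfolding ap_create by (simp add: pair_vec_def basis_vec_def cscale_def)
  qed
  assume I: "I \<subseteq> {1..N}"
  show "ap (create N (Suc n, True)) (pair_vec I {1..n}) = (-1) ^ (card I + n) \<odot> pair_vec I {1..Suc n}"
  proof (rule ext, clarify)
    fix A B
    have "psi_star (Suc n) (\<lambda>J. pair_vec I {1..n} (A, J)) B =
        (if B = {1..Suc n} then (-1) ^ n * (if A = I then 1 else 0) else 0)"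
      by (rule psi_star_indicator) (simp add: pair_vec_def basis_vec_def)
    then show "ap (create N (Suc n, True)) (pair_vec I {1..n}) (A, B) = ((-1) ^ (card I + n) \<odot> pair_vec I {1..Suc n}) (A, B)"
      using I unfolding ap_create by (simp add: pair_vec_def basis_vec_def cscale_def parity_sign_def Int_absorb2 power_add)
  qed
qed

lemma F_pair_vec_zero: assumes "I \<subseteq> J" shows "ap F (pair_vec I J) = 0"
proof -
  have "ap (qhop w (i, True) (i, False)) (pair_vec I J) = 0" for i w
  proof (rule ext, clarify, rule ccontr)
    fix A B assume "ap (qhop w (i, True) (i, False)) (pair_vec I J) (A, B) \<noteq> 0 (A, B)"
    then have "pair_vec I J (insert i A, B - {i}) \<noteq> 0" using qhop_transfer_nonzero(1)[of w i "pair_vec I J" A B] by simp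
    then have "insert i A = I" "B - {i} = J" by (auto simp: pair_vec_def basis_vec_def split: if_splits)
    then show False using assms by auto
  qed
  then show ?thesis by (simp add: F_def ap_sum_left)
qed

lemma E_pair_vec_zero: assumes "J \<subseteq> I" shows "ap E (pair_vec I J) = 0"
proof -
  have "ap (qhop w (i, False) (i, True)) (pair_vec I J) = 0" for i w
  proof (rule ext, clarify, rule ccontr)
    fix A B assume "ap (qhop w (i, False) (i, True)) (pair_vec I J) (A, B) \<noteq> 0 (A, B)"
    then have "pair_vec I J (A - {i}, insert i B) \<noteq> 0" using qhop_transfer_nonzero(2)[of w i "pair_vec I J" A B] by simp
    then have "A - {i} = I" "insert i B = J" by (auto simp: pair_vec_def basis_vec_def split: if_splits)
    then show False using assms by auto
  qed
  then show ?thesis by (simp add: E_def ap_sum_left)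
qed

lemma dpow_zero: assumes "ap T x = 0" "l > 0" shows "ap (dpow T l) x = 0"
proof -
  obtain n where "nat l = Suc n" using assms(2) by (cases "nat l") auto
  then have "dpow T l = (1 / qfact q (nat l)) \<bullet> (T ^ n * T)" using assms(2) by (simp add: dpow_def power_Suc2 del: power_Suc)
  then show ?thesis using assms(1) by (simp add: ap_simps)
qed

text \<open>The divided power transports the \<open>j\<close> particles beyond \<open>p\<close> one by one, from the last site inwards. The
  sites up to \<open>p\<close>, being occupied in both factors, only contribute to the sign.\<close>

lemma dpow_pair_vec:
  "p + j \<le> N \<Longrightarrow> ap (dpow F (int j)) (pair_vec {1..p + j} {1..p}) = (-1) ^ (p * j) \<odot> pair_vec {1..p} {1..p + j}
     \<and> (\<forall>l > int j. ap (dpow F l) (pair_vec {1..p + j} {1..p}) = 0)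
     \<and> ap (dpow E (int j)) (pair_vec {1..p} {1..p + j}) = (-1) ^ (p * j) \<odot> pair_vec {1..p + j} {1..p}
     \<and> (\<forall>l > int j. ap (dpow E l) (pair_vec {1..p} {1..p + j}) = 0)"
proof (induction j)
  case 0
  show ?case by (auto simp: ap_simps dpow_zero F_pair_vec_zero E_pair_vec_zero)
next
  case (Suc j)
  let ?s = "pair_vec {1..p + j} {1..p}" and ?r = "pair_vec {1..p} {1..p + j}" and ?n = "Suc (p + j)"
  let ?s' = "pair_vec {1..p + Suc j} {1..p}" and ?r' = "pair_vec {1..p} {1..p + Suc j}"
  have n: "1 \<le> ?n" "?n \<le> N" using Suc.prems by auto
  have IH: "ap (dpow F (int j)) ?s = (-1) ^ (p * j) \<odot> ?r" "\<And>l. l > int j \<Longrightarrow> ap (dpow F l) ?s = 0"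
    "ap (dpow E (int j)) ?r = (-1) ^ (p * j) \<odot> ?s" "\<And>l. l > int j \<Longrightarrow> ap (dpow E l) ?r = 0"
    using Suc by auto
  have supported_below: "?s \<in> supported_below ?n" "?r \<in> supported_below ?n" by (auto intro!: pair_vec_supported_below)
  have sec: "?s \<in> sector (p + j) p" using Suc.prems by (intro pair_vec_sector) auto
  have s: "ap (create N (?n, False)) ?s = (-1) ^ (p + j) \<odot> ?s'"
    using create_pair_vec(1)[OF n(2), of "{1..p}"] by simp
  have r: "ap (create N (?n, True)) ?r = (-1) ^ (p + (p + j)) \<odot> ?r'"
    using create_pair_vec(2)[OF n(2), of "{1..p}"] Suc.prems by simp
  have sg: "((-1) :: complex) ^ m * ((-1) ^ m * c) = c" for m c
    by (simp flip: mult.assoc power_mult_distrib)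
  have s': "?s' = (-1) ^ (p + j) \<odot> ap (create N (?n, False)) ?s" unfolding s by (simp flip: power_mult_distrib)
  have r': "?r' = (-1) ^ (p + (p + j)) \<odot> ap (create N (?n, True)) ?r" unfolding r by (simp flip: power_mult_distrib)
  have F: "ap (dpow F l) ?s' = (-1) ^ (p + j) \<odot> (ap (create N (?n, False)) (ap (dpow F l) ?s)
     + q powi (l - 1 - (int (p + j) - int p)) \<odot> ap (create N (?n, True)) (ap (dpow F (l - 1)) ?s))" for l
    unfolding s' ap_scale peel_dpowF[OF n supported_below(1) sec] ..
  have E: "ap (dpow E l) ?r' = (-1) ^ (p + (p + j)) \<odot> (q powi (- l) \<odot> ap (create N (?n, True)) (ap (dpow E l) ?r)
     + ap (create N (?n, False)) (ap (dpow E (l - 1)) ?r))" for l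
    unfolding r' ap_scale peel_dpowE[OF n supported_below(2)] ..
  have "ap (dpow F (int (Suc j))) ?s' = ((-1) ^ (p + j) * ((-1) ^ (p * j) * (-1) ^ (p + (p + j)))) \<odot> ?r'"
    unfolding F using IH(1,2) by (simp add: ap_scale r[unfolded One_nat_def])
  moreover have "((-1) :: complex) ^ (p + j) * ((-1) ^ (p * j) * (-1) ^ (p + (p + j))) = (-1) ^ (p * Suc j)"
    by (simp add: minus_one_power_iff)
  moreover have "ap (dpow E (int (Suc j))) ?r' = ((-1) ^ (p + (p + j)) * ((-1) ^ (p * j) * (-1) ^ (p + j))) \<odot> ?s'"
    unfolding E using IH(3,4) by (simp add: ap_scale s[unfolded One_nat_def])
  moreover have "((-1) :: complex) ^ (p + (p + j)) * ((-1) ^ (p * j) * (-1) ^ (p + j)) = (-1) ^ (p * Suc j)"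
    by (simp add: minus_one_power_iff)
  moreover have "ap (dpow F l) ?s' = 0" "ap (dpow E l) ?r' = 0" if "l > int (Suc j)" for l
    unfolding F E using IH(2,4) that by simp_all
  ultimately show ?case by auto
qed

text \<open>On \<open>v\<^sup>k \<otimes> v\<^bsup>k'\<^esup>\<close> only the summand \<open>j = 0\<close> survives, as one of the two sets of occupied sites contains the
  other, and there the coefficient is \<open>1\<close>.\<close>

lemma A_endo_normalised:
  assumes k: "k \<le> N" "k' \<le> N" and z: "regular z"
  shows "((-1) ^ min k k') \<odot> ap (A_endo (int k - int k') z) (pair_vec {1..k} {1..k'}) = (-1) ^ (k * k') \<odot> pair_vec {1..k'} {1..k}"
proof -
  define m where "m = int k - int k'"
  define c where "c j = (- q) ^ j / (1 - q ^ (2 * j + nat \<bar>m\<bar>) * z)" for j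
  define t where "t j = ap (dpow E (int j + max (- m) 0) * dpow F (int j + max m 0)) (pair_vec {1..k} {1..k'})" for j
  define r where "r = (-1) ^ (min k k' * nat \<bar>m\<bar>) \<odot> pair_vec {1..k'} {1..k}"
  have t: "t 0 = r \<and> (\<forall>j>0. t j = 0)"
  proof (cases "k \<ge> k'")
    case True
    then obtain d where d: "k = k' + d" using le_Suc_ex by blast
    then have m: "m = int d" "max m 0 = int d" "max (- m) 0 = 0" "min k k' = k'" "nat \<bar>m\<bar> = d" by (auto simp: m_def)
    show ?thesis unfolding t_def r_def m using dpow_pair_vec[of k' d] k d by (simp add: ap_simps)
  next
    case False
    then obtain d where d: "k' = k + d" using le_Suc_ex by (metis nat_le_linear)
    then have m: "m = - int d" "max m 0 = 0" "max (- m) 0 = int d" "min k k' = k" "nat \<bar>m\<bar> = d" by (auto simp: m_def)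
    have "ap F (pair_vec {1..k} {1..k'}) = 0" using d by (intro F_pair_vec_zero) auto
    then show ?thesis unfolding t_def r_def m using dpow_pair_vec[of k d] k d by (simp add: ap_simps dpow_zero)
  qed
  have "ap (A_endo m z) (pair_vec {1..k} {1..k'}) = (1 - q ^ nat \<bar>m\<bar> * z) \<odot> (\<Sum>j\<le>Suc N. c j \<odot> t j)"
    unfolding A_endo_def c_def t_def scl.rep_eq ap_sum_left ..
  also have "(\<Sum>j\<le>Suc N. c j \<odot> t j) = (\<Sum>j\<in>{0}. c j \<odot> t j)"
    by (rule sum.mono_neutral_right) (use t in auto)
  also have "\<dots> = c 0 \<odot> r" using t by simp
  also have "(1 - q ^ nat \<bar>m\<bar> * z) \<odot> c 0 \<odot> r = r"
  proof -
    have "1 - q ^ nat \<bar>m\<bar> * z \<noteq> 0" using z k unfolding regular_def m_def by auto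
    then show ?thesis by (simp add: c_def)
  qed
  finally have "((-1) ^ min k k') \<odot> ap (A_endo m z) (pair_vec {1..k} {1..k'}) =
     ((-1) ^ min k k' * (-1) ^ (min k k' * nat \<bar>m\<bar>)) \<odot> pair_vec {1..k'} {1..k}"
    by (simp add: r_def)
  also have "((-1) :: complex) ^ min k k' * (-1) ^ (min k k' * nat \<bar>m\<bar>) = (-1) ^ (k * k')"
  proof (cases "k \<ge> k'")
    case True
    then obtain d where "k = k' + d" using le_Suc_ex by blast
    then show ?thesis by (simp add: m_def minus_one_power_iff)
  next
    case False
    then obtain d where "k' = k + d" using le_Suc_ex by (metis nat_le_linear)
    then show ?thesis by (simp add: m_def minus_one_power_iff)
  qed
  finally show ?thesis by (simp add: m_def)
qed

lemma v_top_basis: "v_top k = basis_vec {1..k}"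
proof -
  have "i \<le> Suc k \<Longrightarrow> foldr (\<circ>) (map psi_star [i..<Suc k]) id vac = basis_vec {i..k}" for i
  proof (induction "Suc k - i" arbitrary: i)
    case 0
    then show ?case by (simp add: vac_def)
  next
    case (Suc d)
    then have i: "i < Suc k" by simp
    have "foldr (\<circ>) (map psi_star [i..<Suc k]) id vac = psi_star i (basis_vec {Suc i..k})"
      using Suc(1)[of "Suc i"] Suc(2) i by (subst upt_conv_Cons[OF i]) (simp del: upt_Suc)
    also have "\<dots> = basis_vec {i..k}"
    proof
      fix A
      have e: "{i..k} = insert i {Suc i..k}" using i by auto
      show "psi_star i (basis_vec {Suc i..k}) A = basis_vec {i..k} A"
      proof (cases "A = {i..k}")
        case True
        have "{a \<in> {i..k}. a < i} = {}" by auto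
        then have "wsign i {i..k} = 1" by (simp only: wsign_def card.empty power_0)
        moreover have "{i..k} - {i} = {Suc i..k}" "i \<in> {i..k}" using i by auto
        ultimately show ?thesis unfolding True psi_star_eval basis_vec_def by (simp only: if_True simp_thms mult_1_left)
      next
        case False
        then have "i \<in> A \<Longrightarrow> A - {i} \<noteq> {Suc i..k}" unfolding e by (metis insert_Diff)
        then show ?thesis using False unfolding psi_star_eval basis_vec_def by simp
      qed
    qed
    finally show ?case .
  qed
  from this[of 1] show ?thesis by (simp add: v_top_def op_prod_def del: upt_Suc)
qed

lemma tensor_v_top: "tensor_vec (v_top k) (v_top k') = pair_vec {1..k} {1..k'}"
  by (rule ext, clarify) (simp add: tensor_vec_def v_top_basis pair_vec_def basis_vec_def)

end

section \<open>Moving particles on a circle\<close>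

text \<open>Particles that exclude each other and move by single steps can be treated as if they could jump over each
  other: an occupied site on the way takes over the rest of the journey.\<close>

lemma jump_down:
  fixes P :: "nat set \<Rightarrow> bool"
  assumes move: "\<And>I i. P I \<Longrightarrow> 1 \<le> i \<Longrightarrow> i < N \<Longrightarrow> i + 1 \<in> I \<Longrightarrow> i \<notin> I \<Longrightarrow> P (insert i (I - {i + 1}))"
  shows "P I \<Longrightarrow> 1 \<le> c \<Longrightarrow> c < d \<Longrightarrow> d \<le> N \<Longrightarrow> d \<in> I \<Longrightarrow> c \<notin> I \<Longrightarrow> P (insert c (I - {d}))"
proof (induction d arbitrary: I)
  case (Suc d)
  show ?case
  proof (cases "d = c")
    case True
    then show ?thesis using move[of I d] Suc.prems by simp
  next
    case False
    then have d: "c < d" using Suc.prems by simp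
    show ?thesis
    proof (cases "d \<in> I")
      case True
      let ?J = "insert c (I - {d})"
      have "P ?J" using Suc.IH[of I] Suc.prems d True by simp
      then have "P (insert d (?J - {d + 1}))" using move[of ?J d] Suc.prems d by simp
      moreover have "insert d (?J - {d + 1}) = insert c (I - {Suc d})" using True d by auto
      ultimately show ?thesis by simp
    next
      case False
      let ?J = "insert d (I - {d + 1})"
      have "P ?J" using move[of I d] Suc.prems d False by simp
      then have "P (insert c (?J - {d}))" using Suc.IH[of ?J] Suc.prems d by simp
      moreover have "insert c (?J - {d}) = insert c (I - {Suc d})" using False by auto
      ultimately show ?thesis by simp
    qed
  qed
qed simp

lemma jump_up:
  fixes P :: "nat set \<Rightarrow> bool"
  assumes move: "\<And>I i. P I \<Longrightarrow> 1 \<le> i \<Longrightarrow> i < N \<Longrightarrow> i \<in> I \<Longrightarrow> i + 1 \<notin> I \<Longrightarrow> P (insert (i + 1) (I - {i}))"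
  shows "P I \<Longrightarrow> 1 \<le> d \<Longrightarrow> d < c \<Longrightarrow> c \<le> N \<Longrightarrow> d \<in> I \<Longrightarrow> c \<notin> I \<Longrightarrow> P (insert c (I - {d}))"
proof (induction c arbitrary: I)
  case (Suc c)
  show ?case
  proof (cases "d = c")
    case True
    then show ?thesis using move[of I d] Suc.prems by simp
  next
    case False
    then have c: "d < c" using Suc.prems by simp
    show ?thesis
    proof (cases "c \<in> I")
      case True
      let ?J = "insert (c + 1) (I - {c})"
      have "P ?J" using move[of I c] Suc.prems c True by simp
      then have "P (insert c (?J - {d}))" using Suc.IH[of ?J] Suc.prems c by simp
      moreover have "insert c (?J - {d}) = insert (Suc c) (I - {d})" using True c Suc.prems by auto
      ultimately show ?thesis by simp
    next
      case False
      let ?J = "insert c (I - {d})"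
      have "P ?J" using Suc.IH[of I] Suc.prems c False by simp
      then have "P (insert (c + 1) (?J - {c}))" using move[of ?J c] Suc.prems c by simp
      moreover have "insert (c + 1) (?J - {c}) = insert (Suc c) (I - {d})" using False by auto
      ultimately show ?thesis by simp
    qed
  qed
qed simp

text \<open>Upward jumps go once around the circle, through the step from \<open>1\<close> to \<open>N\<close>.\<close>

lemma jump_around:
  fixes P :: "nat set \<Rightarrow> bool"
  assumes move: "\<And>I i. P I \<Longrightarrow> 1 \<le> i \<Longrightarrow> i < N \<Longrightarrow> i + 1 \<in> I \<Longrightarrow> i \<notin> I \<Longrightarrow> P (insert i (I - {i + 1}))"
    and wrap: "\<And>I. P I \<Longrightarrow> 1 \<in> I \<Longrightarrow> N \<notin> I \<Longrightarrow> P (insert N (I - {1}))"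
    and I: "P I" "1 \<le> d" "d < c" "c \<le> N" "d \<in> I" "c \<notin> I"
  shows "P (insert c (I - {d}))"
proof -
  note down = jump_down[of P N, OF move]
  have one: "P (insert c (J - {1}))" if J: "P J" "1 \<in> J" "c \<notin> J" for J
  proof (cases "c = N")
    case True
    then show ?thesis using wrap J by simp
  next
    case False
    then have c: "1 < c" "c < N" using I by auto
    show ?thesis
    proof (cases "N \<in> J")
      case True
      have "P (insert c (J - {N}))" using down[of J c N] J c True by simp
      then have "P (insert N (insert c (J - {N}) - {1}))" using wrap[of "insert c (J - {N})"] J c by simp
      moreover have "insert N (insert c (J - {N}) - {1}) = insert c (J - {1})" using True c by auto
      ultimately show ?thesis by simp
    next
      case False
      have "P (insert N (J - {1}))" using wrap J False by simp
      then have "P (insert c (insert N (J - {1}) - {N}))" using down[of "insert N (J - {1})" c N] J c by simp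
      moreover have "insert c (insert N (J - {1}) - {N}) = insert c (J - {1})" using False by auto
      ultimately show ?thesis by simp
    qed
  qed
  show ?thesis
  proof (cases "d = 1")
    case True
    then show ?thesis using one I by simp
  next
    case False
    show ?thesis
    proof (cases "1 \<in> I")
      case True
      have "P (insert c (I - {1}))" using one I True by simp
      then have "P (insert 1 (insert c (I - {1}) - {d}))" using down[of "insert c (I - {1})" 1 d] I False by simp
      moreover have "insert 1 (insert c (I - {1}) - {d}) = insert c (I - {d})" using True False I by auto
      ultimately show ?thesis by simp
    next
      case nI: False
      have "P (insert 1 (I - {d}))" using down[of I 1 d] I False nI by simp
      then have "P (insert c (insert 1 (I - {d}) - {1}))" by (rule one) (use I in auto)
      moreover have "insert c (insert 1 (I - {d}) - {1}) = insert c (I - {d})" using nI by auto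
      ultimately show ?thesis by simp
    qed
  qed
qed

text \<open>Induction on the number of particles outside of \<open>{1..k}\<close>: each of them has jumped up from an empty site
  inside.\<close>

lemma reach_from_initial:
  fixes P :: "nat set \<Rightarrow> bool"
  assumes jump: "\<And>I c d. P I \<Longrightarrow> 1 \<le> d \<Longrightarrow> d < c \<Longrightarrow> c \<le> N \<Longrightarrow> d \<in> I \<Longrightarrow> c \<notin> I \<Longrightarrow> P (insert c (I - {d}))"
    and init: "P {1..k}"
  shows "I \<subseteq> {1..N} \<Longrightarrow> card I = k \<Longrightarrow> P I"
proof (induction "card (I - {1..k})" arbitrary: I)
  case 0
  then have f: "finite I" by (meson finite_atLeastAtMost finite_subset)
  then have "I \<subseteq> {1..k}" using 0 by auto
  then have "I = {1..k}" using 0 by (intro card_subset_eq) auto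
  then show ?case using init by simp
next
  case (Suc m)
  have f: "finite I" using Suc.prems by (meson finite_atLeastAtMost finite_subset)
  obtain c where c: "c \<in> I" "c \<notin> {1..k}" using Suc(2) by (metis DiffE card.empty ex_in_conv nat.distinct(1))
  have "\<not> {1..k} \<subseteq> I"
  proof
    assume "{1..k} \<subseteq> I"
    then have "{1..k} = I" using f Suc.prems by (intro card_subset_eq) auto
    then show False using c by auto
  qed
  then obtain d where d: "d \<in> {1..k}" "d \<notin> I" by blast
  let ?J = "insert d (I - {c})"
  have cN: "1 \<le> c" "c \<le> N" "d < c" "1 \<le> d" using c d Suc.prems by auto
  have "?J - {1..k} = (I - {1..k}) - {c}" using d by auto
  then have "card (?J - {1..k}) = m" using Suc(2) c f by simp
  moreover have "card ?J = Suc (card (I - {c}))" using f d(2) by (intro card_insert_disjoint) auto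
  then have "card ?J = k" unfolding card_Suc_Diff1[OF f c(1)] Suc.prems(2) .
  moreover have "?J \<subseteq> {1..N}" using Suc.prems cN by auto
  ultimately have "P ?J" using Suc(1) by blast
  then have "P (insert c (?J - {d}))" using jump[of ?J d c] cN c d by auto
  moreover have "insert c (?J - {d}) = I" using c d by auto
  ultimately show ?case by simp
qed

section \<open>Families of vectors depending polynomially on a parameter\<close>

text \<open>A Nakayama type argument: families that specialise to a basis at \<open>0\<close> span after inverting one nonzero
  polynomial. Elimination of one coordinate at a time, with the pivot \<open>a\<close> satisfying \<open>a(0) = 1\<close>, avoids
  determinants.\<close>

lemma polynomial_basis_elimination:
  fixes L :: "(complex \<Rightarrow> 'b \<Rightarrow> complex) set"
  assumes "finite B"
    and "(\<lambda>_. 0) \<in> L"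
    and "\<And>g h. g \<in> L \<Longrightarrow> h \<in> L \<Longrightarrow> (\<lambda>e. g e + h e) \<in> L"
    and "\<And>g p. g \<in> L \<Longrightarrow> (\<lambda>e. poly p e \<odot> g e) \<in> L"
    and "\<And>g b. g \<in> L \<Longrightarrow> \<exists>p. \<forall>e. g e b = poly p e"
    and "\<And>g b e. g \<in> L \<Longrightarrow> b \<notin> B \<Longrightarrow> g e b = 0"
    and "\<And>b. b \<in> B \<Longrightarrow> \<exists>g\<in>L. g 0 = basis_vec b"
  shows "\<exists>p. p \<noteq> 0 \<and> (\<forall>b\<in>B. (\<lambda>e. poly p e \<odot> basis_vec b) \<in> L)"
  using assms
proof (induction B arbitrary: L rule: finite_induct)
  case empty
  show ?case by (rule exI[of _ "1 :: complex poly"]) simp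
next
  case (insert b0 B)
  note zero = insert.prems(1) and add = insert.prems(2) and mult = insert.prems(3)
    and pol = insert.prems(4) and on_sites = insert.prems(5) and ex = insert.prems(6)
  have sumL: "(\<lambda>e. \<Sum>b\<in>S. f b e) \<in> L" if "finite S" "\<And>b. b \<in> S \<Longrightarrow> f b \<in> L" for f S
    using that
  proof (induction S rule: finite_induct)
    case empty
    show ?case using zero by (simp only: sum.empty)
  next
    case (insert x S)
    have "(\<lambda>e. f x e + (\<Sum>b\<in>S. f b e)) \<in> L" by (rule add) (use insert in auto)
    then show ?case by (simp only: sum.insert[OF insert.hyps(1,2)])
  qed
  define L' where "L' = {g \<in> L. \<forall>e. g e b0 = 0}"
  obtain w where w: "w \<in> L" "w 0 = basis_vec b0" using ex by blast
  obtain a where a: "\<And>e. w e b0 = poly a e" using pol[OF w(1)] by blast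
  have a0: "poly a 0 = 1" using a[of 0] w(2) by (simp add: basis_vec_def)
  have "\<exists>p. p \<noteq> 0 \<and> (\<forall>b\<in>B. (\<lambda>e. poly p e \<odot> basis_vec b) \<in> L')"
  proof (rule insert.IH)
    show "(\<lambda>_. 0) \<in> L'" unfolding L'_def by (intro CollectI conjI zero) simp
    show "(\<lambda>e. g e + h e) \<in> L'" if "g \<in> L'" "h \<in> L'" for g h
    proof -
      have gh: "g \<in> L" "h \<in> L" "(g e + h e) b0 = 0" for e using that by (simp_all add: L'_def)
      show ?thesis unfolding L'_def by (intro CollectI conjI allI add gh)
    qed
    show "(\<lambda>e. poly p e \<odot> g e) \<in> L'" if "g \<in> L'" for g p
      using that mult by (simp add: L'_def cscale_def)
    show "\<exists>p. \<forall>e. g e b = poly p e" if "g \<in> L'" for g b using that pol by (simp add: L'_def)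
    show "g e b = 0" if "g \<in> L'" "b \<notin> B" for g b e
      using that on_sites[of g b e] by (cases "b = b0") (auto simp: L'_def)
    show "\<exists>g\<in>L'. g 0 = basis_vec b" if b: "b \<in> B" for b
    proof -
      obtain h where h: "h \<in> L" "h 0 = basis_vec b" using ex b by blast
      obtain c where c: "\<And>e. h e b0 = poly c e" using pol[OF h(1)] by blast
      have c0: "poly c 0 = 0" using c[of 0] h(2) b insert.hyps(2) by (auto simp: basis_vec_def split: if_splits)
      let ?g = "\<lambda>e. poly a e \<odot> h e + poly (- c) e \<odot> w e"
      have "?g \<in> L" by (intro add mult h(1) w(1))
      moreover have "?g e b0 = 0" for e by (simp add: cscale_def a c)
      moreover have "?g 0 = basis_vec b" by (simp add: h(2) a0 c0)
      ultimately show ?thesis by (intro bexI[of _ ?g]) (simp_all add: L'_def)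
    qed
  qed
  then obtain p where p: "p \<noteq> 0" "\<And>b. b \<in> B \<Longrightarrow> (\<lambda>e. poly p e \<odot> basis_vec b) \<in> L"
    by (auto simp: L'_def)
  have "\<exists>c. \<forall>b. \<forall>e. w e b = poly (c b) e" using pol[OF w(1)] by metis
  then obtain c where c: "\<And>b e. w e b = poly (c b) e" by blast
  let ?g = "\<lambda>e. poly p e \<odot> w e + (\<Sum>b\<in>B. poly (- c b) e \<odot> poly p e \<odot> basis_vec b)"
  have "(\<lambda>e. \<Sum>b\<in>B. poly (- c b) e \<odot> poly p e \<odot> basis_vec b) \<in> L"
    by (rule sumL[OF insert.hyps(1)]) (rule mult[OF p(2)])
  then have gL: "?g \<in> L" by (rule add[OF mult[OF w(1)]])
  have ev: "(\<Sum>i\<in>S. f i) b = (\<Sum>i\<in>S. f i b)" for S and f :: "'b \<Rightarrow> 'b \<Rightarrow> complex" and b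
    by (induction S rule: infinite_finite_induct) simp_all
  have "?g e = poly (p * a) e \<odot> basis_vec b0" for e
  proof
    fix b
    have "(\<Sum>b'\<in>B. poly (- c b') e \<odot> poly p e \<odot> basis_vec b') b = (\<Sum>b'\<in>B. if b' = b then - poly (c b') e * poly p e else 0)"
      unfolding ev by (intro sum.cong) (auto simp: cscale_def basis_vec_def)
    also have "\<dots> = (if b \<in> B then - poly (c b) e * poly p e else 0)"
      using insert.hyps(1) by (simp add: sum.delta)
    finally have "?g e b = poly p e * w e b + (if b \<in> B then - poly (c b) e * poly p e else 0)"
      by (simp add: cscale_def)
    then show "?g e b = (poly (p * a) e \<odot> basis_vec b0) b"
      using on_sites[OF w(1), of b e] insert.hyps(2) a[of e] c[of e b]
      by (cases "b = b0"; cases "b \<in> B") (auto simp: cscale_def basis_vec_def)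
  qed
  then have "(\<lambda>e. poly (p * a) e \<odot> basis_vec b0) \<in> L" using gL by simp
  moreover have "(\<lambda>e. poly (p * a) e \<odot> basis_vec b) \<in> L" if "b \<in> B" for b
    using mult[OF p(2)[OF that], of a] by (simp add: mult.commute)
  moreover have "a \<noteq> 0" using a0 by auto
  ultimately show ?case using p(1) by (intro exI[of _ "p * a"]) auto
qed

text \<open>Polynomial functions of a complex variable with vector coefficients.\<close>

inductive polyvec :: "(complex \<Rightarrow> ext2) \<Rightarrow> bool" where
  const: "polyvec (\<lambda>_. x)"
| add: "polyvec g \<Longrightarrow> polyvec h \<Longrightarrow> polyvec (\<lambda>e. g e + h e)"
| shift: "polyvec g \<Longrightarrow> polyvec (\<lambda>e. e \<odot> g e)"

lemma polyvec_ap: "polyvec g \<Longrightarrow> polyvec (\<lambda>e. ap T (g e))"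
  by (induction rule: polyvec.induct) (simp_all only: ap_add ap_scale polyvec.intros)

lemma polyvec_scale: "polyvec g \<Longrightarrow> polyvec (\<lambda>e. c \<odot> g e)"
proof (induction rule: polyvec.induct)
  case (shift g)
  have "(\<lambda>e. c \<odot> e \<odot> g e) = (\<lambda>e. e \<odot> c \<odot> g e)" by (simp add: mult.commute)
  then show ?case using polyvec.shift[OF shift.IH] by (simp only:)
qed (simp_all only: cfun.scale_right_distrib polyvec.intros)

lemma polyvec_poly: assumes "polyvec g" shows "polyvec (\<lambda>e. poly p e \<odot> g e)"
proof (induction p)
  case 0
  have "(\<lambda>e. poly 0 e \<odot> g e) = (\<lambda>_. 0)" by simp
  then show ?case using polyvec.const by (simp only:)
next
  case (pCons c p)
  have "(\<lambda>e. poly (pCons c p) e \<odot> g e) = (\<lambda>e. c \<odot> g e + e \<odot> poly p e \<odot> g e)"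
    by (simp add: cfun.scale_left_distrib)
  then show ?case
    using polyvec.add[OF polyvec_scale[OF assms, of c] polyvec.shift[OF pCons.IH]] by (simp only:)
qed

lemma polyvec_coordinate: "polyvec g \<Longrightarrow> \<exists>p. \<forall>e. g e b = poly p e"
proof (induction rule: polyvec.induct)
  case (const x)
  show ?case by (rule exI[of _ "[:x b:]"]) simp
next
  case (add g h)
  then obtain p r where "\<forall>e. g e b = poly p e" "\<forall>e. h e b = poly r e" by blast
  then show ?case by (intro exI[of _ "p + r"]) simp
next
  case (shift g)
  then obtain p where "\<forall>e. g e b = poly p e" by blast
  then show ?case by (intro exI[of _ "pCons 0 p"]) (simp add: cscale_def)
qed

section \<open>Cyclicity for generic parameters\<close>

context braiding_setting
begin

definition submodule :: "complex \<Rightarrow> complex \<Rightarrow> ext2 set \<Rightarrow> bool" where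
  "submodule z1 z2 W \<longleftrightarrow> cfun.subspace W \<and>
    (\<forall>i<N. \<forall>u\<in>W. ap (e_act z1 z2 i) u \<in> W \<and> ap (f_act z1 z2 i) u \<in> W)"

text \<open>Polynomial families in \<open>\<epsilon> = z\<^sub>2 / z\<^sub>1\<close> whose value lies in the submodule generated by
  \<open>v\<^sup>k \<otimes> v\<^bsup>k'\<^esup>\<close>, for all parameters simultaneously.\<close>

definition reached :: "nat \<Rightarrow> nat \<Rightarrow> (complex \<Rightarrow> ext2) set" where
  "reached k k' = {g. polyvec g \<and> (\<forall>e. g e \<in> sector k k') \<and>
     (\<forall>z1 z2 W. z1 \<noteq> 0 \<longrightarrow> z2 \<noteq> 0 \<longrightarrow> submodule z1 z2 W \<longrightarrow> pair_vec {1..k} {1..k'} \<in> W \<longrightarrow> g (z2 / z1) \<in> W)}"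

lemma reached_zero: "(\<lambda>_. 0) \<in> reached k k'"
  by (auto simp: reached_def polyvec.const sector_zero submodule_def cfun.subspace_0)

lemma reached_add: "g \<in> reached k k' \<Longrightarrow> h \<in> reached k k' \<Longrightarrow> (\<lambda>e. g e + h e) \<in> reached k k'"
  by (auto simp: reached_def polyvec.add sector_add submodule_def cfun.subspace_add)

lemma reached_poly: "g \<in> reached k k' \<Longrightarrow> (\<lambda>e. poly p e \<odot> g e) \<in> reached k k'"
  by (auto simp: reached_def polyvec_poly sector_scale submodule_def cfun.subspace_scale)

lemma reached_scale: "g \<in> reached k k' \<Longrightarrow> (\<lambda>e. c \<odot> g e) \<in> reached k k'"
  using reached_poly[of g k k' "[:c:]"] by simp

lemma e_act_f_act_finite:
  assumes "1 \<le> i" "i < N"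
  shows "e_act z1 z2 i = e1 i (i + 1) + e2 i (i + 1)" "f_act z1 z2 i = f1 i (i + 1) + f2 i (i + 1)"
  using assms by (simp_all add: e_act_def f_act_def e_comb_def f_comb_def spectral_def cyc_def)

lemma reached_finite:
  assumes g: "g \<in> reached k k'" and i: "1 \<le> i" "i < N"
  shows "(\<lambda>e. ap (e1 i (i + 1) + e2 i (i + 1)) (g e)) \<in> reached k k'"
    and "(\<lambda>e. ap (f1 i (i + 1) + f2 i (i + 1)) (g e)) \<in> reached k k'"
proof -
  have s: "ap (e1 i (i + 1) + e2 i (i + 1)) x \<in> sector k k'" "ap (f1 i (i + 1) + f2 i (i + 1)) x \<in> sector k k'"
    if "x \<in> sector k k'" for x
    using sector_ops[OF that i(2), of 1 1] e_act_f_act_finite[OF i] by simp_all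
  have W: "ap (e1 i (i + 1) + e2 i (i + 1)) (g (z2 / z1)) \<in> W \<and> ap (f1 i (i + 1) + f2 i (i + 1)) (g (z2 / z1)) \<in> W"
    if "z1 \<noteq> 0" "z2 \<noteq> 0" "submodule z1 z2 W" "pair_vec {1..k} {1..k'} \<in> W" for z1 z2 W
  proof -
    have "g (z2 / z1) \<in> W" using g that unfolding reached_def by blast
    then show ?thesis using that(3) i(2) unfolding submodule_def e_act_f_act_finite[OF i, of z1 z2, symmetric] by blast
  qed
  have p: "polyvec g" "\<And>e. g e \<in> sector k k'" using g by (auto simp: reached_def)
  show "(\<lambda>e. ap (e1 i (i + 1) + e2 i (i + 1)) (g e)) \<in> reached k k'"
    "(\<lambda>e. ap (f1 i (i + 1) + f2 i (i + 1)) (g e)) \<in> reached k k'"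
    using W s p polyvec_ap unfolding reached_def by simp_all
qed

text \<open>The rescaled generator \<open>\<Delta>(e\<^sub>0) / z\<^sub>1\<close> is polynomial in \<open>\<epsilon>\<close>, and at \<open>\<epsilon> = 0\<close> only the part acting on the first
  factor is left.\<close>

lemma reached_affine:
  assumes g: "g \<in> reached k k'"
  shows "(\<lambda>e. ap (e1 N 1) (g e) + e \<odot> ap (e2 N 1) (g e)) \<in> reached k k'"
proof -
  let ?h = "\<lambda>e. ap (e1 N 1) (g e) + e \<odot> ap (e2 N 1) (g e)"
  have eq: "e_act z1 z2 0 = z1 \<bullet> e1 N 1 + z2 \<bullet> e2 N 1" for z1 z2
    by (simp add: e_act_def e_comb_def spectral_def cyc_def)
  have "?h e \<in> sector k k'" for e
  proof -
    have "g e \<in> sector k k'" using g by (simp add: reached_def)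
    then have "ap (e_act 1 e 0) (g e) \<in> sector k k'" using sector_ops(1)[of "g e" k k' 0 1 e] N2 by simp
    then show ?thesis by (simp add: eq ap_simps)
  qed
  moreover have "polyvec ?h" 
    using g polyvec.add[OF polyvec_ap polyvec.shift[OF polyvec_ap]] by (simp only: reached_def mem_Collect_eq)
  moreover have "?h (z2 / z1) \<in> W"
    if W: "z1 \<noteq> 0" "z2 \<noteq> 0" "submodule z1 z2 W" "pair_vec {1..k} {1..k'} \<in> W" for z1 z2 W
  proof -
    have "g (z2 / z1) \<in> W" using g W unfolding reached_def by blast
    then have "ap (e_act z1 z2 0) (g (z2 / z1)) \<in> W" using W(3) N2 by (simp add: submodule_def)
    then have "inverse z1 \<odot> ap (e_act z1 z2 0) (g (z2 / z1)) \<in> W"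
      using W(3) by (simp add: submodule_def cfun.subspace_scale)
    then show ?thesis using W(1) by (simp add: eq ap_simps cfun.scale_right_distrib divide_inverse mult.commute)
  qed
  ultimately show ?thesis by (simp add: reached_def)
qed

definition limit_space :: "nat \<Rightarrow> nat \<Rightarrow> ext2 set" where "limit_space k k' = {g 0 | g. g \<in> reached k k'}"

lemma limit_spaceI: "g \<in> reached k k' \<Longrightarrow> g 0 \<in> limit_space k k'"
  unfolding limit_space_def by blast

lemma limit_spaceE: "x \<in> limit_space k k' \<Longrightarrow> (\<And>g. x = g 0 \<Longrightarrow> g \<in> reached k k' \<Longrightarrow> thesis) \<Longrightarrow> thesis"
  unfolding limit_space_def by blast

lemma limit_space_add: "x \<in> limit_space k k' \<Longrightarrow> y \<in> limit_space k k' \<Longrightarrow> x + y \<in> limit_space k k'"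
  by (elim limit_spaceE) (simp only: limit_spaceI[OF reached_add])

lemma limit_space_scale: "x \<in> limit_space k k' \<Longrightarrow> c \<odot> x \<in> limit_space k k'"
  by (elim limit_spaceE) (simp only: limit_spaceI[OF reached_scale])

lemma limit_space_ops:
  assumes "x \<in> limit_space k k'"
  shows "1 \<le> i \<Longrightarrow> i < N \<Longrightarrow> ap (e1 i (i + 1) + e2 i (i + 1)) x \<in> limit_space k k'"
    and "1 \<le> i \<Longrightarrow> i < N \<Longrightarrow> ap (f1 i (i + 1) + f2 i (i + 1)) x \<in> limit_space k k'"
    and "ap (e1 N 1) x \<in> limit_space k k'"
proof -
  obtain g where g: "x = g 0" "g \<in> reached k k'" using assms by (rule limit_spaceE)
  show "1 \<le> i \<Longrightarrow> i < N \<Longrightarrow> ap (e1 i (i + 1) + e2 i (i + 1)) x \<in> limit_space k k'"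
    unfolding g(1) by (rule limit_spaceI[OF reached_finite(1)[OF g(2)]])
  show "1 \<le> i \<Longrightarrow> i < N \<Longrightarrow> ap (f1 i (i + 1) + f2 i (i + 1)) x \<in> limit_space k k'"
    unfolding g(1) by (rule limit_spaceI[OF reached_finite(2)[OF g(2)]])
  show "ap (e1 N 1) x \<in> limit_space k k'"
    using limit_spaceI[OF reached_affine[OF g(2)]] by (simp add: g(1))
qed

lemma limit_space_scaleD: "c \<odot> x \<in> limit_space k k' \<Longrightarrow> c \<noteq> 0 \<Longrightarrow> x \<in> limit_space k k'"
  using limit_space_scale[of "c \<odot> x" k k' "inverse c"] by simp

lemma qhop_pair_vec:
  assumes "1 \<le> c" "c \<le> N" "1 \<le> d" "d \<le> N" "c \<noteq> d"
  shows "d \<in> I \<Longrightarrow> c \<notin> I \<Longrightarrow> \<exists>s. s \<noteq> 0 \<and> ap (qhop w (c, False) (d, False)) (pair_vec I J) = s \<odot> pair_vec (insert c (I - {d})) J"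
    and "d \<notin> I \<or> c \<in> I \<Longrightarrow> ap (qhop w (c, False) (d, False)) (pair_vec I J) = 0"
    and "d \<in> J \<Longrightarrow> c \<notin> J \<Longrightarrow> \<exists>s. s \<noteq> 0 \<and> ap (qhop w (c, True) (d, True)) (pair_vec I J) = s \<odot> pair_vec I (insert c (J - {d}))"
    and "d \<notin> J \<or> c \<in> J \<Longrightarrow> ap (qhop w (c, True) (d, True)) (pair_vec I J) = 0"
proof -
  have set: "d \<notin> A - {c} \<and> c \<in> A \<and> insert d (A - {c}) = I \<longleftrightarrow> d \<in> I \<and> c \<notin> I \<and> A = insert c (I - {d})" for A I
    using assms(5) by (safe; auto)
  have nz: "wsign i A \<noteq> 0" for i A by (simp add: wsign_def)
  have hop: "psi_star c (psi d u) A = (if d \<in> I \<and> c \<notin> I \<and> A = insert c (I - {d})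
      then wsign c (insert c (I - {d})) * wsign d (I - {d}) * v else 0)"
    if u: "\<And>A. u A = (if A = I then v else 0)" for u v A I
  proof (cases "d \<in> I \<and> c \<notin> I \<and> A = insert c (I - {d})")
    case True
    then have "c \<in> A" "d \<notin> A - {c}" "insert d (A - {c}) = I" "A - {c} = I - {d}" using set[of A I] by auto
    then show ?thesis using True by (simp add: psi_eval psi_star_eval u)
  next
    case False
    then have "c \<in> A \<Longrightarrow> d \<notin> A - {c} \<Longrightarrow> insert d (A - {c}) \<noteq> I" using set[of A I] by blast
    then show ?thesis unfolding if_not_P[OF False] by (simp add: psi_eval psi_star_eval u)
  qed
  have 1: "ap (qhop w (c, False) (d, False)) (pair_vec I J) (A, B) =
      q powi energy N w A B * (if d \<in> I \<and> c \<notin> I \<and> A = insert c (I - {d})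
      then wsign c (insert c (I - {d})) * wsign d (I - {d}) * (if B = J then 1 else 0) else 0)" for A B
  proof -
    have "psi_star c (psi d (\<lambda>I'. pair_vec I J (I', B))) A = (if d \<in> I \<and> c \<notin> I \<and> A = insert c (I - {d})
      then wsign c (insert c (I - {d})) * wsign d (I - {d}) * (if B = J then 1 else 0) else 0)"
      by (rule hop) (simp add: pair_vec_def basis_vec_def)
    then show ?thesis unfolding qhop_def times_endo.rep_eq ap_weight_op ap_hop(1)[OF assms(1-4)] by (simp only:)
  qed
  have 2: "ap (qhop w (c, True) (d, True)) (pair_vec I J) (A, B) =
      q powi energy N w A B * (if d \<in> J \<and> c \<notin> J \<and> B = insert c (J - {d})
      then wsign c (insert c (J - {d})) * wsign d (J - {d}) * (if A = I then 1 else 0) else 0)" for A B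
  proof -
    have "psi_star c (psi d (\<lambda>J'. pair_vec I J (A, J'))) B = (if d \<in> J \<and> c \<notin> J \<and> B = insert c (J - {d})
      then wsign c (insert c (J - {d})) * wsign d (J - {d}) * (if A = I then 1 else 0) else 0)"
      by (rule hop) (simp add: pair_vec_def basis_vec_def)
    then show ?thesis unfolding qhop_def times_endo.rep_eq ap_weight_op ap_hop(2)[OF assms(1-4)] by (simp only:)
  qed
  show "\<exists>s. s \<noteq> 0 \<and> ap (qhop w (c, False) (d, False)) (pair_vec I J) = s \<odot> pair_vec (insert c (I - {d})) J"
    if "d \<in> I" "c \<notin> I"
  proof (intro exI[of _ "q powi energy N w (insert c (I - {d})) J * (wsign c (insert c (I - {d})) * wsign d (I - {d}))"] conjI)
    show "ap (qhop w (c, False) (d, False)) (pair_vec I J) =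
        (q powi energy N w (insert c (I - {d})) J * (wsign c (insert c (I - {d})) * wsign d (I - {d}))) \<odot> pair_vec (insert c (I - {d})) J"
      by (rule ext, clarify, unfold 1) (use that in \<open>simp add: cscale_def pair_vec_def basis_vec_def\<close>)
  qed (simp add: nz)
  show "ap (qhop w (c, False) (d, False)) (pair_vec I J) = 0" if "d \<notin> I \<or> c \<in> I"
    by (rule ext, clarify, unfold 1) (use that in auto)
  show "\<exists>s. s \<noteq> 0 \<and> ap (qhop w (c, True) (d, True)) (pair_vec I J) = s \<odot> pair_vec I (insert c (J - {d}))"
    if "d \<in> J" "c \<notin> J"
  proof (intro exI[of _ "q powi energy N w I (insert c (J - {d})) * (wsign c (insert c (J - {d})) * wsign d (J - {d}))"] conjI)
    show "ap (qhop w (c, True) (d, True)) (pair_vec I J) =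
        (q powi energy N w I (insert c (J - {d})) * (wsign c (insert c (J - {d})) * wsign d (J - {d}))) \<odot> pair_vec I (insert c (J - {d}))"
      by (rule ext, clarify, unfold 2) (use that in \<open>simp add: cscale_def pair_vec_def basis_vec_def\<close>)
  qed (simp add: nz)
  show "ap (qhop w (c, True) (d, True)) (pair_vec I J) = 0" if "d \<notin> J \<or> c \<in> J"
    by (rule ext, clarify, unfold 2) (use that in auto)
qed

text \<open>All \<open>e\<^sub>i\<close> with \<open>1 \<le> i < N\<close> annihilate \<open>v\<^bsup>k'\<^esup>\<close>, so that on \<open>\<bigwedge>\<^sup>k V \<otimes> v\<^bsup>k'\<^esup>\<close> they move particles of the first factor only.
  Together with the degenerate \<open>e\<^sub>0\<close> they move these particles around a circle.\<close>

lemma limit_space_first: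
  assumes k: "k \<le> N" "k' \<le> N" and I: "I \<subseteq> {1..N}" "card I = k"
  shows "pair_vec I {1..k'} \<in> limit_space k k'"
proof -
  define P where "P I \<longleftrightarrow> pair_vec I {1..k'} \<in> limit_space k k'" for I
  have move: "P (insert i (I - {i + 1}))" if P: "P I" and i: "1 \<le> i" "i < N" "i + 1 \<in> I" "i \<notin> I" for I i
  proof -
    have "ap (e2 i (i + 1)) (pair_vec I {1..k'}) = 0"
      unfolding e2_def using i by (intro qhop_pair_vec(4)) auto
    moreover obtain s where "s \<noteq> 0" "ap (e1 i (i + 1)) (pair_vec I {1..k'}) = s \<odot> pair_vec (insert i (I - {i + 1})) {1..k'}"
      using qhop_pair_vec(1)[of i "i + 1" I "\<lambda>_. 0" "{1..k'}"] i unfolding e1_def by auto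
    ultimately show ?thesis
      using limit_space_ops(1)[of _ k k' i, OF P[unfolded P_def] i(1,2)] limit_space_scaleD
      by (simp add: P_def ap_simps)
  qed
  have wrap: "P (insert N (I - {1}))" if P: "P I" and I: "1 \<in> I" "N \<notin> I" for I
  proof -
    obtain s where "s \<noteq> 0" "ap (e1 N 1) (pair_vec I {1..k'}) = s \<odot> pair_vec (insert N (I - {1})) {1..k'}"
      using qhop_pair_vec(1)[of N 1 I "\<lambda>_. 0" "{1..k'}"] I N2 unfolding e1_def by auto
    then show ?thesis using limit_space_ops(3)[OF P[unfolded P_def]] limit_space_scaleD by (simp add: P_def)
  qed
  have "pair_vec {1..k} {1..k'} \<in> sector k k'" using k by (intro pair_vec_sector) auto
  then have "(\<lambda>_. pair_vec {1..k} {1..k'}) \<in> reached k k'" by (auto simp: reached_def polyvec.const)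
  from limit_spaceI[OF this] have init: "P {1..k}" unfolding P_def .
  have "P I" by (rule reach_from_initial[of P N, OF jump_around[of P N, OF move wrap] init I]) auto
  then show ?thesis by (simp add: P_def)
qed

text \<open>Once the first factor is arbitrary, the first summand of \<open>\<Delta>(f\<^sub>i)\<close> stays within what has been reached, and
  hence the second summand, a move in the second factor alone, is available too.\<close>

lemma limit_space_all:
  assumes k: "k \<le> N" "k' \<le> N" and I: "I \<subseteq> {1..N}" "card I = k" and J: "J \<subseteq> {1..N}" "card J = k'"
  shows "pair_vec I J \<in> limit_space k k'"
proof -
  define P where "P J \<longleftrightarrow> (\<forall>I. I \<subseteq> {1..N} \<longrightarrow> card I = k \<longrightarrow> pair_vec I J \<in> limit_space k k')" for J
  have move: "P (insert (i + 1) (J - {i}))" if P: "P J" and i: "1 \<le> i" "i < N" "i \<in> J" "i + 1 \<notin> J" for J i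
    unfolding P_def
  proof (intro allI impI)
    fix I assume I: "I \<subseteq> {1..N}" "card I = k"
    have b: "pair_vec I J \<in> limit_space k k'" using P I by (simp add: P_def)
    have 1: "ap (f1 i (i + 1)) (pair_vec I J) \<in> limit_space k k'"
    proof (cases "i \<in> I \<and> i + 1 \<notin> I")
      case True
      let ?I = "insert (i + 1) (I - {i})"
      have "finite I" using I by (meson finite_atLeastAtMost finite_subset)
      then have "card ?I = Suc (card (I - {i}))" "Suc (card (I - {i})) = card I"
        using True by (auto intro: card_insert_disjoint card_Suc_Diff1 simp del: card_Diff_insert card_Diff_singleton)
      then have "?I \<subseteq> {1..N}" "card ?I = k" using I i by auto
      then have "pair_vec ?I J \<in> limit_space k k'" using P unfolding P_def by blast
      moreover obtain s where "ap (f1 i (i + 1)) (pair_vec I J) = s \<odot> pair_vec ?I J"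
        using qhop_pair_vec(1)[of "i + 1" i I _ J] True i unfolding f1_def by auto
      ultimately show ?thesis using limit_space_scale by simp
    next
      case False
      then have "ap (f1 i (i + 1)) (pair_vec I J) = 0" using i unfolding f1_def by (intro qhop_pair_vec(2)) auto
      then show ?thesis using limit_space_scale[OF b, of 0] by simp
    qed
    have "ap (f2 i (i + 1)) (pair_vec I J) = ap (f1 i (i + 1) + f2 i (i + 1)) (pair_vec I J) + (-1) \<odot> ap (f1 i (i + 1)) (pair_vec I J)"
      by (simp add: ap_simps)
    then have "ap (f2 i (i + 1)) (pair_vec I J) \<in> limit_space k k'"
      using limit_space_add[OF limit_space_ops(2)[OF b i(1,2)] limit_space_scale[OF 1, of "-1"]] by simp
    moreover obtain s where "s \<noteq> 0" "ap (f2 i (i + 1)) (pair_vec I J) = s \<odot> pair_vec I (insert (i + 1) (J - {i}))"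
      using qhop_pair_vec(3)[of "i + 1" i J "\<lambda>_. 0" I] i unfolding f2_def by auto
    ultimately show "pair_vec I (insert (i + 1) (J - {i})) \<in> limit_space k k'" using limit_space_scaleD by simp
  qed
  have init: "P {1..k'}" unfolding P_def using limit_space_first[OF k] by simp
  have "P J" by (rule reach_from_initial[of P N, OF jump_up[of P N, OF move] init J]) auto
  then show ?thesis using I by (simp add: P_def)
qed

lemma sector_expand: assumes x: "x \<in> sector k k'"
  shows "x = (\<Sum>p\<in>{(A, B). A \<subseteq> {1..N} \<and> B \<subseteq> {1..N} \<and> card A = k \<and> card B = k'}. x p \<odot> basis_vec p)"
proof (rule ext, clarify)
  fix A B
  let ?S = "{(A, B). A \<subseteq> {1..N} \<and> B \<subseteq> {1..N} \<and> card A = k \<and> card B = k'}"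
  have fin: "finite ?S" by (rule finite_subset[of _ "Pow {1..N} \<times> Pow {1..N}"]) auto
  have "(\<Sum>p\<in>?S. x p \<odot> basis_vec p) (A, B) = (\<Sum>p\<in>?S. if p = (A, B) then x p else 0)"
    unfolding sum_fun_eval by (intro sum.cong) (auto simp: cscale_def basis_vec_def)
  also have "\<dots> = x (A, B)" using sectorD[OF x, of A B] fin by (cases "x (A, B) = 0") (auto simp: sum.delta)
  finally show "x (A, B) = (\<Sum>p\<in>?S. x p \<odot> basis_vec p) (A, B)" by simp
qed

text \<open>This replaces the irreducibility of generic tensor products: it suffices for uniqueness, and also for
  invertibility because the inverse is known explicitly.\<close>

theorem generic_cyclicity:
  assumes k: "k \<le> N" "k' \<le> N"
  obtains P :: "complex poly" where "P \<noteq> 0"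
    "\<And>z1 z2 W. z1 \<noteq> 0 \<Longrightarrow> z2 \<noteq> 0 \<Longrightarrow> poly P (z2 / z1) \<noteq> 0 \<Longrightarrow> submodule z1 z2 W \<Longrightarrow>
       pair_vec {1..k} {1..k'} \<in> W \<Longrightarrow> sector k k' \<subseteq> W"
proof -
  let ?S = "{(A, B). A \<subseteq> {1..N} \<and> B \<subseteq> {1..N} \<and> card A = k \<and> card B = k'}"
  have fin: "finite ?S" by (rule finite_subset[of _ "Pow {1..N} \<times> Pow {1..N}"]) auto
  have "\<exists>P. P \<noteq> 0 \<and> (\<forall>b\<in>?S. (\<lambda>e. poly P e \<odot> basis_vec b) \<in> reached k k')"
  proof (rule polynomial_basis_elimination[OF fin reached_zero reached_add reached_poly])
    show "\<exists>p. \<forall>e. g e b = poly p e" if "g \<in> reached k k'" for g b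
    proof -
      have "polyvec g" using that by (simp add: reached_def)
      then show ?thesis by (rule polyvec_coordinate)
    qed
    show "g e b = 0" if g: "g \<in> reached k k'" and b: "b \<notin> ?S" for g b e
    proof (rule ccontr)
      assume nz: "g e b \<noteq> 0"
      obtain A B where AB: "b = (A, B)" by (cases b)
      have "g e \<in> sector k k'" using g by (simp add: reached_def)
      from sectorD[OF this nz[unfolded AB]] b show False unfolding AB by simp
    qed
    show "\<exists>g\<in>reached k k'. g 0 = basis_vec b" if "b \<in> ?S" for b
    proof -
      obtain A B where AB: "b = (A, B)" by (cases b)
      have "pair_vec A B \<in> limit_space k k'" using that unfolding AB by (intro limit_space_all k) auto
      then obtain g where g: "pair_vec A B = g 0" "g \<in> reached k k'" by (rule limit_spaceE)
      show ?thesis by (rule bexI[OF _ g(2)]) (simp only: g(1)[symmetric] pair_vec_def AB)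
    qed
  qed
  then obtain P where P: "P \<noteq> 0" "\<And>b. b \<in> ?S \<Longrightarrow> (\<lambda>e. poly P e \<odot> basis_vec b) \<in> reached k k'" by blast
  show thesis
  proof (rule that[OF P(1)])
    fix z1 z2 W assume z: "z1 \<noteq> 0" "z2 \<noteq> 0" "poly P (z2 / z1) \<noteq> 0" and W: "submodule z1 z2 W" "pair_vec {1..k} {1..k'} \<in> W"
    have sub: "cfun.subspace W" using W(1) by (simp add: submodule_def)
    have "basis_vec b \<in> W" if "b \<in> ?S" for b
    proof -
      have "\<forall>z1 z2 W. z1 \<noteq> 0 \<longrightarrow> z2 \<noteq> 0 \<longrightarrow> submodule z1 z2 W \<longrightarrow> pair_vec {1..k} {1..k'} \<in> W \<longrightarrow>
          poly P (z2 / z1) \<odot> basis_vec b \<in> W"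
        using P(2)[OF that] unfolding reached_def mem_Collect_eq by (elim conjE)
      then have "poly P (z2 / z1) \<odot> basis_vec b \<in> W" using z(1,2) W by (simp only: simp_thms)
      from cfun.subspace_scale[OF sub this, of "inverse (poly P (z2 / z1))"] show ?thesis using z(3) by simp
    qed
    then have "(\<Sum>p\<in>?S. x p \<odot> basis_vec p) \<in> W" for x
      by (intro cfun.subspace_sum[OF sub] cfun.subspace_scale[OF sub]) auto
    then have "x \<in> W" if "x \<in> sector k k'" for x
      by (subst sector_expand[OF that])
    then show "sector k k' \<subseteq> W" by blast
  qed
qed

end

context braiding_setting
begin

section \<open>Uniqueness of the braiding\<close>

definition R_matrix :: "nat \<Rightarrow> nat \<Rightarrow> complex \<Rightarrow> endo" where
  "R_matrix k k' z = (-1) ^ min k k' \<bullet> A_endo (int k - int k') z"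

lemma R_matrix_sector: "x \<in> sector k k' \<Longrightarrow> ap (R_matrix k k' z) x \<in> sector k' k"
  by (simp add: R_matrix_def scl.rep_eq sector_scale A_endo_sector)

lemma R_matrix_equivariant:
  assumes "k \<le> N" "k' \<le> N" "z1 \<noteq> 0" "z2 \<noteq> 0" "regular (z1 / z2)" "x \<in> sector k k'"
  shows "i < N \<Longrightarrow> ap (R_matrix k k' (z1 / z2)) (ap (e_act z1 z2 i) x) = ap (e_act z2 z1 i) (ap (R_matrix k k' (z1 / z2)) x)"
    and "i < N \<Longrightarrow> ap (R_matrix k k' (z1 / z2)) (ap (f_act z1 z2 i) x) = ap (f_act z2 z1 i) (ap (R_matrix k k' (z1 / z2)) x)"
    and "ap (R_matrix k k' (z1 / z2)) (ap (t_act \<nu>) x) = ap (t_act \<nu>) (ap (R_matrix k k' (z1 / z2)) x)"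
  using A_endo_equivariant[OF assms] by (simp_all add: R_matrix_def scl.rep_eq ap_scale)

lemma R_matrix_top:
  "k \<le> N \<Longrightarrow> k' \<le> N \<Longrightarrow> regular z \<Longrightarrow>
    ap (R_matrix k k' z) (pair_vec {1..k} {1..k'}) = (-1) ^ (k * k') \<odot> pair_vec {1..k'} {1..k}"
  using A_endo_normalised by (simp add: R_matrix_def scl.rep_eq)

lemma linear_on_0: "linear_map_on S h \<Longrightarrow> 0 \<in> S \<Longrightarrow> h 0 = 0"
  unfolding linear_map_on_def by (metis cfun.scale_zero_left)

text \<open>Two intertwiners that agree on a generating vector agree everywhere.\<close>

lemma equalizer_submodule:
  assumes f: "linear_map_on (sector k k') f" and g: "linear_map_on (sector k k') g"
    and fe: "\<And>i x. i < N \<Longrightarrow> x \<in> sector k k' \<Longrightarrow> f (ap (e_act z1 z2 i) x) = a i (f x) \<and> f (ap (f_act z1 z2 i) x) = b i (f x)"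
    and ge: "\<And>i x. i < N \<Longrightarrow> x \<in> sector k k' \<Longrightarrow> g (ap (e_act z1 z2 i) x) = a i (g x) \<and> g (ap (f_act z1 z2 i) x) = b i (g x)"
  shows "submodule z1 z2 {x \<in> sector k k'. f x = g x}"
  unfolding submodule_def
proof (intro conjI allI impI ballI)
  show "cfun.subspace {x \<in> sector k k'. f x = g x}"
  proof (rule cfun.subspaceI)
    show "0 \<in> {x \<in> sector k k'. f x = g x}"
      using linear_on_0[OF f sector_zero] linear_on_0[OF g sector_zero] sector_zero by simp
  next
    fix x y assume "x \<in> {x \<in> sector k k'. f x = g x}" "y \<in> {x \<in> sector k k'. f x = g x}"
    then have *: "x \<in> sector k k'" "y \<in> sector k k'" "f x = g x" "f y = g y" by auto
    have "f (x + y) = f x + f y" "g (x + y) = g x + g y"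
      using f g *(1,2) unfolding linear_map_on_def by blast+
    then show "x + y \<in> {x \<in> sector k k'. f x = g x}" using * sector_add by simp
  next
    fix c x assume "x \<in> {x \<in> sector k k'. f x = g x}"
    then have *: "x \<in> sector k k'" "f x = g x" by auto
    have "f (c \<odot> x) = c \<odot> f x" "g (c \<odot> x) = c \<odot> g x"
      using f g *(1) unfolding linear_map_on_def by blast+
    then show "c \<odot> x \<in> {x \<in> sector k k'. f x = g x}" using * sector_scale by simp
  qed
next
  fix i u assume i: "i < N" and "u \<in> {x \<in> sector k k'. f x = g x}"
  then have u: "u \<in> sector k k'" "f u = g u" by auto
  show "ap (e_act z1 z2 i) u \<in> {x \<in> sector k k'. f x = g x}" "ap (f_act z1 z2 i) u \<in> {x \<in> sector k k'. f x = g x}"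
    using sector_ops[OF u(1) i] fe[OF i u(1)] ge[OF i u(1)] u(2) by simp_all
qed

lemma ap_linear_on: "linear_map_on S (ap T)"
  by (simp add: linear_map_on_def ap_add ap_scale)

lemma finite_nonregular: "finite {z. \<not> regular z}"
proof -
  have "{z. \<not> regular z} \<subseteq> (\<lambda>j. 1 / q ^ j) ` {..2 * Suc N + N}"
  proof
    fix z assume "z \<in> {z. \<not> regular z}"
    then obtain j where "j \<le> 2 * Suc N + N" "1 - q ^ j * z = 0" by (auto simp: regular_def)
    then show "z \<in> (\<lambda>j. 1 / q ^ j) ` {..2 * Suc N + N}"
      by (intro image_eqI[of _ _ j]) (auto simp: field_simps)
  qed
  then show ?thesis using finite_surj by blast
qed

lemma finite_reciprocals:
  fixes S :: "complex set" assumes "finite S" shows "finite {z. 1 / z \<in> S}"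
proof -
  have "{z. 1 / z \<in> S} \<subseteq> (\<lambda>z. 1 / z) ` S"
    by (auto intro!: image_eqI[of _ "\<lambda>z. 1 / z"])
  then show ?thesis using assms finite_surj by blast
qed

theorem R_matrix_unique_braiding:
  assumes k: "k \<le> N" "k' \<le> N"
  shows "\<exists>S :: complex set. finite S \<and>
    (\<forall>z1 z2. z1 \<noteq> 0 \<longrightarrow> z2 \<noteq> 0 \<longrightarrow> z1 / z2 \<notin> S \<longrightarrow>
      (\<forall>R. is_braiding q N k k' z1 z2 R \<longleftrightarrow> (\<forall>x\<in>sector k k'. R x = ap (R_matrix k k' (z1 / z2)) x)))"
proof -
  obtain P where P: "P \<noteq> 0" and cycP:
    "\<And>z1 z2 W. z1 \<noteq> 0 \<Longrightarrow> z2 \<noteq> 0 \<Longrightarrow> poly P (z2 / z1) \<noteq> 0 \<Longrightarrow> submodule z1 z2 W \<Longrightarrow>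
       pair_vec {1..k} {1..k'} \<in> W \<Longrightarrow> sector k k' \<subseteq> W"
    using generic_cyclicity[OF k] by blast
  obtain P' where P': "P' \<noteq> 0" and cycP':
    "\<And>z1 z2 W. z1 \<noteq> 0 \<Longrightarrow> z2 \<noteq> 0 \<Longrightarrow> poly P' (z2 / z1) \<noteq> 0 \<Longrightarrow> submodule z1 z2 W \<Longrightarrow>
       pair_vec {1..k'} {1..k} \<in> W \<Longrightarrow> sector k' k \<subseteq> W"
    using generic_cyclicity[OF k(2,1)] by blast
  define S where "S = {z. \<not> regular z} \<union> {z. 1 / z \<in> {z. \<not> regular z}}
    \<union> {z. 1 / z \<in> {z. poly P z = 0}} \<union> {z. poly P' z = 0}"
  have "finite S"
    unfolding S_def using P P'
    by (intro finite_UnI finite_reciprocals finite_nonregular poly_roots_finite)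
  moreover have "is_braiding q N k k' z1 z2 R \<longleftrightarrow> (\<forall>x\<in>sector k k'. R x = ap (R_matrix k k' (z1 / z2)) x)"
    if z: "z1 \<noteq> 0" "z2 \<noteq> 0" "z1 / z2 \<notin> S" for z1 z2 R
  proof -
    have reg: "regular (z1 / z2)" "regular (z2 / z1)" and nz: "poly P (z2 / z1) \<noteq> 0" "poly P' (z1 / z2) \<noteq> 0"
      using z(3) by (simp_all add: S_def)
    let ?M = "ext_tensor q N k z1 k' z2" and ?M' = "ext_tensor q N k' z2 k z1"
    let ?A = "R_matrix k k' (z1 / z2)" and ?B = "R_matrix k' k (z2 / z1)"
    note eA = R_matrix_equivariant[OF k z(1,2) reg(1)] and eB = R_matrix_equivariant[OF k(2,1) z(2,1) reg(2)]
    note actM = act_on_sector[where z = z1 and z' = z2 and k = k and k' = k']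
      and actM' = act_on_sector[where z = z2 and z' = z1 and k = k' and k' = k]
    have sg: "((-1) :: complex) ^ (k * k') * (-1) ^ (k' * k) = 1"
      by (simp add: mult.commute flip: power_mult_distrib)
    \<comment> \<open>Both composites with the braiding in the opposite direction fix a cyclic vector.\<close>
    have BA: "ap ?B (ap ?A x) = x" if x: "x \<in> sector k k'" for x
    proof -
      have "sector k k' \<subseteq> {x \<in> sector k k'. ap (?B * ?A) x = ap 1 x}"
      proof (rule cycP[OF z(1,2) nz(1)])
        show "submodule z1 z2 {x \<in> sector k k'. ap (?B * ?A) x = ap 1 x}"
          by (rule equalizer_submodule[OF ap_linear_on ap_linear_on,
              where a = "\<lambda>i. ap (e_act z1 z2 i)" and b = "\<lambda>i. ap (f_act z1 z2 i)"])
            (simp_all only: ap_one times_endo.rep_eq eA eB R_matrix_sector simp_thms)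
        show "pair_vec {1..k} {1..k'} \<in> {x \<in> sector k k'. ap (?B * ?A) x = ap 1 x}"
          using k sg by (simp add: ap_simps ap_scale R_matrix_top reg pair_vec_sector del: One_nat_def)
      qed
      then show ?thesis using x by (auto simp: ap_simps)
    qed
    have AB: "ap ?A (ap ?B x) = x" if x: "x \<in> sector k' k" for x
    proof -
      have "sector k' k \<subseteq> {x \<in> sector k' k. ap (?A * ?B) x = ap 1 x}"
      proof (rule cycP'[OF z(2,1) nz(2)])
        show "submodule z2 z1 {x \<in> sector k' k. ap (?A * ?B) x = ap 1 x}"
          by (rule equalizer_submodule[OF ap_linear_on ap_linear_on,
              where a = "\<lambda>i. ap (e_act z2 z1 i)" and b = "\<lambda>i. ap (f_act z2 z1 i)"])
            (simp_all only: ap_one times_endo.rep_eq eA eB R_matrix_sector simp_thms)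
        show "pair_vec {1..k'} {1..k} \<in> {x \<in> sector k' k. ap (?A * ?B) x = ap 1 x}"
          using k sg by (simp add: ap_simps ap_scale R_matrix_top reg pair_vec_sector mult.commute del: One_nat_def)
      qed
      then show ?thesis using x by (auto simp: ap_simps)
    qed
    have bij: "bij_betw (ap ?A) (sector k k') (sector k' k)"
      by (rule bij_betw_byWitness[where f' = "ap ?B"]) (use BA AB R_matrix_sector in auto)
    show ?thesis
    proof
      assume br: "is_braiding q N k k' z1 z2 R"
      note iso = br[unfolded is_braiding_def is_uq_iso_def space_tensor tensor_v_top]
      have R: "linear_map_on (sector k k') R" "R (pair_vec {1..k} {1..k'}) = (-1) ^ (k * k') \<odot> pair_vec {1..k'} {1..k}"
        by (insert iso, elim conjE, assumption)+
      have into: "R x \<in> sector k' k" if "x \<in> sector k k'" for x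
      proof -
        have "bij_betw R (sector k k') (sector k' k)" by (insert iso, elim conjE, assumption)
        then show ?thesis using that unfolding bij_betw_def by blast
      qed
      have act: "R (act_e ?M i x) = act_e ?M' i (R x)" "R (act_f ?M i x) = act_f ?M' i (R x)"
        if "i < N" "x \<in> sector k k'" for i x
        using conjunct2[OF conjunct2[OF conjunct2[OF conjunct2[OF conjunct1[OF iso]]]]] that by blast+
      have Re: "R (ap (e_act z1 z2 i) x) = ap (e_act z2 z1 i) (R x)" and Rf: "R (ap (f_act z1 z2 i) x) = ap (f_act z2 z1 i) (R x)"
        if "i < N" "x \<in> sector k k'" for i x
        using act[OF that] actM(1,2)[OF that(2,1)] actM'(1,2)[OF into[OF that(2)] that(1)] by (simp_all only:)
      have "sector k k' \<subseteq> {x \<in> sector k k'. R x = ap ?A x}"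
      proof (rule cycP[OF z(1,2) nz(1)])
        show "submodule z1 z2 {x \<in> sector k k'. R x = ap ?A x}"
          by (rule equalizer_submodule[OF R(1) ap_linear_on,
              where a = "\<lambda>i. ap (e_act z2 z1 i)" and b = "\<lambda>i. ap (f_act z2 z1 i)"])
            (simp_all only: Re Rf eA simp_thms)
        show "pair_vec {1..k} {1..k'} \<in> {x \<in> sector k k'. R x = ap ?A x}"
          using k by (simp add: R(2) R_matrix_top reg pair_vec_sector del: One_nat_def)
      qed
      then show "\<forall>x\<in>sector k k'. R x = ap ?A x" by blast
    next
      assume R: "\<forall>x\<in>sector k k'. R x = ap ?A x"
      then have R': "R x = ap ?A x" if "x \<in> sector k k'" for x using that by blast
      have "linear_map_on (sector k k') R"
        unfolding linear_map_on_def by (simp add: R' sector_add sector_scale ap_add ap_scale)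
      moreover have "bij_betw R (sector k k') (sector k' k)"
        using bij R' by (simp cong: bij_betw_cong)
      moreover have "R (act_e ?M i x) = act_e ?M' i (R x)" "R (act_f ?M i x) = act_f ?M' i (R x)"
        if "i < N" "x \<in> sector k k'" for i x
        using that by (simp_all only: actM actM' R' sector_ops R_matrix_sector eA)
      moreover have "R (act_t ?M \<nu> x) = act_t ?M' \<nu> (R x)" if "x \<in> sector k k'" for \<nu> x
        using that by (simp only: actM actM' R' sector_t_act R_matrix_sector eA)
      moreover have "R (pair_vec {1..k} {1..k'}) = (-1) ^ (k * k') \<odot> pair_vec {1..k'} {1..k}"
      proof -
        have "pair_vec {1..k} {1..k'} \<in> sector k k'" using k by (intro pair_vec_sector) auto
        then show ?thesis using R' R_matrix_top[OF k reg(1)] by simp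
      qed
      ultimately show "is_braiding q N k k' z1 z2 R"
        unfolding is_braiding_def is_uq_iso_def space_tensor tensor_v_top
        using module_ext_tensor[OF z(1,2)] module_ext_tensor[OF z(2,1)]
        by (intro conjI ballI allI impI) (simp_all only:)
    qed
  qed
  ultimately show ?thesis by blast
qed

end

theorem theorem2p6:
  fixes N k k' :: nat and q :: complex
  assumes "N \<ge> 2" and "k \<le> N" and "k' \<le> N"
    and "q \<noteq> 0" and "\<forall>n\<ge>1. q ^ n \<noteq> 1"
  shows "\<exists>S :: complex set. finite S \<and>
    (\<forall>z1 z2. z1 \<noteq> 0 \<longrightarrow> z2 \<noteq> 0 \<longrightarrow> z1 / z2 \<notin> S \<longrightarrow>
      (\<forall>R. is_braiding q N k k' z1 z2 R \<longleftrightarrow>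
        (\<forall>x\<in>space_of (ext_tensor q N k z1 k' z2).
          R x = (-1) ^ min k k' \<odot>
            A_op q N (Min {k, k', N - k, N - k'}) (int k - int k') (z1 / z2) x)))"
proof -
  interpret braiding_setting q N
    by unfold_locales (use assms in auto)
  have "(-1) ^ min k k' \<odot> A_op q N (Min {k, k', N - k, N - k'}) (int k - int k') z x = ap (R_matrix k k' z) x"
    if "x \<in> sector k k'" for x z
    using A_op_eval[OF that assms(2,3)] by (simp add: R_matrix_def scl.rep_eq)
  then show ?thesis
    using R_matrix_unique_braiding[OF assms(2,3)] unfolding space_tensor by simp
qed

end
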